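(* Let $G$ be a nilpotent group of nilpotency class $c\ge1$ acting transitively on a finite set $\Omega$. If $S\subseteq G$ is any finite symmetric multiset, then $$gap(G\circlearrowleft\Omega,S)\ \le\ 5\,|\Omega|^{-f(|S|,c)},$$ where $f(|S|,c):=\dfrac{2(|S|-1)}{|S|\,(|S|^{c+1}-|S|^2+|S|-1)}\ \ge\ |S|^{-c-1}$.
   Context: For a finite $d$-regular undirected graph $\Gamma$ (loops and multiple edges allowed), the averaging operator is $\mathbf M\mathbf v(x)=\frac1d\sum_{y\sim x}\mathbf v(y)$ (with multiplicity); its eigenvalues are $1=\lambda_1\ge\lambda_2\ge\dots\ge-1$ and $gap(\Gamma):=1-\lambda_2$. A multiset $S\subseteq G$ is symmetric if each element appears with the same multiplicity as its inverse. The Schreier graph $Sch(G\circlearrowleft\Omega,S)$ has vertex set $\Omega$ and edges $(\omega,\omega^s)$ for $\omega\in\Omega$, $s\in S$ (with multiplicity), and $gap(G\circlearrowleft\Omega,S):=gap(Sch(G\circlearrowleft\Omega,S))$. *)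

theory Defs
  imports
    Complex_Main
    "HOL-Library.Multiset"
    "HOL-Algebra.Group_Action"
    "HOL-Algebra.Generated_Groups"
    "Jordan_Normal_Form.Char_Poly"
begin

section \<open>Spectral gap of a finite regular multigraph\<close>

text \<open>
  An undirected multigraph is given by its multiset of oriented edges: an edge joining
  \<open>x \<noteq> y\<close> occurs as \<open>(x, y)\<close> and as \<open>(y, x)\<close>, and each
  occurrence of \<open>(x, x)\<close> adds one to the degree of \<open>x\<close>.
\<close>

record 'a multigraph =
  vertices :: "'a set"
  darts :: "('a \<times> 'a) multiset"

definition darts_from :: "'a multigraph \<Rightarrow> 'a \<Rightarrow> ('a \<times> 'a) multiset" where
  "darts_from \<Gamma> x = filter_mset (\<lambda>e. fst e = x) (darts \<Gamma>)"

definition regular_multigraph :: "'a multigraph \<Rightarrow> nat \<Rightarrow> bool" where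
  "regular_multigraph \<Gamma> d \<longleftrightarrow>
     finite (vertices \<Gamma>) \<and>
     set_mset (darts \<Gamma>) \<subseteq> vertices \<Gamma> \<times> vertices \<Gamma> \<and>
     (\<forall>x y. count (darts \<Gamma>) (x, y) = count (darts \<Gamma>) (y, x)) \<and>
     (\<forall>x \<in> vertices \<Gamma>. size (darts_from \<Gamma> x) = d)"

definition averaging :: "'a multigraph \<Rightarrow> ('a \<Rightarrow> real) \<Rightarrow> 'a \<Rightarrow> real" where
  "averaging \<Gamma> v x = 1 / real (size (darts_from \<Gamma> x)) * (\<Sum>e\<in>#darts_from \<Gamma> x. v (snd e))"

text \<open>
  The matrix of the averaging operator in the basis of indicator functions of vertices, for
  some enumeration of the vertices.  Its characteristic polynomial does not depend on the
  enumeration.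
\<close>

definition vertex_list :: "'a multigraph \<Rightarrow> 'a list" where
  "vertex_list \<Gamma> = (SOME xs. distinct xs \<and> set xs = vertices \<Gamma>)"

definition averaging_matrix :: "'a multigraph \<Rightarrow> real mat" where
  "averaging_matrix \<Gamma> =
     (let xs = vertex_list \<Gamma>; n = length xs
      in mat n n (\<lambda>(i, j). averaging \<Gamma> (\<lambda>y. if y = xs ! j then 1 else 0) (xs ! i)))"

text \<open>
  The eigenvalues in decreasing order, with multiplicity.  For an undirected regular graph the
  matrix is symmetric, so that all its eigenvalues are real and the list has one entry per vertex.
\<close>

definition eigenvalue_list :: "'a multigraph \<Rightarrow> real list" where
  "eigenvalue_list \<Gamma> = rev (sorted_list_of_multiset (proots (char_poly (averaging_matrix \<Gamma>))))"

text \<open>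
  List indices start at 0, so \<open>\<lambda>\<^sub>2\<close> is the entry with index 1.  A graph with
  fewer than two vertices has no second eigenvalue; its gap is 0 by convention.
\<close>

definition spectral_gap :: "'a multigraph \<Rightarrow> real" where
  "spectral_gap \<Gamma> =
     (if card (vertices \<Gamma>) \<ge> 2 then 1 - eigenvalue_list \<Gamma> ! 1 else 0)"


section \<open>Schreier graphs\<close>

definition symmetric_mset :: "('g, 'm) monoid_scheme \<Rightarrow> 'g multiset \<Rightarrow> bool" where
  "symmetric_mset G S \<longleftrightarrow>
     set_mset S \<subseteq> carrier G \<and> (\<forall>g \<in> carrier G. count S (inv\<^bsub>G\<^esub> g) = count S g)"

text \<open>
  Actions are left actions, as in the library.  A right action corresponds to the left
  action of the inverses, and for symmetric \<open>S\<close> both have the same Schreier graph.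
\<close>

definition schreier_graph :: "('g \<Rightarrow> 'a \<Rightarrow> 'a) \<Rightarrow> 'a set \<Rightarrow> 'g multiset \<Rightarrow> 'a multigraph" where
  "schreier_graph \<phi> \<Omega> S =
     \<lparr>vertices = \<Omega>, darts = (\<Sum>\<omega>\<in>\<Omega>. image_mset (\<lambda>s. (\<omega>, \<phi> s \<omega>)) S)\<rparr>"

definition action_gap :: "('g \<Rightarrow> 'a \<Rightarrow> 'a) \<Rightarrow> 'a set \<Rightarrow> 'g multiset \<Rightarrow> real" where
  "action_gap \<phi> \<Omega> S = spectral_gap (schreier_graph \<phi> \<Omega> S)"

lemma count_darts_schreier_graph:
  assumes "finite \<Omega>"
  shows "count (darts (schreier_graph \<phi> \<Omega> S)) (x, y) =
           (if x \<in> \<Omega> then size (filter_mset (\<lambda>s. \<phi> s x = y) S) else 0)"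
proof -
  have "count (image_mset (\<lambda>s. (\<omega>, \<phi> s \<omega>)) S) (x, y) =
          (if \<omega> = x then size (filter_mset (\<lambda>s. \<phi> s x = y) S) else 0)" for \<omega>
    by (induction S) auto
  then show ?thesis
    using assms by (simp add: schreier_graph_def count_sum)
qed

lemma darts_from_schreier_graph:
  assumes "finite \<Omega>" "x \<in> \<Omega>"
  shows "darts_from (schreier_graph \<phi> \<Omega> S) x = image_mset (\<lambda>s. (x, \<phi> s x)) S"
proof (rule multiset_eqI)
  fix e :: "'a \<times> 'a"
  obtain a b where e: "e = (a, b)" by (cases e)
  have "count (image_mset (\<lambda>s. (x, \<phi> s x)) S) (a, b) =
          (if x = a then size (filter_mset (\<lambda>s. \<phi> s a = b) S) else 0)"
    by (induction S) auto
  then show "count (darts_from (schreier_graph \<phi> \<Omega> S) x) e =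
             count (image_mset (\<lambda>s. (x, \<phi> s x)) S) e"
    using assms by (auto simp: e darts_from_def count_darts_schreier_graph)
qed

lemma regular_schreier_graph:
  fixes G (structure)
  assumes act: "group_action G \<Omega> \<phi>" and fin: "finite \<Omega>" and S: "symmetric_mset G S"
  shows "regular_multigraph (schreier_graph \<phi> \<Omega> S) (size S)"
proof -
  interpret group_action G \<Omega> \<phi> by (fact act)
  interpret group G using group_hom group_hom.axioms(1) by blast
  have SG: "set_mset S \<subseteq> carrier G" using S by (simp add: symmetric_mset_def)
  have inv_S: "image_mset (\<lambda>s. inv s) S = S"
  proof (rule multiset_eqI)
    fix g
    show "count (image_mset (\<lambda>s. inv s) S) g = count S g"
    proof (cases "g \<in> carrier G")
      case True
      have "(\<lambda>s. inv s) -` {g} \<inter> set_mset S = {inv g} \<inter> set_mset S"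
        using True SG by auto
      moreover have "count S (inv g) = count S g"
        using S True by (simp add: symmetric_mset_def)
      ultimately show ?thesis
        by (cases "inv g \<in># S") (auto simp: count_image_mset not_in_iff)
    next
      case False
      then have "g \<notin># S" "g \<notin># image_mset (\<lambda>s. inv s) S" using SG by auto
      then show ?thesis by (simp only: not_in_iff)
    qed
  qed
  have mem: "\<phi> s x \<in> \<Omega>" if "s \<in># S" "x \<in> \<Omega>" for s x
    using that SG element_image by blast
  have sym: "size (filter_mset (\<lambda>s. \<phi> s x = y) S) = size (filter_mset (\<lambda>s. \<phi> s y = x) S)"
    if "x \<in> \<Omega>" "y \<in> \<Omega>" for x y
  proof -
    have "size (filter_mset (\<lambda>s. \<phi> s y = x) (image_mset (\<lambda>s. inv s) S)) =
          size (filter_mset (\<lambda>s. \<phi> (inv s) y = x) S)"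
      by (simp add: filter_mset_image_mset)
    also have "filter_mset (\<lambda>s. \<phi> (inv s) y = x) S = filter_mset (\<lambda>s. \<phi> s x = y) S"
    proof (rule filter_mset_cong[OF refl])
      fix s assume "s \<in># S"
      then have s: "s \<in> carrier G" using SG by blast
      show "(\<phi> (inv s) y = x) = (\<phi> s x = y)"
        using orbit_sym_aux[OF s that(1)] orbit_sym_aux[OF inv_closed[OF s] that(2)]
        by (metis inv_inv s)
    qed
    finally show ?thesis by (simp add: inv_S)
  qed
  have none: "filter_mset (\<lambda>s. \<phi> s x = y) S = {#}" if "x \<in> \<Omega>" "y \<notin> \<Omega>" for x y
    using mem[OF _ that(1)] that(2) by auto
  show ?thesis
    unfolding regular_multigraph_def
  proof (intro conjI allI ballI)
    show "set_mset (darts (schreier_graph \<phi> \<Omega> S)) \<subseteq>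
            vertices (schreier_graph \<phi> \<Omega> S) \<times> vertices (schreier_graph \<phi> \<Omega> S)"
      using fin mem by (auto simp: schreier_graph_def set_mset_sum)
    show "count (darts (schreier_graph \<phi> \<Omega> S)) (x, y) =
          count (darts (schreier_graph \<phi> \<Omega> S)) (y, x)" for x y
      using sym none by (auto simp: count_darts_schreier_graph[OF fin])
    show "size (darts_from (schreier_graph \<phi> \<Omega> S) x) = size S"
      if "x \<in> vertices (schreier_graph \<phi> \<Omega> S)" for x
    proof -
      have "x \<in> \<Omega>" using that by (simp add: schreier_graph_def)
      then show ?thesis by (simp add: darts_from_schreier_graph[OF fin])
    qed
  qed (simp add: schreier_graph_def fin)
qed


section \<open>Nilpotency class\<close>

text \<open>
  The indexing of the lower central series starts at 0: \<open>lower_central G n\<close> is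
  \<open>\<gamma>\<^sub>n\<^sub>+\<^sub>1(G)\<close>.
\<close>

primrec lower_central :: "('g, 'm) monoid_scheme \<Rightarrow> nat \<Rightarrow> 'g set" where
  "lower_central G 0 = carrier G"
| "lower_central G (Suc n) =
     generate G {x \<otimes>\<^bsub>G\<^esub> y \<otimes>\<^bsub>G\<^esub> inv\<^bsub>G\<^esub> x \<otimes>\<^bsub>G\<^esub> inv\<^bsub>G\<^esub> y | x y. x \<in> lower_central G n \<and> y \<in> carrier G}"

definition nilpotent_of_class :: "('g, 'm) monoid_scheme \<Rightarrow> nat \<Rightarrow> bool" where
  "nilpotent_of_class G c \<longleftrightarrow>
     group G \<and> lower_central G c = {\<one>\<^bsub>G\<^esub>} \<and> (\<forall>i<c. lower_central G i \<noteq> {\<one>\<^bsub>G\<^esub>})"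


section \<open>The exponent\<close>

text \<open>
  For \<open>k \<le> 1\<close> the denominator vanishes, so that the exponent is 0 by the convention
  \<open>x / 0 = 0\<close>.
\<close>

definition gap_exponent :: "nat \<Rightarrow> nat \<Rightarrow> real" where
  "gap_exponent k c =
     2 * (real k - 1) / (real k * (real k ^ (c + 1) - real k ^ 2 + real k - 1))"

end

theory Submission
  imports Defs "HOL-Algebra.Multiplicative_Group"
begin

text \<open>
  If \<open>S\<close> does not act transitively, the eigenvalue belonging to the constant functions is
  multiple.  Otherwise we may assume that \<open>S\<close> generates \<open>G\<close>.  Let \<open>H\<close> be the stabilizer
  of a point, \<open>m\<close> the index of \<open>H\<gamma>\<^sub>2(G)\<close>, and \<open>k = |S|\<close>.

  The \<open>m\<close> characters of \<open>G / H\<gamma>\<^sub>2(G)\<close> lift to eigenfunctions on \<open>\<Omega>\<close>.  If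
  \<open>m > 2\<^sup>k\<close>, two of them are close on all of \<open>S\<close> by the pigeonhole principle, and
  their quotient gives an eigenvalue close to 1.  If \<open>m\<close> is smaller, it suffices that the trace of
  the averaging operator on \<open>G / H\<gamma>\<^sub>2(G)\<close> is not negative, except for \<open>m = 4\<close> and
  \<open>k = 2\<close>, where two of the nontrivial characters lie in a common quadrant.  In all cases the gap is at
  most \<open>5 m powr (- 2 / k)\<close>.

  The layer \<open>\<gamma>\<^sub>i / \<gamma>\<^sub>i\<^sub>+\<^sub>1\<close> is generated by the left-normed commutators of weight \<open>i\<close> in
  a set that contains the involutions of \<open>S\<close> and one element of each pair of mutually inverse
  elements.  By multilinearity the \<open>m\<^sup>i\<close>-th power of such a commutator lies in
  \<open>H\<gamma>\<^sub>i\<^sub>+\<^sub>1\<close>, and already its square lies in \<open>\<gamma>\<^sub>i\<^sub>+\<^sub>1\<close> if it involves an involution.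
  Counting these commutators shows that the layer contributes a factor of at most \<open>m\<close> to the power
  \<open>k\<^sup>i\<close> to \<open>|\<Omega>|\<close>, so that \<open>|\<Omega>|\<close> is at most \<open>m\<close> to the power
  \<open>1 + k\<^sup>2 + \<dots> + k\<^sup>c\<close>, which is \<open>2 / (k f(k, c))\<close>.
\<close>

section \<open>Eigenvectors and the spectral gap\<close>

text \<open>
  Let \<open>R\<close> be the identity matrix with rows \<open>p\<close> and \<open>q\<close> replaced by \<open>u\<close> and \<open>v\<close>.  Multiplying
  the transposed characteristic matrix by \<open>R\<close> makes these two rows divisible by \<open>X - l\<close> and
  \<open>X - m\<close>, which covers \<open>l = m\<close> as well.
\<close>

lemma char_poly_two_eigenvectors:
  fixes A :: "real mat" and u v :: "real vec"
  assumes A: "A \<in> carrier_mat n n" and u: "u \<in> carrier_vec n" and v: "v \<in> carrier_vec n"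
    and Au: "A *\<^sub>v u = l \<cdot>\<^sub>v u" and Av: "A *\<^sub>v v = m \<cdot>\<^sub>v v"
    and pq: "p < n" "q < n" "u $ p * v $ q \<noteq> u $ q * v $ p"
  shows "[:- l, 1:] * [:- m, 1:] dvd char_poly A"
proof -
  define C where "C = char_poly_matrix A"
  define R0 where "R0 = mat n n (\<lambda>(i, j). if i = p then u $ j else if i = q then v $ j
                                   else if i = j then (1::real) else 0)"
  define R where "R = map_mat (\<lambda>a. [:a:]) R0"
  \<comment> \<open>What remains of \<open>R * transpose_mat C\<close> once the factors X - l and X
    - m have been taken out of rows \<open>p\<close> and \<open>q\<close>; all other rows of
    \<open>R\<close> are unit vectors and merely pick out rows of
    \<open>transpose_mat C\<close>.\<close>
  define D where "D = mat n n (\<lambda>(i, j). if i = p then [:u $ j:] else if i = q then [:v $ j:]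
                                   else C $$ (j, i))"
  have "p \<noteq> q" using pq by auto
  have C: "C \<in> carrier_mat n n" using A by (simp add: C_def)
  have R0: "R0 \<in> carrier_mat n n" by (simp add: R0_def)
  have R: "R \<in> carrier_mat n n" by (simp add: R_def R0_def)
  have D: "D \<in> carrier_mat n n" by (simp add: D_def)
  have Cij: "C $$ (j, k) = (if j = k then [:0, 1:] else 0) + [:- A $$ (j, k):]"
    if "j < n" "k < n" for j k
    using A that by (auto simp: C_def char_poly_matrix_def)
  have eig: "(\<Sum>k<n. [:w $ k:] * C $$ (j, k)) = [:- a, 1:] * [:w $ j:]"
    if w: "w \<in> carrier_vec n" "A *\<^sub>v w = a \<cdot>\<^sub>v w" and j: "j < n" for w a j
  proof -
    have "(A *\<^sub>v w) $ j = a * w $ j" using w j by simp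
    then have s: "(\<Sum>k<n. A $$ (j, k) * w $ k) = a * w $ j"
      using A w(1) j by (simp add: scalar_prod_def lessThan_atLeast0)
    have "(\<Sum>k<n. [:w $ k:] * C $$ (j, k)) =
          (\<Sum>k<n. (if j = k then [:0, w $ j:] else 0) + [:- (A $$ (j, k) * w $ k):])"
      by (intro sum.cong) (auto simp: Cij j)
    also have "\<dots> = [:0, w $ j:] + [:- (\<Sum>k<n. A $$ (j, k) * w $ k):]"
    proof -
      have "(\<Sum>k\<in>K. [:f k:]) = [:\<Sum>k\<in>K. f k:]" if "finite K" for K and f :: "nat \<Rightarrow> real"
        using that by (induction K) auto
      from this[of "{..<n}"] show ?thesis
        using j by (simp add: sum.distrib sum_negf)
    qed
    finally show ?thesis using s by simp
  qed
  have "R * transpose_mat C = multrow p [:- l, 1:] (multrow q [:- m, 1:] D)"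
  proof (rule eq_matI)
    fix i j
    assume "i < dim_row (multrow p [:- l, 1:] (multrow q [:- m, 1:] D))"
      "j < dim_col (multrow p [:- l, 1:] (multrow q [:- m, 1:] D))"
    then have ij: "i < n" "j < n" by (auto simp: mat_multrow_def D_def)
    have e: "(R * transpose_mat C) $$ (i, j) = (\<Sum>k<n. [:R0 $$ (i, k):] * C $$ (j, k))"
      using C R ij by (auto simp: scalar_prod_def lessThan_atLeast0 R_def R0_def intro!: sum.cong)
    consider "i = p" | "i = q" | "i \<noteq> p" "i \<noteq> q" by blast
    then show "(R * transpose_mat C) $$ (i, j) =
               multrow p [:- l, 1:] (multrow q [:- m, 1:] D) $$ (i, j)"
    proof cases
      case 1
      have "(R * transpose_mat C) $$ (i, j) = (\<Sum>k<n. [:u $ k:] * C $$ (j, k))"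
        unfolding e using 1 ij by (intro sum.cong) (auto simp: R0_def)
      with eig[OF u Au ij(2)] show ?thesis
        using 1 ij \<open>p \<noteq> q\<close> by (simp add: mat_multrow_def D_def)
    next
      case 2
      have "(R * transpose_mat C) $$ (i, j) = (\<Sum>k<n. [:v $ k:] * C $$ (j, k))"
        unfolding e using 2 ij \<open>p \<noteq> q\<close> by (intro sum.cong) (auto simp: R0_def)
      with eig[OF v Av ij(2)] show ?thesis
        using 2 ij \<open>p \<noteq> q\<close> by (simp add: mat_multrow_def D_def)
    next
      case 3
      have "(R * transpose_mat C) $$ (i, j) = (\<Sum>k<n. if i = k then C $$ (j, k) else 0)"
        unfolding e using 3 ij by (intro sum.cong) (auto simp: R0_def)
      then show ?thesis using 3 ij by (simp add: mat_multrow_def D_def)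
    qed
  qed (use C R in \<open>auto simp: mat_multrow_def D_def\<close>)
  then have "det (R * transpose_mat C) = [:- l, 1:] * ([:- m, 1:] * det D)"
  proof -
    have "multrow q [:- m, 1:] D \<in> carrier_mat n n" using D by (simp add: mat_multrow_def)
    then show ?thesis
      by (simp only: \<open>R * transpose_mat C = _\<close> det_multrow[OF pq(1)] det_multrow[OF pq(2) D])
  qed
  moreover have "det (R * transpose_mat C) = det R * char_poly A"
    using det_mult[OF R, of "transpose_mat C"] det_transpose[OF C] C
    by (simp add: char_poly_def C_def)
  moreover have "det R = [:det R0:]"
  proof -
    interpret comm_ring_hom "\<lambda>a::real. [:a:]" by unfold_locales auto
    show ?thesis unfolding R_def by (rule hom_det)
  qed
  \<comment> \<open>This determinant is the minor \<open>u $ p * v $ q - u $ q * v $ p\<close>.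
    Rather than expanding it, one shows that the kernel is trivial: the unit rows force a kernel
    vector to vanish outside \<open>p\<close> and \<open>q\<close>, and Cramer's rule for the
    remaining 2 by 2 system does the rest.\<close>
  moreover have "det R0 \<noteq> 0"
  proof
    assume "det R0 = 0"
    then obtain w where w: "w \<in> carrier_vec n" "w \<noteq> 0\<^sub>v n" "R0 *\<^sub>v w = 0\<^sub>v n"
      using det_0_iff_vec_prod_zero[OF R0] by blast
    have row: "(\<Sum>k<n. R0 $$ (i, k) * w $ k) = 0" if "i < n" for i
    proof -
      have "(R0 *\<^sub>v w) $ i = (\<Sum>k<n. R0 $$ (i, k) * w $ k)"
        using R0 w(1) that by (simp add: scalar_prod_def lessThan_atLeast0)
      then show ?thesis using w(3) that by simp
    qed
    have w0: "w $ i = 0" if "i < n" "i \<noteq> p" "i \<noteq> q" for i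
    proof -
      have "(\<Sum>k<n. R0 $$ (i, k) * w $ k) = (\<Sum>k<n. if i = k then w $ k else 0)"
        using that by (intro sum.cong) (auto simp: R0_def)
      then show ?thesis using row[OF that(1)] that by simp
    qed
    have two: "(\<Sum>k<n. f k * w $ k) = f p * w $ p + f q * w $ q" for f
    proof -
      have "(\<Sum>k<n. f k * w $ k) = (\<Sum>k\<in>{p, q}. f k * w $ k)"
        using pq w0 by (intro sum.mono_neutral_right) auto
      then show ?thesis using \<open>p \<noteq> q\<close> by simp
    qed
    have "(\<Sum>k<n. u $ k * w $ k) = (\<Sum>k<n. R0 $$ (p, k) * w $ k)"
      "(\<Sum>k<n. v $ k * w $ k) = (\<Sum>k<n. R0 $$ (q, k) * w $ k)"
      using pq \<open>p \<noteq> q\<close> by (auto simp: R0_def intro!: sum.cong)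
    then have eqs: "u $ p * w $ p + u $ q * w $ q = 0" "v $ p * w $ p + v $ q * w $ q = 0"
      using row pq by (simp_all add: two)
    have "(u $ p * v $ q - u $ q * v $ p) * w $ p =
          v $ q * (u $ p * w $ p + u $ q * w $ q) - u $ q * (v $ p * w $ p + v $ q * w $ q)"
      "(u $ p * v $ q - u $ q * v $ p) * w $ q =
          u $ p * (v $ p * w $ p + v $ q * w $ q) - v $ p * (u $ p * w $ p + u $ q * w $ q)"
      by (simp_all add: algebra_simps)
    then have "(u $ p * v $ q - u $ q * v $ p) * w $ p = 0"
      "(u $ p * v $ q - u $ q * v $ p) * w $ q = 0"
      by (simp_all only: eqs mult_zero_right diff_0_right)
    then have "w $ p = 0" "w $ q = 0" using pq(3) by simp_all
    with w0 have "w = 0\<^sub>v n" using w(1) by (intro eq_vecI) auto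
    with w(2) show False ..
  qed
  ultimately have "[:det R0:] * char_poly A = [:- l, 1:] * [:- m, 1:] * det D"
    by (simp only: mult.assoc)
  then have "Polynomial.smult (det R0) (char_poly A) = [:- l, 1:] * [:- m, 1:] * det D"
    by (simp only: mult_pCons_left pCons_0_0 mult_zero_left add_0_right)
  then have "char_poly A = [:- l, 1:] * [:- m, 1:] * Polynomial.smult (1 / det R0) (det D)"
  proof -
    have "char_poly A = Polynomial.smult (1 / det R0) (Polynomial.smult (det R0) (char_poly A))"
      using \<open>det R0 \<noteq> 0\<close> by simp
    also have "\<dots> = Polynomial.smult (1 / det R0) ([:- l, 1:] * [:- m, 1:] * det D)"
      by (simp only: \<open>Polynomial.smult (det R0) (char_poly A) = _\<close>)
    finally show ?thesis by (simp only: mult_smult_right)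
  qed
  then show ?thesis by (rule dvdI)
qed

text \<open>In the decreasing list only the head can exceed the entry with index 1. If both
  \<open>a\<close> and \<open>b\<close> exceeded it, each would equal the head and occur only once,
  which contradicts the two occurrences counted in \<open>{#a, b#}\<close>, also when a = b.\<close>

lemma second_largest_ge:
  assumes "{#a, b#} \<subseteq># (M :: real multiset)"
  shows "min a b \<le> rev (sorted_list_of_multiset M) ! 1"
proof -
  define xs where "xs = rev (sorted_list_of_multiset M)"
  have mset: "mset xs = M" by (simp add: xs_def)
  have sorted: "sorted (rev xs)" by (simp add: xs_def)
  have "size {#a, b#} \<le> size M" using assms by (rule size_mset_mono)
  also have "size M = length xs" by (simp flip: mset)
  finally have len: "2 \<le> length xs" by simp
  obtain y z zs where xs: "xs = y # z # zs"
  proof (cases xs rule: remdups_adj.cases)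
    case (3 y z zs)
    then show ?thesis using that by blast
  qed (use len in auto)
  have le: "x \<le> z" if "x \<in> set zs" for x using sorted that by (simp add: xs sorted_append)
  show ?thesis
  proof (rule ccontr)
    assume "\<not> ?thesis"
    then have "z < a" "z < b" by (auto simp: xs_def[symmetric] xs)
    then have "a \<notin># mset (z # zs)" "b \<notin># mset (z # zs)" using le by fastforce+
    then have "count M a = (if a = y then 1 else 0)" "count M b = (if b = y then 1 else 0)"
      unfolding mset[symmetric] xs by (auto simp: not_in_iff)
    moreover have "count {#a, b#} a \<le> count M a" "count {#a, b#} b \<le> count M b"
      using assms by (intro mset_subset_eq_count; assumption)+
    ultimately show False by (auto split: if_splits)
  qed
qed

text \<open>The nonzero minor at \<open>x\<close> and \<open>y\<close> makes the two eigenfunctions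
  linearly independent, so (X - l)(X - m) divides the characteristic polynomial and the pair
  \<open>l\<close>, \<open>m\<close> occurs with multiplicity in the eigenvalue list. The form with
  a minor avoids any case distinction between l = m and l \<noteq> m.\<close>

lemma spectral_gap_le:
  assumes fin: "finite (vertices \<Gamma>)" and sub: "snd ` set_mset (darts \<Gamma>) \<subseteq> vertices \<Gamma>"
    and u: "\<And>x. x \<in> vertices \<Gamma> \<Longrightarrow> averaging \<Gamma> u x = l * u x"
    and v: "\<And>x. x \<in> vertices \<Gamma> \<Longrightarrow> averaging \<Gamma> v x = m * v x"
    and xy: "x \<in> vertices \<Gamma>" "y \<in> vertices \<Gamma>" "u x * v y \<noteq> u y * v x"
  shows "spectral_gap \<Gamma> \<le> 1 - min l m"
proof -
  define xs where "xs = vertex_list \<Gamma>"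
  define n where "n = length xs"
  define A where "A = averaging_matrix \<Gamma>"
  have "\<exists>xs. distinct xs \<and> set xs = vertices \<Gamma>"
    using finite_distinct_list[OF fin] by blast
  from someI_ex[OF this] have xs: "distinct xs" "set xs = vertices \<Gamma>"
    by (simp_all add: xs_def vertex_list_def)
  have A: "A \<in> carrier_mat n n"
    by (simp add: A_def averaging_matrix_def Let_def n_def xs_def)
  have eig: "A *\<^sub>v vec n (\<lambda>i. w (xs ! i)) = a \<cdot>\<^sub>v vec n (\<lambda>i. w (xs ! i))"
    if w: "\<And>x. x \<in> vertices \<Gamma> \<Longrightarrow> averaging \<Gamma> w x = a * w x" for w a
  proof (rule eq_vecI)
    fix i assume "i < dim_vec (a \<cdot>\<^sub>v vec n (\<lambda>i. w (xs ! i)))"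
    then have i: "i < n" by simp
    define x where "x = xs ! i"
    have x: "x \<in> vertices \<Gamma>" using i xs by (auto simp: x_def n_def)
    have "(A *\<^sub>v vec n (\<lambda>i. w (xs ! i))) $ i =
          (\<Sum>j<n. averaging \<Gamma> (\<lambda>y. if y = xs ! j then 1 else 0) x * w (xs ! j))"
      using A i by (simp add: scalar_prod_def lessThan_atLeast0)
        (simp add: A_def averaging_matrix_def Let_def xs_def[symmetric] n_def[symmetric] x_def)
    also have "\<dots> = (\<Sum>y\<in>vertices \<Gamma>. averaging \<Gamma> (\<lambda>z. if z = y then 1 else 0) x * w y)"
      using xs by (intro sum.reindex_bij_betw bij_betw_nth) (auto simp: n_def)
    also have "\<dots> = averaging \<Gamma> w x"
    proof -
      \<comment> \<open>This expands \<open>w\<close> in indicator functions of vertices. The dart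
        multiset is generalized to an arbitrary \<open>E\<close> so that the induction runs over
        single darts.\<close>
      have *: "(\<Sum>y\<in>vertices \<Gamma>. (\<Sum>e\<in>#E. if snd e = y then 1 else 0) * w y) = (\<Sum>e\<in>#E. w (snd e))"
        if "snd ` set_mset E \<subseteq> vertices \<Gamma>" for E :: "('a \<times> 'a) multiset"
        using that
      proof (induction E)
        case (add e E)
        then show ?case
          by (simp add: distrib_right sum.distrib) (simp add: fin if_distrib[of "\<lambda>t. t * _"] cong: if_cong)
      qed simp
      have "snd ` set_mset (darts_from \<Gamma> x) \<subseteq> vertices \<Gamma>"
        using sub by (auto simp: darts_from_def)
      from *[OF this] show ?thesis
        unfolding averaging_def by (simp only: mult.assoc sum_distrib_left[symmetric])
    qed
    finally show "(A *\<^sub>v vec n (\<lambda>i. w (xs ! i))) $ i = (a \<cdot>\<^sub>v vec n (\<lambda>i. w (xs ! i))) $ i"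
      using w[OF x] i by (simp add: x_def)
  qed (use A in simp)
  obtain p q where pq: "p < n" "q < n" "x = xs ! p" "y = xs ! q"
    using xy(1,2) by (metis in_set_conv_nth n_def xs(2))
  have "[:- l, 1:] * [:- m, 1:] dvd char_poly A"
    by (rule char_poly_two_eigenvectors[OF A _ _ eig[OF u] eig[OF v] pq(1,2)])
      (use pq xy in auto)
  then obtain Q where Q: "char_poly A = [:- l, 1:] * [:- m, 1:] * Q" by (rule dvdE)
  have "char_poly A \<noteq> 0" using degree_monic_char_poly[OF A] by auto
  then have "proots (char_poly A) = {#l, m#} + proots Q"
    unfolding Q by (subst proots_mult, force, force, subst proots_mult) auto
  then have "min l m \<le> eigenvalue_list \<Gamma> ! 1"
    unfolding eigenvalue_list_def A_def[symmetric] by (intro second_largest_ge) simp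
  moreover have "card (vertices \<Gamma>) \<ge> 2"
  proof -
    have "x \<noteq> y" using xy(3) by auto
    then show ?thesis using fin xy card_mono[of "vertices \<Gamma>" "{x, y}"] by auto
  qed
  ultimately show ?thesis by (simp add: spectral_gap_def)
qed

lemma (in group_action) action_gap_le:
  assumes fin: "finite E" and S: "set_mset S \<subseteq> carrier G"
    and u: "\<And>x. x \<in> E \<Longrightarrow> 1 / real (size S) * (\<Sum>s\<in>#S. u (\<phi> s x)) = l * u x"
    and v: "\<And>x. x \<in> E \<Longrightarrow> 1 / real (size S) * (\<Sum>s\<in>#S. v (\<phi> s x)) = m * v x"
    and xy: "x \<in> E" "y \<in> E" "u x * v y \<noteq> u y * v x"
  shows "action_gap \<phi> E S \<le> 1 - min l m"
  unfolding action_gap_def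
proof (rule spectral_gap_le[where u = u and v = v and x = x and y = y])
  let ?\<Gamma> = "schreier_graph \<phi> E S"
  have V: "vertices ?\<Gamma> = E" by (simp add: schreier_graph_def)
  show "finite (vertices ?\<Gamma>)" "x \<in> vertices ?\<Gamma>" "y \<in> vertices ?\<Gamma>" "u x * v y \<noteq> u y * v x"
    using fin xy by (simp_all add: V)
  show "snd ` set_mset (darts ?\<Gamma>) \<subseteq> vertices ?\<Gamma>"
    using fin S element_image by (auto simp: schreier_graph_def set_mset_sum)
  have avg: "averaging ?\<Gamma> w x = 1 / real (size S) * (\<Sum>s\<in>#S. w (\<phi> s x))" if "x \<in> E" for w x
    by (simp add: averaging_def darts_from_schreier_graph[OF fin that] multiset.map_comp comp_def)
  show "averaging ?\<Gamma> u x = l * u x" "averaging ?\<Gamma> v x = m * v x" if "x \<in> vertices ?\<Gamma>" for x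
    using u v that by (simp_all add: V avg)
qed

section \<open>Subgroups containing all commutators\<close>

context group
begin

text \<open>A conjugate of \<open>h\<close> differs from \<open>h\<close> by the commutator of
  \<open>x\<close> and \<open>h\<close>.\<close>

lemma normal_if_commutators:
  assumes L: "subgroup L G"
    and comm: "\<And>x y. x \<in> carrier G \<Longrightarrow> y \<in> carrier G \<Longrightarrow> x \<otimes> y \<otimes> inv x \<otimes> inv y \<in> L"
  shows "L \<lhd> G"
proof (rule normal_invI[OF L])
  fix x h assume x: "x \<in> carrier G" and h: "h \<in> L"
  have hG: "h \<in> carrier G" using L h by (rule subgroup.mem_carrier)
  have "x \<otimes> h \<otimes> inv x = (x \<otimes> h \<otimes> inv x \<otimes> inv h) \<otimes> h"
    using x hG by (simp add: m_assoc)
  then show "x \<otimes> h \<otimes> inv x \<in> L"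
    using subgroup.m_closed[OF L comm[OF x hG] h] by simp
qed

lemma subgroup_nat_pow_closed: "subgroup L G \<Longrightarrow> x \<in> L \<Longrightarrow> x [^] (n::nat) \<in> L"
  by (induction n) (auto simp: subgroup.one_closed subgroup.m_closed)

lemma normal_move:
  assumes "L \<lhd> G" "g \<in> carrier G" "x \<in> L"
  shows "x \<otimes> g = g \<otimes> (inv g \<otimes> x \<otimes> g)" "inv g \<otimes> x \<otimes> g \<in> L"
proof -
  interpret normal L G by fact
  show "inv g \<otimes> x \<otimes> g \<in> L" using assms by (simp add: inv_op_closed1)
  show "x \<otimes> g = g \<otimes> (inv g \<otimes> x \<otimes> g)"
    using assms by (simp add: m_assoc[symmetric] mem_carrier)
qed

text \<open>Modulo the normal subgroup \<open>L\<close> the element \<open>t\<close> has an order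
  dividing \<open>e\<close>, so its powers with exponents below \<open>e\<close> already form a
  subgroup of the quotient. The exponent \<open>e\<close> need not be the exact order, hence
  representations may repeat.\<close>

lemma generate_insert_normal:
  assumes L: "L \<lhd> G" and t: "t \<in> carrier G" "t [^] (e::nat) \<in> L" and e: "0 < e"
  shows "generate G (insert t L) = {t [^] (i::nat) \<otimes> x | i x. i < e \<and> x \<in> L}" (is "_ = ?R")
proof -
  interpret normal L G by fact
  have red: "t [^] (i::nat) \<otimes> x \<in> ?R" if "x \<in> L" for i x
  proof -
    have "t [^] i = t [^] (i mod e + e * (i div e))" by simp
    also have "\<dots> = t [^] (i mod e) \<otimes> (t [^] e) [^] (i div e)"
      using t by (simp add: nat_pow_mult nat_pow_pow)
    finally have "t [^] i \<otimes> x = t [^] (i mod e) \<otimes> ((t [^] e) [^] (i div e) \<otimes> x)"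
      using t that by (simp add: m_assoc mem_carrier)
    moreover have "(t [^] e) [^] (i div e) \<otimes> x \<in> L"
      using t(2) that by (simp add: subgroup_nat_pow_closed[OF is_subgroup] m_closed)
    ultimately show ?thesis using e by (auto intro!: exI[of _ "i mod e"])
  qed
  have sub: "subgroup ?R G"
  proof (rule subgroupI)
    show "?R \<subseteq> carrier G" using t by (auto simp: mem_carrier)
    show "?R \<noteq> {}" using red one_closed by blast
  next
    fix a assume "a \<in> ?R"
    then obtain i x where a: "a = t [^] i \<otimes> x" "i < e" "x \<in> L" by blast
    define s where "s = t [^] (e - i)"
    have s: "s \<in> carrier G" "t [^] e = t [^] i \<otimes> s"
      using t a(2) nat_pow_mult[OF t(1), of i "e - i"] by (simp_all add: s_def)
    have xi: "inv x \<in> L" using a(3) by simp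
    \<comment> \<open>The inverse of t^i is t^(e - i) up to the factor \<open>inv (t [^] e)\<close>,
      which lies in \<open>L\<close>; this keeps all exponents natural numbers.\<close>
    have "inv (t [^] i) = s \<otimes> inv (t [^] e)"
      unfolding s(2) using s(1) t by (simp add: inv_mult_group m_assoc[symmetric])
    then have "inv a = (inv x \<otimes> s) \<otimes> inv (t [^] e)"
      using a t s by (simp add: inv_mult_group mem_carrier m_assoc)
    also have "\<dots> = s \<otimes> (inv s \<otimes> inv x \<otimes> s) \<otimes> inv (t [^] e)"
      using normal_move(1)[OF L s(1) xi] by (simp only:)
    also have "\<dots> = s \<otimes> ((inv s \<otimes> inv x \<otimes> s) \<otimes> inv (t [^] e))"
      using s(1) xi t by (intro m_assoc) (auto simp: mem_carrier)
    finally have "inv a = \<dots>" .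
    moreover have "(inv s \<otimes> inv x \<otimes> s) \<otimes> inv (t [^] e) \<in> L"
      by (rule m_closed[OF normal_move(2)[OF L s(1) xi] m_inv_closed[OF t(2)]])
    ultimately show "inv a \<in> ?R" using red[of _ "e - i"] by (simp only: s_def)
  next
    fix a b assume "a \<in> ?R" "b \<in> ?R"
    then obtain i j :: nat and x y where a: "a = t [^] i \<otimes> x" "x \<in> L" and b: "b = t [^] j \<otimes> y" "y \<in> L"
      by blast
    define s where "s = t [^] j"
    have s: "s \<in> carrier G" using t by (simp add: s_def)
    have G: "t [^] i \<in> carrier G" "x \<in> carrier G" "y \<in> carrier G"
        "inv s \<otimes> x \<otimes> s \<in> carrier G"
      using t s a b by (auto simp: mem_carrier)
    have "a \<otimes> b = t [^] i \<otimes> (x \<otimes> s) \<otimes> y"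
      unfolding a(1) b(1) s_def[symmetric] using G s by (simp add: m_assoc)
    also have "\<dots> = t [^] i \<otimes> (s \<otimes> (inv s \<otimes> x \<otimes> s)) \<otimes> y"
      using normal_move(1)[OF L s a(2)] by (simp only:)
    also have "\<dots> = (t [^] i \<otimes> s) \<otimes> ((inv s \<otimes> x \<otimes> s) \<otimes> y)"
      using G s by (simp only: m_assoc[of "t [^] i"] m_assoc[of s] subgroup.m_closed[OF subgroup_self])
    also have "t [^] i \<otimes> s = t [^] (i + j)"
      using t by (simp add: s_def nat_pow_mult)
    finally have "a \<otimes> b = t [^] (i + j) \<otimes> ((inv s \<otimes> x \<otimes> s) \<otimes> y)" .
    moreover have "(inv s \<otimes> x \<otimes> s) \<otimes> y \<in> L"
      using normal_move(2)[OF L s a(2)] b(2) by (rule m_closed)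
    ultimately show "a \<otimes> b \<in> ?R" using red by (simp only:)
  qed
  have "t \<in> ?R" using red[OF one_closed, of 1] t by (simp only: nat_pow_0 One_nat_def nat_pow_Suc l_one r_one)
  moreover have "L \<subseteq> ?R" using red[of _ 0] by (simp only: nat_pow_0) (auto simp: mem_carrier)
  ultimately have "generate G (insert t L) \<subseteq> ?R"
    using sub by (intro generate_subgroup_incl) auto
  moreover have "?R \<subseteq> generate G (insert t L)"
  proof
    fix a assume "a \<in> ?R"
    then obtain i :: nat and x where a: "a = t [^] i \<otimes> x" "x \<in> L" by blast
    have g: "subgroup (generate G (insert t L)) G"
      using t by (intro generate_is_subgroup) (auto simp: mem_carrier)
    show "a \<in> generate G (insert t L)"
      unfolding a(1) using a(2)
      by (intro subgroup.m_closed[OF g] subgroup_nat_pow_closed[OF g] generate.incl) auto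
  qed
  ultimately show ?thesis by blast
qed

lemma generate_Un_insert:
  assumes "K \<subseteq> carrier G" "T \<subseteq> carrier G" "t \<in> carrier G"
  shows "generate G (K \<union> insert t T) = generate G (insert t (generate G (K \<union> T)))"
proof (rule subset_antisym)
  show "generate G (K \<union> insert t T) \<subseteq> generate G (insert t (generate G (K \<union> T)))"
    by (intro mono_generate) (auto intro: generate.incl)
  have "generate G (K \<union> T) \<subseteq> generate G (K \<union> insert t T)"
    by (intro mono_generate) auto
  moreover have "t \<in> generate G (K \<union> insert t T)" by (auto intro: generate.incl)
  ultimately show "generate G (insert t (generate G (K \<union> T))) \<subseteq> generate G (K \<union> insert t T)"
    using assms by (intro generate_subgroup_incl generate_is_subgroup) auto
qed

text \<open>The elements \<open>t i\<close> are adjoined one at a time. Every intermediate subgroup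
  contains all commutators and is therefore normal, so each adjunction multiplies the number of
  cosets of \<open>K\<close> needed for a cover by at most \<open>e i\<close>. The set
  \<open>F\<close> collects the coset representatives, possibly with redundancy.\<close>

lemma generate_cover:
  assumes K: "subgroup K G"
    and comm: "\<And>x y. x \<in> carrier G \<Longrightarrow> y \<in> carrier G \<Longrightarrow> x \<otimes> y \<otimes> inv x \<otimes> inv y \<in> K"
    and "finite I" and "\<And>i. i \<in> I \<Longrightarrow> t i \<in> carrier G"
    and "\<And>i. i \<in> I \<Longrightarrow> 0 < e i" and "\<And>i. i \<in> I \<Longrightarrow> t i [^] (e i :: nat) \<in> K"
  shows "\<exists>F. finite F \<and> F \<subseteq> carrier G \<and> card F \<le> (\<Prod>i\<in>I. e i) \<and> generate G (K \<union> t ` I) \<subseteq> F <#> K"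
  using assms(3-)
proof (induction I)
  case empty
  have "generate G K = K" using generate_subgroup_incl[OF order_refl K] by (auto intro: generate.incl)
  moreover have "K \<subseteq> {\<one>} <#> K"
    using subgroup.subset[OF K] by (force simp: set_mult_def)
  ultimately show ?case by (intro exI[of _ "{\<one>}"]) auto
next
  case (insert i I)
  then obtain F where F: "finite F" "F \<subseteq> carrier G" "card F \<le> (\<Prod>i\<in>I. e i)"
      "generate G (K \<union> t ` I) \<subseteq> F <#> K"
    by (metis (no_types, lifting) insertCI)
  define L where "L = generate G (K \<union> t ` I)"
  define F' where "F' = (\<lambda>(j, f). t i [^] j \<otimes> f) ` ({..<e i} \<times> F)"
  have KG: "K \<subseteq> carrier G" by (rule subgroup.subset[OF K])
  have KL: "K \<subseteq> L" by (auto simp: L_def intro: generate.incl)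
  have ti: "t i \<in> carrier G" "t i [^] e i \<in> L" "0 < e i" using insert.prems KL by auto
  have tI: "t ` I \<subseteq> carrier G" using insert.prems by auto
  have "L \<lhd> G"
    using KG tI KL comm unfolding L_def
    by (intro normal_if_commutators generate_is_subgroup) (auto simp: L_def)
  have "generate G (K \<union> t ` insert i I) = generate G (insert (t i) L)"
    using generate_Un_insert[OF KG tI ti(1)] by (simp add: L_def)
  also have "\<dots> \<subseteq> F' <#> K"
  proof
    fix a assume "a \<in> generate G (insert (t i) L)"
    then obtain j x where a: "a = t i [^] j \<otimes> x" "j < e i" "x \<in> L"
      unfolding generate_insert_normal[OF \<open>L \<lhd> G\<close> ti] by blast
    then obtain f k where fk: "f \<in> F" "k \<in> K" "x = f \<otimes> k"
      using F(4) unfolding L_def[symmetric] set_mult_def by blast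
    have "a = (t i [^] j \<otimes> f) \<otimes> k"
      unfolding a(1) fk(3) using ti(1) fk F(2) KG by (subst m_assoc) auto
    moreover have "t i [^] j \<otimes> f \<in> F'" using a(2) fk(1) by (auto simp: F'_def)
    ultimately show "a \<in> F' <#> K" using fk(2) by (auto simp: set_mult_def)
  qed
  finally have sub: "generate G (K \<union> t ` insert i I) \<subseteq> F' <#> K" .
  have "card F' \<le> card ({..<e i} \<times> F)"
    unfolding F'_def using F(1) by (intro card_image_le) auto
  also have "\<dots> \<le> e i * (\<Prod>i\<in>I. e i)" using F(3) by (simp add: card_cartesian_product)
  finally have "card F' \<le> (\<Prod>i\<in>insert i I. e i)" using insert.hyps by simp
  moreover have "finite F'" "F' \<subseteq> carrier G" using F(1,2) ti(1) by (auto simp: F'_def)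
  ultimately show ?case using sub by blast
qed

end

section \<open>Characters\<close>

text \<open>These are the characters of \<open>L\<close> that are trivial on \<open>K\<close>. The
  value 0 outside \<open>L\<close> makes equality of characters the same as equality of functions,
  so that they can be counted.\<close>

definition (in group) chars :: "'a set \<Rightarrow> 'a set \<Rightarrow> ('a \<Rightarrow> complex) set" where
  "chars K L = {\<chi>. (\<forall>x\<in>L. \<forall>y\<in>L. \<chi> (x \<otimes> y) = \<chi> x * \<chi> y) \<and> (\<forall>x\<in>K. \<chi> x = 1) \<and> (\<forall>x. x \<notin> L \<longrightarrow> \<chi> x = 0)}"

context group
begin

lemma chars_mult: "\<chi> \<in> chars K L \<Longrightarrow> x \<in> L \<Longrightarrow> y \<in> L \<Longrightarrow> \<chi> (x \<otimes> y) = \<chi> x * \<chi> y"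
  and chars_one: "\<chi> \<in> chars K L \<Longrightarrow> x \<in> K \<Longrightarrow> \<chi> x = 1"
  and chars_outside: "\<chi> \<in> chars K L \<Longrightarrow> x \<notin> L \<Longrightarrow> \<chi> x = 0"
  by (auto simp: chars_def)

lemma chars_pow:
  assumes "\<chi> \<in> chars K L" "subgroup K G" "subgroup L G" "x \<in> L"
  shows "\<chi> (x [^] (n::nat)) = \<chi> x ^ n"
  using assms by (induction n)
    (auto simp: chars_mult subgroup_nat_pow_closed chars_one subgroup.one_closed)

lemma chars_inv:
  assumes "\<chi> \<in> chars K L" "subgroup K G" "subgroup L G" "x \<in> L"
  shows "\<chi> x * \<chi> (inv x) = 1"
proof -
  have "\<chi> (x \<otimes> inv x) = \<chi> x * \<chi> (inv x)"
    using assms by (intro chars_mult) (auto simp: subgroup.m_inv_closed)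
  moreover have "x \<in> carrier G" using assms(3,4) by (rule subgroup.mem_carrier)
  ultimately show ?thesis using assms by (simp add: chars_one subgroup.one_closed)
qed

lemma chars_nonzero:
  assumes "\<chi> \<in> chars K L" "subgroup K G" "subgroup L G" "x \<in> L"
  shows "\<chi> x \<noteq> 0"
  using chars_inv[OF assms] by auto

text \<open>Extension of characters by one generator: if \<open>e\<close> is the order of
  \<open>t\<close> modulo \<open>L\<close>, an extension of \<chi> is determined by its value z at
  \<open>t\<close>, and z^e = \<chi>(t^e) is the only constraint. Given such z, the rule t^i x
  \<mapsto> z^i \<chi>(x) is well defined, since a power of \<open>t\<close> lies in
  \<open>L\<close> only if \<open>e\<close> divides its exponent, and it is multiplicative, since
  \<chi> is 1 on commutators.\<close>

lemma bij_betw_chars_insert: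
  assumes K: "subgroup K G" "K \<subseteq> L" and L: "subgroup L G"
    and comm: "\<And>x y. x \<in> carrier G \<Longrightarrow> y \<in> carrier G \<Longrightarrow> x \<otimes> y \<otimes> inv x \<otimes> inv y \<in> K"
    and t: "t \<in> carrier G" "t [^] (e::nat) \<in> L" "0 < e"
    and minimal: "\<And>r. 0 < r \<Longrightarrow> r < e \<Longrightarrow> t [^] r \<notin> L"
  defines "L' \<equiv> generate G (insert t L)"
  shows "bij_betw (\<lambda>\<chi>. (\<lambda>x. if x \<in> L then \<chi> x else 0, \<chi> t)) (chars K L')
           (SIGMA \<chi>:chars K L. {z. z ^ e = \<chi> (t [^] e)})"
proof -
  have normal: "L \<lhd> G" using comm K by (intro normal_if_commutators L) auto
  note LG = subgroup.mem_carrier[OF L]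
  have sub': "subgroup L' G" unfolding L'_def using LG t by (intro generate_is_subgroup) auto
  have LL': "L \<subseteq> L'" and tL': "t \<in> L'" by (auto simp: L'_def intro: generate.incl)
  have elem: "\<exists>i x. g = t [^] (i::nat) \<otimes> x \<and> x \<in> L" if "g \<in> L'" for g
    using that generate_insert_normal[OF normal t] unfolding L'_def by auto
  have memL': "t [^] (i::nat) \<otimes> x \<in> L'" if "x \<in> L" for i x
    using that LL' tL' by (intro subgroup.m_closed[OF sub'] subgroup_nat_pow_closed[OF sub']) auto
  have dvd: "e dvd i" if "t [^] i \<in> L" for i
  proof (rule ccontr)
    assume "\<not> e dvd i"
    then have "0 < i mod e" "i mod e < e" using t(3) by (auto simp: mod_greater_zero_iff_not_dvd)
    have "t [^] i = (t [^] e) [^] (i div e) \<otimes> t [^] (i mod e)"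
      using t(1) by (simp add: nat_pow_pow nat_pow_mult)
    then have "t [^] (i mod e) = inv ((t [^] e) [^] (i div e)) \<otimes> t [^] i"
      using t(1) by (simp add: m_assoc[symmetric])
    also have "\<dots> \<in> L"
      using that t(2) by (simp add: L subgroup.m_closed subgroup.m_inv_closed subgroup_nat_pow_closed)
    finally show False using minimal \<open>0 < i mod e\<close> \<open>i mod e < e\<close> by blast
  qed
  show ?thesis
    unfolding bij_betw_def
  proof (intro conjI subset_antisym)
    show "inj_on (\<lambda>\<chi>. (\<lambda>x. if x \<in> L then \<chi> x else 0, \<chi> t)) (chars K L')"
    proof (rule inj_onI, rule ext)
      fix \<chi> \<psi> g
      assume \<chi>: "\<chi> \<in> chars K L'" and \<psi>: "\<psi> \<in> chars K L'"
        and eq: "(\<lambda>x. if x \<in> L then \<chi> x else 0, \<chi> t) = (\<lambda>x. if x \<in> L then \<psi> x else 0, \<psi> t)"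
      have eqL: "\<chi> x = \<psi> x" if "x \<in> L" for x
      proof -
        have "(\<lambda>x. if x \<in> L then \<chi> x else 0) = (\<lambda>x. if x \<in> L then \<psi> x else 0)"
          using eq by simp
        note fun_cong[OF this, of x]
        then show ?thesis using that by simp
      qed
      have eqt: "\<chi> t = \<psi> t" using eq by simp
      show "\<chi> g = \<psi> g"
      proof (cases "g \<in> L'")
        case True
        then obtain i :: nat and x where g: "g = t [^] i \<otimes> x" "x \<in> L" using elem by blast
        have ev: "\<zeta> g = \<zeta> t ^ i * \<zeta> x" if "\<zeta> \<in> chars K L'" for \<zeta>
          unfolding g(1) using that g(2) LL' tL' K sub'
          by (simp add: chars_mult subgroup_nat_pow_closed chars_pow subsetD)
        show ?thesis using ev[OF \<chi>] ev[OF \<psi>] eqL[OF g(2)] eqt by simp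
      qed (use \<chi> \<psi> in \<open>simp add: chars_outside\<close>)
    qed
    show "(\<lambda>\<chi>. (\<lambda>x. if x \<in> L then \<chi> x else 0, \<chi> t)) ` chars K L'
          \<subseteq> (SIGMA \<chi>:chars K L. {z. z ^ e = \<chi> (t [^] e)})"
    proof (rule image_subsetI)
      fix \<chi> assume \<chi>: "\<chi> \<in> chars K L'"
      have "(\<lambda>x. if x \<in> L then \<chi> x else 0) \<in> chars K L"
        using chars_mult[OF \<chi>] chars_one[OF \<chi>] LL' K(2) L
        by (auto simp: chars_def subgroup.m_closed subset_iff)
      moreover have "\<chi> t ^ e = \<chi> (t [^] e)" using chars_pow[OF \<chi> K(1) sub' tL'] by simp
      ultimately show "(\<lambda>x. if x \<in> L then \<chi> x else 0, \<chi> t)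
          \<in> (SIGMA \<chi>:chars K L. {z. z ^ e = \<chi> (t [^] e)})"
        using t(2) by simp
    qed
    show "(SIGMA \<chi>:chars K L. {z. z ^ e = \<chi> (t [^] e)})
          \<subseteq> (\<lambda>\<chi>. (\<lambda>x. if x \<in> L then \<chi> x else 0, \<chi> t)) ` chars K L'"
    proof clarify
      fix \<chi> z assume \<chi>: "\<chi> \<in> chars K L" and z: "z ^ e = \<chi> (t [^] e)"
      \<comment> \<open>Independence of the chosen representation t^i x, first for j \<le> i so that
        the difference of exponents is a natural number; \<open>wd\<close> then removes the
        ordering.\<close>
      have le: "z ^ i * \<chi> x = z ^ j * \<chi> y"
        if "t [^] i \<otimes> x = t [^] j \<otimes> y" "x \<in> L" "y \<in> L" "j \<le> i" for i j x y
      proof -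
        have "t [^] i = t [^] j \<otimes> t [^] (i - j)" using t(1) that(4) by (simp add: nat_pow_mult)
        then have "t [^] j \<otimes> (t [^] (i - j) \<otimes> x) = t [^] j \<otimes> y"
          using that t(1) LG by (simp add: m_assoc)
        then have y: "t [^] (i - j) \<otimes> x = y" using that t(1) LG by simp
        then have "t [^] (i - j) = y \<otimes> inv x" using that t(1) LG by (simp add: inv_solve_right)
        then have "t [^] (i - j) \<in> L"
          using that by (simp add: L subgroup.m_closed subgroup.m_inv_closed)
        then obtain q where q: "i - j = e * q" using dvd by (metis dvdE)
        have "\<chi> y = \<chi> ((t [^] e) [^] q) * \<chi> x"
          unfolding y[symmetric] q using t that(2)
          by (simp add: nat_pow_pow[symmetric] chars_mult[OF \<chi>] subgroup_nat_pow_closed[OF L])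
        also have "\<chi> ((t [^] e) [^] q) = z ^ (i - j)"
          using chars_pow[OF \<chi> K(1) L t(2)] z by (simp add: q power_mult)
        finally have "z ^ j * \<chi> y = z ^ (j + (i - j)) * \<chi> x" by (simp add: power_add)
        then show ?thesis using that(4) by simp
      qed
      have wd: "z ^ i * \<chi> x = z ^ j * \<chi> y"
        if "t [^] i \<otimes> x = t [^] j \<otimes> y" "x \<in> L" "y \<in> L" for i j x y
        using le[OF that] le[OF that(1)[symmetric] that(3,2)] by (cases "j \<le> i") auto
      define \<psi> where "\<psi> g = (if g \<in> L' then
          (SOME w. \<exists>i x. g = t [^] (i::nat) \<otimes> x \<and> x \<in> L \<and> w = z ^ i * \<chi> x) else 0)" for g
      have \<psi>: "\<psi> (t [^] i \<otimes> x) = z ^ i * \<chi> x" if "x \<in> L" for i x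
      proof -
        define P where
          "P w = (\<exists>j y. t [^] i \<otimes> x = t [^] (j::nat) \<otimes> y \<and> y \<in> L \<and> w = z ^ j * \<chi> y)" for w
        have "\<exists>w. P w" using that by (auto simp: P_def)
        then have "P (SOME w. P w)" by (rule someI_ex)
        moreover have "(SOME w. P w) = \<psi> (t [^] i \<otimes> x)"
          using memL'[OF that] by (simp add: \<psi>_def P_def)
        ultimately obtain j y where jy: "t [^] i \<otimes> x = t [^] (j::nat) \<otimes> y" "y \<in> L"
            "\<psi> (t [^] i \<otimes> x) = z ^ j * \<chi> y"
          by (auto simp: P_def)
        then show ?thesis using wd[OF jy(1) that jy(2)] by simp
      qed
      have \<chi>1: "\<chi> \<one> = 1" using \<chi> K(1) by (simp add: chars_one subgroup.one_closed)
      have \<psi>L: "\<psi> x = \<chi> x" if "x \<in> L" for x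
        using \<psi>[OF that, of 0] that LG by simp
      have \<psi>t: "\<psi> t = z" using \<psi>[OF subgroup.one_closed[OF L], of 1] t(1) \<chi>1 by simp
      have "\<psi> (g \<otimes> h) = \<psi> g * \<psi> h" if gL: "g \<in> L'" "h \<in> L'" for g h
      proof -
        obtain i j :: nat and x y where g: "g = t [^] i \<otimes> x" "x \<in> L" and h: "h = t [^] j \<otimes> y" "y \<in> L"
          using elem[OF gL(1)] elem[OF gL(2)] by blast
        define s where "s = t [^] j"
        have s: "s \<in> carrier G" using t(1) by (simp add: s_def)
        define x' where "x' = inv s \<otimes> x \<otimes> s"
        have x': "x \<otimes> s = s \<otimes> x'" "x' \<in> L"
          unfolding x'_def using normal_move[OF normal s g(2)] .
        have G: "t [^] i \<in> carrier G" "x \<in> carrier G" "y \<in> carrier G" "x' \<in> carrier G"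
          using t LG g(2) h(2) x' by auto
        have "g \<otimes> h = t [^] i \<otimes> (x \<otimes> s) \<otimes> y"
          unfolding g(1) h(1) s_def[symmetric] using G s by (simp add: m_assoc)
        also have "\<dots> = (t [^] i \<otimes> s) \<otimes> (x' \<otimes> y)"
          unfolding x'(1) using G s by (simp add: m_assoc)
        also have "t [^] i \<otimes> s = t [^] (i + j)" using t(1) by (simp add: s_def nat_pow_mult)
        finally have gh: "g \<otimes> h = t [^] (i + j) \<otimes> (x' \<otimes> y)" .
        \<comment> \<open>Moving \<open>x\<close> past \<open>s\<close> replaces it by the conjugate
          \<open>x'\<close>. The two differ by a commutator, which lies in \<open>K\<close>, so
          \<chi> does not distinguish them.\<close>
        have "inv x \<otimes> x' = inv x \<otimes> inv s \<otimes> inv (inv x) \<otimes> inv (inv s)"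
          using G s by (simp add: x'_def m_assoc)
        then have "inv x \<otimes> x' \<in> K" using comm[of "inv x" "inv s"] G s by simp
        then have "\<chi> (x \<otimes> (inv x \<otimes> x')) = \<chi> x"
          using chars_mult[OF \<chi> g(2)] K(2) chars_one[OF \<chi>] by auto
        then have "\<chi> x' = \<chi> x" using G by (simp add: m_assoc[symmetric])
        moreover have "\<psi> (g \<otimes> h) = z ^ (i + j) * \<chi> (x' \<otimes> y)"
          unfolding gh using x'(2) h(2) by (intro \<psi> subgroup.m_closed[OF L])
        moreover have "\<psi> g = z ^ i * \<chi> x" "\<psi> h = z ^ j * \<chi> y"
          unfolding g(1) h(1) using g(2) h(2) by (auto intro: \<psi>)
        ultimately show ?thesis
          using chars_mult[OF \<chi> x'(2) h(2)] by (simp add: power_add)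
      qed
      then have "\<psi> \<in> chars K L'"
        using \<psi>L chars_one[OF \<chi>] K(2) by (auto simp: chars_def subset_iff) (simp add: \<psi>_def)
      moreover have "(\<lambda>x. if x \<in> L then \<psi> x else 0) = \<chi>"
        using \<psi>L chars_outside[OF \<chi>] by auto
      ultimately show "(\<chi>, z) \<in> (\<lambda>\<chi>. (\<lambda>x. if x \<in> L then \<chi> x else 0, \<chi> t)) ` chars K L'"
        using \<psi>t by (intro image_eqI[where x = \<psi>]) auto
    qed
  qed
qed

text \<open>Adjoining \<open>t\<close> multiplies the number of characters by exactly
  \<open>e\<close>, the number of \<open>e\<close>-th roots of a nonzero complex number, and the
  number of cosets of \<open>K\<close> by at most \<open>e\<close>. Comparing the two counts along
  the generators in \<open>T\<close> gives at least as many characters as cosets.\<close>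

lemma card_chars_ge:
  assumes K: "subgroup K G"
    and comm: "\<And>x y. x \<in> carrier G \<Longrightarrow> y \<in> carrier G \<Longrightarrow> x \<otimes> y \<otimes> inv x \<otimes> inv y \<in> K"
    and "finite T" "T \<subseteq> carrier G" "\<And>t. t \<in> T \<Longrightarrow> \<exists>n>0. t [^] (n::nat) \<in> K"
  defines "L \<equiv> generate G (K \<union> T)"
  shows "finite (chars K L) \<and> finite ((\<lambda>g. g <# K) ` L) \<and> card ((\<lambda>g. g <# K) ` L) \<le> card (chars K L)"
  using assms(3-5) unfolding L_def
proof (induction T)
  case empty
  have "generate G K = K" using generate_subgroup_incl[OF order_refl K] by (auto intro: generate.incl)
  moreover have "(\<lambda>g. g <# K) ` K = {K}"
    using K by (auto simp: subgroup.one_closed coset_join3 subgroup.mem_carrier intro!: image_eqI[of _ _ \<one>])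
  moreover have "chars K K = {\<lambda>x. if x \<in> K then 1 else 0}"
    using K by (auto simp: chars_def subgroup.m_closed)
  ultimately show ?case by simp
next
  case (insert t T)
  define L where "L = generate G (K \<union> T)"
  define L' where "L' = generate G (insert t L)"
  have KG: "K \<subseteq> carrier G" by (rule subgroup.subset[OF K])
  have tT: "t \<in> carrier G" "T \<subseteq> carrier G" using insert.prems by auto
  have L'_eq: "generate G (K \<union> insert t T) = L'"
    unfolding L'_def L_def by (rule generate_Un_insert[OF KG tT(2,1)])
  have L: "subgroup L G" unfolding L_def using KG tT by (intro generate_is_subgroup) auto
  have KL: "K \<subseteq> L" by (auto simp: L_def intro: generate.incl)
  have normal: "L \<lhd> G" using comm KL by (intro normal_if_commutators L) auto
  have IH: "finite (chars K L)" "finite ((\<lambda>g. g <# K) ` L)"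
    "card ((\<lambda>g. g <# K) ` L) \<le> card (chars K L)"
    using insert.IH insert.prems unfolding L_def by auto
  define e where "e = (LEAST n. 0 < n \<and> t [^] (n::nat) \<in> L)"
  have "\<exists>n. 0 < n \<and> t [^] (n::nat) \<in> L" using insert.prems(2)[of t] KL by auto
  from LeastI_ex[OF this] have e: "t [^] e \<in> L" "0 < e" by (auto simp: e_def)
  have min: "t [^] r \<notin> L" if "0 < r" "r < e" for r
    using that not_less_Least[of r "\<lambda>n. 0 < n \<and> t [^] (n::nat) \<in> L"] by (auto simp: e_def)
  have roots: "finite {z. z ^ e = \<chi> (t [^] e)} \<and> card {z. z ^ e = \<chi> (t [^] e)} = e"
    if "\<chi> \<in> chars K L" for \<chi>
  proof -
    have "card {z. z ^ e = \<chi> (t [^] e)} = e"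
      using chars_nonzero[OF that K L e(1)] e(2) by (rule card_nth_roots)
    then show ?thesis using e(2) by (metis card_gt_0_iff)
  qed
  note bij = bij_betw_chars_insert[OF K KL L comm tT(1) e min, folded L'_def]
  have "finite (SIGMA \<chi>:chars K L. {z. z ^ e = \<chi> (t [^] e)})"
    using IH(1) roots by (intro finite_SigmaI) auto
  then have fin: "finite (chars K L')" using bij_betw_finite[OF bij] by simp
  have "card (chars K L') = (\<Sum>\<chi>\<in>chars K L. card {z. z ^ e = \<chi> (t [^] e)})"
    using bij_betw_same_card[OF bij] IH(1) roots by (simp add: card_SigmaI)
  then have card: "card (chars K L') = card (chars K L) * e"
    using roots by simp
  have sub: "(\<lambda>g. g <# K) ` L' \<subseteq> (\<lambda>(i, C). t [^] i <# C) ` ({..<e} \<times> (\<lambda>g. g <# K) ` L)"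
  proof (rule image_subsetI)
    fix g assume "g \<in> L'"
    then obtain i x where g: "g = t [^] i \<otimes> x" "i < e" "x \<in> L"
      using generate_insert_normal[OF normal tT(1) e] unfolding L'_def by blast
    have "g <# K = t [^] i <# (x <# K)"
      unfolding g(1) using tT(1) g(3) KG L by (intro lcos_m_assoc[symmetric]) (auto simp: subgroup.mem_carrier)
    then show "g <# K \<in> (\<lambda>(i, C). t [^] i <# C) ` ({..<e} \<times> (\<lambda>g. g <# K) ` L)"
      using g by force
  qed
  have fin2: "finite ({..<e} \<times> (\<lambda>g. g <# K) ` L)" using IH(2) by simp
  have "card ((\<lambda>g. g <# K) ` L') \<le> card ({..<e} \<times> (\<lambda>g. g <# K) ` L)"
    using card_mono[OF finite_imageI[OF fin2] sub] card_image_le[OF fin2] by (rule order_trans)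
  also have "\<dots> \<le> card (chars K L')" using IH(3) by (simp add: card card_cartesian_product mult.commute)
  finally show ?case
    unfolding L'_eq using fin finite_subset[OF sub finite_imageI[OF fin2]] by blast
qed

end

section \<open>The dual of an abelian torsion quotient\<close>

locale abelian_quotient = group +
  fixes K
  assumes K: "subgroup K G"
    and comm: "\<And>x y. x \<in> carrier G \<Longrightarrow> y \<in> carrier G \<Longrightarrow> x \<otimes> y \<otimes> inv x \<otimes> inv y \<in> K"
    and torsion: "\<And>g. g \<in> carrier G \<Longrightarrow> \<exists>n>0. g [^] (n::nat) \<in> K"
begin

abbreviation dual where "dual \<equiv> chars K (carrier G)"

definition trivial_char :: "'a \<Rightarrow> complex" where
  "trivial_char x = (if x \<in> carrier G then 1 else 0)"

lemma KG: "x \<in> K \<Longrightarrow> x \<in> carrier G"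
  using K by (rule subgroup.mem_carrier)

lemma trivial_char: "trivial_char \<in> dual"
  using KG by (auto simp: chars_def trivial_char_def)

lemma norm_char:
  assumes "\<chi> \<in> dual" "x \<in> carrier G"
  shows "norm (\<chi> x) = 1"
proof -
  obtain n where n: "n > 0" "x [^] (n::nat) \<in> K" using torsion assms(2) by blast
  have "\<chi> x ^ n = 1"
    using chars_pow[OF assms(1) K subgroup_self assms(2), of n] chars_one[OF assms(1) n(2)] by simp
  then have "norm (\<chi> x) ^ n = 1" by (simp flip: norm_power)
  then show ?thesis using n(1) power_eq_imp_eq_base[of "norm (\<chi> x)" n 1] by simp
qed

lemma char_inv:
  assumes "\<chi> \<in> dual" "x \<in> carrier G"
  shows "\<chi> (inv x) = cnj (\<chi> x)"
proof -
  have "\<chi> x * \<chi> (inv x) = 1" using chars_inv[OF assms(1) K subgroup_self assms(2)] .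
  moreover have "\<chi> x * cnj (\<chi> x) = 1"
    using norm_char[OF assms] by (simp add: complex_norm_square[symmetric])
  ultimately have "\<chi> x * \<chi> (inv x) = \<chi> x * cnj (\<chi> x)" by simp
  then show ?thesis using norm_char[OF assms] by auto
qed

lemma Re_char_le: "\<chi> \<in> dual \<Longrightarrow> x \<in> carrier G \<Longrightarrow> Re (\<chi> x) \<le> 1"
  using complex_Re_le_cmod[of "\<chi> x"] norm_char by simp

lemma chars_mult_closed: "\<chi> \<in> dual \<Longrightarrow> \<psi> \<in> dual \<Longrightarrow> (\<lambda>x. \<chi> x * \<psi> x) \<in> dual"
  by (auto simp: chars_def)

lemma chars_cnj_closed: "\<chi> \<in> dual \<Longrightarrow> (\<lambda>x. cnj (\<chi> x)) \<in> dual"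
  by (auto simp: chars_def)

text \<open>This turns two distinct characters that are close to each other on some elements into
  one nontrivial character that is close to 1 there.\<close>

lemma quotient_char:
  assumes "\<chi> \<in> dual" "\<psi> \<in> dual" "\<chi> \<noteq> \<psi>"
  shows "(\<lambda>x. \<chi> x * cnj (\<psi> x)) \<in> dual - {trivial_char}"
proof -
  have "\<chi> = \<psi>" if *: "(\<lambda>x. \<chi> x * cnj (\<psi> x)) = trivial_char"
  proof
    fix x
    show "\<chi> x = \<psi> x"
    proof (cases "x \<in> carrier G")
      case True
      have "\<chi> x * cnj (\<psi> x) = 1" using fun_cong[OF *, of x] True by (simp add: trivial_char_def)
      moreover have "\<psi> x * cnj (\<psi> x) = 1"
        using norm_char[OF assms(2) True] by (simp add: complex_norm_square[symmetric])
      ultimately have "\<chi> x * cnj (\<psi> x) = \<psi> x * cnj (\<psi> x)" by simp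
      then show ?thesis using norm_char[OF assms(2) True] by auto
    qed (use assms in \<open>simp add: chars_outside\<close>)
  qed
  then show ?thesis using assms chars_mult_closed chars_cnj_closed by auto
qed

text \<open>Orthogonality: if some \<psi> has \<psi>(x) \<noteq> 1, multiplication by \<psi>
  permutes the dual and the sum of all \<chi>(x) is 0; otherwise every summand is 1.\<close>

lemma sum_Re_chars_nonneg:
  assumes fin: "finite dual" and x: "x \<in> carrier G"
  shows "(\<Sum>\<chi>\<in>dual. Re (\<chi> x)) \<ge> 0"
proof (cases "\<exists>\<psi>\<in>dual. \<psi> x \<noteq> 1")
  case True
  then obtain \<psi> where \<psi>: "\<psi> \<in> dual" "\<psi> x \<noteq> 1" by blast
  have unit: "\<psi> y * cnj (\<psi> y) = 1" if "y \<in> carrier G" for y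
    using norm_char[OF \<psi>(1) that] by (simp add: complex_norm_square[symmetric])
  have cancel: "\<psi> y * (cnj (\<psi> y) * \<chi> y) = \<chi> y" "cnj (\<psi> y) * (\<psi> y * \<chi> y) = \<chi> y"
    if "\<chi> \<in> dual" for \<chi> y
  proof -
    have "(\<psi> y * cnj (\<psi> y)) * \<chi> y = \<chi> y"
    proof (cases "y \<in> carrier G")
      case False
      then show ?thesis using chars_outside[OF that] by simp
    qed (simp only: unit mult_1_left)
    then show "\<psi> y * (cnj (\<psi> y) * \<chi> y) = \<chi> y" "cnj (\<psi> y) * (\<psi> y * \<chi> y) = \<chi> y"
      by (simp_all only: ac_simps)
  qed
  have "bij_betw (\<lambda>\<chi> y. \<psi> y * \<chi> y) dual dual"
    by (rule bij_betwI[where g = "\<lambda>\<chi> y. cnj (\<psi> y) * \<chi> y"])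
      (auto simp: cancel intro!: chars_mult_closed chars_cnj_closed \<psi>(1))
  then have "(\<Sum>\<chi>\<in>dual. \<psi> x * \<chi> x) = (\<Sum>\<chi>\<in>dual. \<chi> x)"
    using sum.reindex_bij_betw[of "\<lambda>\<chi> y. \<psi> y * \<chi> y" dual dual "\<lambda>\<chi>. \<chi> x"] by simp
  then have "\<psi> x * (\<Sum>\<chi>\<in>dual. \<chi> x) = (\<Sum>\<chi>\<in>dual. \<chi> x)"
    by (simp only: sum_distrib_left)
  then have "(\<psi> x - 1) * (\<Sum>\<chi>\<in>dual. \<chi> x) = 0"
    by (simp only: left_diff_distrib mult_1_left diff_self)
  then have "(\<Sum>\<chi>\<in>dual. \<chi> x) = 0" using \<psi>(2) by simp
  then have "Re (\<Sum>\<chi>\<in>dual. \<chi> x) = 0" by simp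
  then show ?thesis by (simp add: Re_sum)
next
  case False
  show ?thesis
  proof (rule sum_nonneg)
    fix \<chi> assume "\<chi> \<in> dual"
    then have "\<chi> x = 1" using False by blast
    then show "0 \<le> Re (\<chi> x)" by simp
  qed
qed

text \<open>The sums over \<open>S\<close>, added up over the whole dual, are nonnegative. The
  trivial character accounts for \<open>size S\<close> of the total, so the average over the others
  is at least \<open>- size S / (card dual - 1)\<close>, and some character reaches the
  average.\<close>

lemma trace_bound:
  assumes fin: "finite dual" and two: "2 \<le> card dual" and S: "set_mset S \<subseteq> carrier G"
  shows "\<exists>\<chi>\<in>dual - {trivial_char}. (\<Sum>s\<in>#S. Re (\<chi> s)) \<ge> - real (size S) / (real (card dual) - 1)"
proof (rule ccontr)
  assume "\<not> ?thesis"
  then have less: "(\<Sum>s\<in>#S. Re (\<chi> s)) < - real (size S) / (real (card dual) - 1)"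
    if "\<chi> \<in> dual - {trivial_char}" for \<chi>
    using that by (auto simp: not_le)
  have c: "card (dual - {trivial_char}) = card dual - 1"
    using trivial_char fin by simp
  have "(\<Sum>\<chi>\<in>dual. \<Sum>s\<in>#S. Re (\<chi> s)) = (\<Sum>s\<in>#S. \<Sum>\<chi>\<in>dual. Re (\<chi> s))"
    by (induction S) (simp_all add: sum.distrib)
  also have "\<dots> \<ge> 0"
    using S by (induction S) (auto simp: sum_Re_chars_nonneg[OF fin])
  finally have nonneg: "0 \<le> (\<Sum>\<chi>\<in>dual. \<Sum>s\<in>#S. Re (\<chi> s))" .
  have split: "(\<Sum>\<chi>\<in>dual. \<Sum>s\<in>#S. Re (\<chi> s)) =
      (\<Sum>s\<in>#S. Re (trivial_char s)) + (\<Sum>\<chi>\<in>dual - {trivial_char}. \<Sum>s\<in>#S. Re (\<chi> s))"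
    using fin trivial_char by (rule sum.remove)
  have triv: "(\<Sum>s\<in>#S. Re (trivial_char s)) = real (size S)"
    using S by (induction S) (auto simp: trivial_char_def)
  have "(\<Sum>\<chi>\<in>dual - {trivial_char}. \<Sum>s\<in>#S. Re (\<chi> s)) <
      (\<Sum>\<chi>\<in>dual - {trivial_char}. - real (size S) / (real (card dual) - 1))"
  proof (rule sum_strict_mono)
    show "dual - {trivial_char} \<noteq> {}" using c two by (intro notI) simp
  qed (use fin less in auto)
  also have "\<dots> = - real (size S)" using c two by (simp add: of_nat_diff)
  finally show False using nonneg split triv by simp
qed

end

section \<open>Numerical estimates\<close>

text \<open>The Taylor polynomial of degree 3 shows that sin(8/15) exceeds 1/2 = sin(\<pi>/6), so
  8/15 exceeds \<pi>/6. The value 16/5 is sharp enough for \<open>one_minus_cos_le\<close> at r = 5,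
  where 12 \<pi>^2 \<le> 125 is required.\<close>

lemma pi_less_16_div_5: "pi < 16 / 5"
proof (rule ccontr)
  assume "\<not> ?thesis"
  then have le: "8 / 15 \<le> pi / 6" by simp
  have "sin (8 / 15) \<le> sin (pi / 6)"
    using le pi_gt_zero by (subst sin_mono_le_eq) auto
  then have "sin (8 / 15 :: real) \<le> 1 / 2" by (simp add: sin_30)
  moreover have "\<bar>sin (8 / 15 :: real) - (\<Sum>m<5. sin_coeff m * (8 / 15) ^ m)\<bar> \<le> inverse (fact 5) * \<bar>8 / 15\<bar> ^ 5"
    by (rule Maclaurin_sin_bound)
  moreover have "(\<Sum>m<5. sin_coeff m * (8 / 15) ^ m) = 8 / 15 - (8 / 15 :: real) ^ 3 / 6"
  proof -
    have "{..<5::nat} = {0, 1, 2, 3, 4}" by auto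
    then show ?thesis by (simp add: sin_coeff_def fact_numeral)
  qed
  ultimately have "\<bar>sin (8 / 15) - (8 / 15 - (8 / 15 :: real) ^ 3 / 6)\<bar> \<le> (8 / 15) ^ 5 / 120"
    "sin (8 / 15 :: real) \<le> 1 / 2"
    by (simp_all add: fact_numeral)
  then show False by (simp add: power_divide abs_le_iff)
qed

text \<open>For r \<ge> 5 the estimate 1 - cos(2x) = 2 sin(x)^2 \<le> 2 x^2 with x = \<pi>/r
  suffices. It is too weak for r = 4, but there the cosine is 0 and both sides equal 1.\<close>

lemma one_minus_cos_le:
  assumes "4 \<le> (r::nat)"
  shows "1 - cos (2 * pi / real r) \<le> 5 / (real r + 1)"
proof (cases "r = 4")
  case True
  then have "2 * pi / real r = pi / 2" by simp
  then show ?thesis using True by simp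
next
  case False
  then have r: "5 \<le> r" using assms by simp
  define y where "y = real r"
  have y: "5 \<le> y" using r by (simp add: y_def)
  have "1 - cos (2 * pi / y) = 2 * (sin (pi / y))\<^sup>2"
    using cos_double_sin[of "pi / y"] by simp
  also have "\<dots> \<le> 2 * (pi / y)\<^sup>2"
  proof -
    have "\<bar>sin (pi / y)\<bar> \<le> \<bar>pi / y\<bar>" by (rule abs_sin_x_le_abs_x)
    then have "(sin (pi / y))\<^sup>2 \<le> (pi / y)\<^sup>2" by (simp only: abs_le_square_iff)
    then show ?thesis by simp
  qed
  also have "\<dots> \<le> 5 / (y + 1)"
  proof -
    have "pi\<^sup>2 \<le> (16 / 5)\<^sup>2" using pi_less_16_div_5 by (intro power_mono) auto
    then have "2 * pi\<^sup>2 * (y + 1) \<le> 2 * (16 / 5)\<^sup>2 * (y + 1)" using y by simp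
    also have "\<dots> \<le> 5 * y\<^sup>2"
    proof -
      have "2 * (16 / 5)\<^sup>2 * (y + 1) = (512 * y + 512) / 25"
        by (simp add: power2_eq_square field_simps)
      also have "\<dots> \<le> 5 * (5 * y)" using y by simp
      also have "\<dots> \<le> 5 * (y * y)" using y by (intro mult_left_mono mult_right_mono) auto
      finally show ?thesis by (simp only: power2_eq_square)
    qed
    finally have "2 * pi\<^sup>2 * (y + 1) / y\<^sup>2 \<le> 5" using y by (simp only: pos_divide_le_eq zero_less_power)
    then have "2 * (pi / y)\<^sup>2 * (y + 1) \<le> 5" by (simp add: power_divide)
    then show ?thesis using y by (simp only: pos_le_divide_eq)
  qed
  finally show ?thesis by (simp add: y_def)
qed

text \<open>Compare cubes. The bound 15/4 is what the factor m / (m - 1) = 4/3 leaves of 5 in the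
  case m = 4 of \<open>trace_estimate\<close>.\<close>

lemma four_powr_le: "4 powr (2 / 3) \<le> (15 / 4 :: real)"
proof (rule power_le_imp_le_base)
  have "(4 powr (2 / 3)) ^ 3 = (4 powr (2 / 3)) powr (3 :: real)" by (simp only: powr_numeral powr_ge_zero)
  also have "\<dots> = (16 :: real)" unfolding powr_powr by simp
  finally show "(4 powr (2 / 3)) ^ Suc 2 \<le> (15 / 4 :: real) ^ Suc 2"
    by (simp add: numeral_3_eq_3[symmetric] power_divide)
qed simp

text \<open>With x = m^(2/k) the claim reads x m / (m - 1) \<le> 5. For m \<ge> 5 use x \<le> 4,
  from m \<le> 2^k, and m / (m - 1) \<le> 5/4. For m = 2 and m = 3 use x \<le> m, and for m = 4 use
  k \<ge> 3. At m = 4 and k = 2 the left side is 16/3, so this pair is treated separately.\<close>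

lemma trace_estimate:
  assumes k: "2 \<le> (k::nat)" and m: "2 \<le> (m::nat)" "m \<le> 2 ^ k" and not: "\<not> (m = 4 \<and> k = 2)"
  shows "real m / (real m - 1) \<le> 5 * real m powr (- 2 / real k)"
proof -
  define x where "x = real m powr (2 / real k)"
  have x: "x > 0" using m by (simp add: x_def)
  have inv: "real m powr (- 2 / real k) = 1 / x"
    by (simp add: x_def powr_minus_divide[symmetric])
  have "x * (real m / (real m - 1)) \<le> 5"
  proof (cases "m \<ge> 5")
    case True
    have "x \<le> (2 ^ k) powr (2 / real k)"
      unfolding x_def using of_nat_mono[OF m(2), where 'a = real] by (intro powr_mono2) auto
    also have "\<dots> = 4"
      using k by (simp add: powr_realpow[symmetric] powr_powr)
    finally have "x \<le> 4" .
    moreover have "real m / (real m - 1) \<le> 5 / 4" using True by (simp add: divide_simps)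
    ultimately have "x * (real m / (real m - 1)) \<le> 4 * (5 / 4)"
      using m x by (intro mult_mono) auto
    then show ?thesis by simp
  next
    case False
    have le: "x \<le> real m"
      unfolding x_def using k m powr_mono[of "2 / real k" 1 "real m"] by simp
    from False consider "m = 2" | "m = 3" | "m = 4" using m by linarith
    then show ?thesis
    proof cases
      case 3
      then have "3 \<le> k" using not k by simp
      then have "x \<le> 4 powr (2 / 3)"
        unfolding x_def 3 using k by (simp add: powr_mono divide_simps)
      also note four_powr_le
      finally show ?thesis using 3 by simp
    qed (use le in simp_all)
  qed
  then have "real m / (real m - 1) \<le> 5 / x"
    using x by (simp only: pos_le_divide_eq mult.commute)
  then show ?thesis by (simp only: inv times_divide_eq_right mult_1_right)
qed

section \<open>Characters close to the trivial one\<close>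

lemma involution_transversal:
  assumes f: "\<And>x. x \<in> A \<Longrightarrow> f x \<in> A" "\<And>x. x \<in> A \<Longrightarrow> f (f x) = x" "\<And>x. x \<in> A \<Longrightarrow> f x \<noteq> x"
  shows "\<exists>T\<subseteq>A. A = T \<union> f ` T \<and> T \<inter> f ` T = {}"
proof -
  \<comment> \<open>The choice is made from the unordered pair, so it is the same for
    \<open>x\<close> and \<open>f x\<close>; its image contains exactly one element of each
    pair.\<close>
  define c where "c x = (SOME y. y \<in> {x, f x})" for x
  have c: "c x \<in> {x, f x}" for x unfolding c_def by (rule someI_ex) blast
  have cf: "c (f x) = c x" if "x \<in> A" for x
    using f(2)[OF that] by (simp add: c_def insert_commute)
  have cc: "c y = y" if "y \<in> c ` A" for y
  proof -
    from that obtain x where x: "x \<in> A" "y = c x" by blast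
    then have "y = x \<or> y = f x" using c[of x] by simp
    then show ?thesis using cf[OF x(1)] x(2) by auto
  qed
  have "x \<in> c ` A \<union> f ` c ` A" if x: "x \<in> A" for x
  proof (cases "c x = x")
    case True
    then show ?thesis using x by (metis UnI1 imageI)
  next
    case False
    then have "c x = f x" using c[of x] by simp
    then have "x = f (c x)" using f(2)[OF x] by simp
    then show ?thesis using x by blast
  qed
  moreover have "c x \<in> A" if "x \<in> A" for x using c[of x] f(1)[OF that] that by auto
  moreover have "y \<notin> f ` c ` A" if y: "y \<in> c ` A" for y
  proof
    assume "y \<in> f ` c ` A"
    then obtain z where z: "z \<in> c ` A" "y = f z" by blast
    have zA: "z \<in> A" using z(1) \<open>\<And>x. x \<in> A \<Longrightarrow> c x \<in> A\<close> by blast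
    have "y = c y" using cc[OF y] by simp
    also have "\<dots> = c z" unfolding z(2) by (rule cf[OF zA])
    also have "\<dots> = z" by (rule cc[OF z(1)])
    finally show False using z(2) f(3)[OF zA] by simp
  qed
  ultimately show ?thesis using f(1) by (intro exI[of _ "c ` A"]) blast
qed

lemma (in group) image_inv_symmetric_mset:
  assumes "symmetric_mset G S"
  shows "image_mset (\<lambda>s. inv s) S = S"
proof (rule multiset_eqI)
  have SG: "set_mset S \<subseteq> carrier G" using assms by (simp add: symmetric_mset_def)
  fix g
  show "count (image_mset (\<lambda>s. inv s) S) g = count S g"
  proof (cases "g \<in> carrier G")
    case True
    have "(\<lambda>s. inv s) -` {g} \<inter> set_mset S = {inv g} \<inter> set_mset S"
      using True SG by auto
    moreover have "count S (inv g) = count S g"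
      using assms True by (simp add: symmetric_mset_def)
    ultimately show ?thesis
      by (cases "inv g \<in># S") (auto simp: count_image_mset not_in_iff)
  next
    case False
    then have "g \<notin># S" "g \<notin># image_mset (\<lambda>s. inv s) S" using SG by auto
    then show ?thesis by (simp only: not_in_iff)
  qed
qed

text \<open>Off \<open>I\<close>, inversion acts on the underlying set of \<open>S\<close> without
  fixed points, so that part consists of pairs and \<open>T\<close> takes one element of each.
  \<open>I\<close> also contains the identity if it occurs in \<open>S\<close>. Multiplicities in
  \<open>S\<close> are forgotten, which leaves an inequality for the size.\<close>

lemma (in group) symmetric_mset_transversal:
  assumes S: "symmetric_mset G S"
  defines "I \<equiv> {s \<in> set_mset S. s \<otimes> s = \<one>}"
  shows "\<exists>T. T \<subseteq> set_mset S \<and> set_mset S = I \<union> T \<union> m_inv G ` T \<and> card I + 2 * card T \<le> size S"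
proof -
  have SG: "s \<in> carrier G" if "s \<in># S" for s using S that by (auto simp: symmetric_mset_def)
  have inv_mem: "inv s \<in># S" if "s \<in># S" for s
  proof -
    have "inv s \<in># image_mset (\<lambda>s. inv s) S" using that by simp
    then show ?thesis by (simp only: image_inv_symmetric_mset[OF S])
  qed
  have invol: "s \<otimes> s = \<one> \<longleftrightarrow> inv s = s" if "s \<in># S" for s
  proof
    show "inv s = s" if "s \<otimes> s = \<one>" using inv_equality[OF that] SG \<open>s \<in># S\<close> by simp
    show "s \<otimes> s = \<one>" if "inv s = s" using r_inv[OF SG[OF \<open>s \<in># S\<close>]] that by simp
  qed
  have mem: "s \<in> set_mset S - I \<longleftrightarrow> s \<in># S \<and> inv s \<noteq> s" for s
    unfolding I_def using invol[of s] by blast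
  have "\<exists>T\<subseteq>set_mset S - I. set_mset S - I = T \<union> m_inv G ` T \<and> T \<inter> m_inv G ` T = {}"
  proof (rule involution_transversal)
    fix s assume "s \<in> set_mset S - I"
    then have s: "s \<in># S" "inv s \<noteq> s" unfolding mem by blast+
    show "inv s \<noteq> s" by (rule s(2))
    show "inv (inv s) = s" using SG[OF s(1)] by simp
    then show "inv s \<in> set_mset S - I" unfolding mem using inv_mem[OF s(1)] s(2) by auto
  qed
  then obtain T where T: "T \<subseteq> set_mset S - I" "set_mset S - I = T \<union> m_inv G ` T" "T \<inter> m_inv G ` T = {}"
    by blast
  have "inj_on (m_inv G) T" using T(1) SG by (intro inj_on_inverseI[where g = "m_inv G"]) auto
  moreover have "finite T" using T(1) by (rule finite_subset) simp
  ultimately have "card (set_mset S - I) = 2 * card T"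
    unfolding T(2) using T(3) by (simp add: card_Un_disjoint card_image)
  moreover have "card (set_mset S - I) = card (set_mset S) - card I" "card I \<le> card (set_mset S)"
    by (simp_all add: I_def card_Diff_subset card_mono)
  moreover have "card (set_mset S) \<le> size S"
    by (induction S) (simp_all add: card_insert_if)
  ultimately have "card I + 2 * card T \<le> size S" by linarith
  moreover have "set_mset S = I \<union> T \<union> m_inv G ` T" using T(2) by (auto simp: I_def)
  ultimately show ?thesis using T(1) by blast
qed

context abelian_quotient
begin

text \<open>Each character is put into a box that records its sign on \<open>I\<close> and, for each
  t in \<open>T\<close>, which of \<open>r\<close> arcs of length 2\<pi>/r contains its value. There
  are fewer boxes than characters, and two characters in one box have a quotient that is 1 on
  \<open>I\<close> and has argument below 2\<pi>/r on \<open>T\<close>. Inverses only conjugate the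
  values and keep the real parts.\<close>

lemma pigeonhole_char:
  fixes r :: nat
  assumes fin: "finite dual" and r: "2 \<le> r" and I: "finite I" "\<And>s. s \<in> I \<Longrightarrow> s \<in> carrier G \<and> s \<otimes> s = \<one>"
    and T: "finite T" "T \<subseteq> carrier G" and card: "2 ^ card I * r ^ card T < card dual"
  shows "\<exists>\<chi>\<in>dual - {trivial_char}. \<forall>s\<in>I \<union> T \<union> m_inv G ` T. cos (2 * pi / real r) \<le> Re (\<chi> s)"
proof -
  \<comment> \<open>As \<open>Arg\<close> takes values in the interval from -\<pi> (excluded) to
    \<pi> (included), subtracting it from \<pi> gives a position in [0, 2\<pi>). So the floor of
    \<open>a\<close> is an arc number from 0 to r - 1.\<close>
  define a where "a \<chi> t = real r * (pi - Arg (\<chi> t)) / (2 * pi)" for \<chi> :: "'a \<Rightarrow> complex" and t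
  define box where "box \<chi> = (restrict (\<lambda>s. \<chi> s = 1) I, restrict (\<lambda>t. \<lfloor>a \<chi> t\<rfloor>) T)" for \<chi>
  have a: "0 \<le> a \<chi> t" "a \<chi> t < real r" for \<chi> t
  proof -
    have "0 \<le> pi - Arg (\<chi> t)" "pi - Arg (\<chi> t) < 2 * pi" using Arg_bounded[of "\<chi> t"] by linarith+
    then show "0 \<le> a \<chi> t" "a \<chi> t < real r" using r by (simp_all add: a_def pos_divide_less_eq)
  qed
  let ?B = "(I \<rightarrow>\<^sub>E (UNIV :: bool set)) \<times> (T \<rightarrow>\<^sub>E {0..<int r})"
  have "\<lfloor>a \<chi> t\<rfloor> \<in> {0..<int r}" for \<chi> t using a[of \<chi> t] by (auto simp: floor_less_iff)
  then have sub: "box ` dual \<subseteq> ?B" by (auto simp: box_def)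
  have finB: "finite ?B" using I T by (intro finite_cartesian_product finite_PiE) auto
  have "card ?B = 2 ^ card I * r ^ card T"
    using I T by (simp add: card_cartesian_product card_PiE)
  then have "\<not> inj_on box dual"
    using card card_inj_on_le[OF _ sub finB] by linarith
  then obtain \<chi> \<psi> where \<chi>: "\<chi> \<in> dual" and \<psi>: "\<psi> \<in> dual" and "\<chi> \<noteq> \<psi>" and eq: "box \<chi> = box \<psi>"
    by (auto simp: inj_on_def)
  define \<xi> where "\<xi> = (\<lambda>x. \<chi> x * cnj (\<psi> x))"
  have \<xi>: "\<xi> \<in> dual - {trivial_char}"
    unfolding \<xi>_def using quotient_char[OF \<chi> \<psi> \<open>\<chi> \<noteq> \<psi>\<close>] .
  have eqI: "(\<chi> s = 1) = (\<psi> s = 1)" if "s \<in> I" for s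
  proof -
    have "restrict (\<lambda>s. \<chi> s = 1) I = restrict (\<lambda>s. \<psi> s = 1) I"
      using eq by (simp only: box_def prod.inject)
    from fun_cong[OF this, of s] show ?thesis using that by simp
  qed
  have eqT: "\<lfloor>a \<chi> t\<rfloor> = \<lfloor>a \<psi> t\<rfloor>" if "t \<in> T" for t
  proof -
    have "restrict (\<lambda>t. \<lfloor>a \<chi> t\<rfloor>) T = restrict (\<lambda>t. \<lfloor>a \<psi> t\<rfloor>) T"
      using eq by (simp only: box_def prod.inject)
    from fun_cong[OF this, of t] show ?thesis using that by simp
  qed
  have sgn: "\<zeta> s = 1 \<or> \<zeta> s = - 1" if "\<zeta> \<in> dual" "s \<in> I" for \<zeta> s
  proof -
    have "\<zeta> (s \<otimes> s) = \<zeta> s * \<zeta> s" using that I by (intro chars_mult[OF that(1)]) auto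
    then have "(\<zeta> s)\<^sup>2 = 1" using that I chars_one[OF that(1)] subgroup.one_closed[OF K]
      by (simp add: power2_eq_square)
    then show ?thesis by (simp add: power2_eq_1_iff)
  qed
  have onI: "Re (\<xi> s) = 1" if "s \<in> I" for s
    using sgn[OF \<chi> that] sgn[OF \<psi> that] eqI[OF that] by (auto simp: \<xi>_def)
  have onT: "cos (2 * pi / real r) \<le> Re (\<xi> t)" if t: "t \<in> T" for t
  proof -
    define d where "d = Arg (\<chi> t) - Arg (\<psi> t)"
    have tG: "t \<in> carrier G" using t T by auto
    have "norm (\<chi> t) = 1" "norm (\<psi> t) = 1" using norm_char \<chi> \<psi> tG by auto
    moreover from this have "\<chi> t \<noteq> 0" "\<psi> t \<noteq> 0" by auto
    ultimately have "cis (Arg (\<chi> t)) = \<chi> t" "cis (Arg (\<psi> t)) = \<psi> t"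
      using cis_Arg[of "\<chi> t"] cis_Arg[of "\<psi> t"] by (simp_all add: sgn_div_norm)
    then have "\<xi> t = cis (Arg (\<chi> t)) * cnj (cis (Arg (\<psi> t)))" by (simp add: \<xi>_def)
    also have "\<dots> = cis d" by (simp add: d_def cis_cnj cis_mult)
    finally have re: "Re (\<xi> t) = cos \<bar>d\<bar>" by simp
    have "\<bar>a \<chi> t - a \<psi> t\<bar> < 1" using eqT[OF t] by linarith
    also have "a \<chi> t - a \<psi> t = - (real r * d / (2 * pi))"
      by (simp add: a_def d_def diff_divide_distrib[symmetric] minus_divide_left right_diff_distrib)
    finally have "real r * \<bar>d\<bar> / (2 * pi) < 1" by (simp add: abs_mult)
    then have "\<bar>d\<bar> < 2 * pi / real r"
      using r by (simp add: pos_less_divide_eq mult.commute)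
    moreover have "2 * pi / real r \<le> pi" using r by (simp add: divide_simps)
    ultimately have "cos (2 * pi / real r) \<le> cos \<bar>d\<bar>"
      by (intro cos_monotone_0_pi_le) simp_all
    then show ?thesis by (simp only: re)
  qed
  have "cos (2 * pi / real r) \<le> Re (\<xi> s)" if s: "s \<in> I \<union> T \<union> m_inv G ` T" for s
  proof -
    consider "s \<in> I" | "s \<in> T" | t where "t \<in> T" "s = inv t" using s by blast
    then show ?thesis
    proof cases
      case 3
      then have "\<xi> s = cnj (\<xi> t)" using char_inv \<xi> T by auto
      then show ?thesis using onT[OF 3(1)] by simp
    qed (use onI onT in auto)
  qed
  then show ?thesis using \<xi> by blast
qed

text \<open>Suppose all nontrivial characters had negative sums. The two elements of
  \<open>S\<close> are either both self-inverse, with character values 1 or -1, or inverse to each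
  other, with conjugate values; in both cases the two real parts would be negative. Among three
  nontrivial characters two then have values in a common quadrant, and their quotient has
  nonnegative real parts, a contradiction. This covers the pair m = 4, k = 2 missing in
  \<open>trace_estimate\<close>.\<close>

lemma four_chars_two_generators:
  assumes fin: "finite dual" and four: "4 \<le> card dual" and S: "symmetric_mset G S" "size S = 2"
  shows "\<exists>\<chi>\<in>dual - {trivial_char}. 0 \<le> (\<Sum>s\<in>#S. Re (\<chi> s))"
proof (rule ccontr)
  assume "\<not> ?thesis"
  then have neg: "(\<Sum>s\<in>#S. Re (\<chi> s)) < 0" if "\<chi> \<in> dual - {trivial_char}" for \<chi>
    using that by (auto simp: not_le)
  obtain s S' where "S = add_mset s S'" "size S' = 1"
    using S(2) size_eq_Suc_imp_eq_union[of S 1] by auto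
  moreover then obtain t where "S' = {#t#}" using size_1_singleton_mset by blast
  ultimately have st: "S = {#s, t#}" by simp
  have G: "s \<in> carrier G" "t \<in> carrier G" using S(1) by (auto simp: symmetric_mset_def st)
  have "image_mset (\<lambda>s. inv s) S = S" by (rule image_inv_symmetric_mset[OF S(1)])
  then have "(inv s = s \<and> inv t = t) \<or> (inv s = t \<and> inv t = s)"
    by (auto simp: st add_eq_conv_ex)
  then have sign: "Im (\<chi> t) = 0 \<and> Im (\<chi> s) = 0 \<and> \<bar>Re (\<chi> s)\<bar> = 1 \<and> \<bar>Re (\<chi> t)\<bar> = 1
      \<or> Im (\<chi> t) = - Im (\<chi> s) \<and> Re (\<chi> t) = Re (\<chi> s)" if "\<chi> \<in> dual" for \<chi>
  proof
    assume i: "inv s = s \<and> inv t = t"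
    have "Im (\<chi> u) = 0 \<and> \<bar>Re (\<chi> u)\<bar> = 1" if "u \<in> carrier G" "inv u = u" for u
    proof -
      have "Im (\<chi> u) = 0" using char_inv[OF \<open>\<chi> \<in> dual\<close> that(1)] that(2)
        by (simp add: complex_eq_iff)
      then show ?thesis using norm_char[OF \<open>\<chi> \<in> dual\<close> that(1)] by (simp add: cmod_eq_Re)
    qed
    then show ?thesis using i G by blast
  next
    assume i: "inv s = t \<and> inv t = s"
    then have "\<chi> t = cnj (\<chi> s)" using char_inv[OF that G(1)] by simp
    then show ?thesis by simp
  qed
  have "\<not> inj_on (\<lambda>\<chi>. Im (\<chi> s) \<ge> 0) (dual - {trivial_char})"
  proof
    assume "inj_on (\<lambda>\<chi>. Im (\<chi> s) \<ge> 0) (dual - {trivial_char})"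
    then have "card (dual - {trivial_char}) \<le> card (UNIV :: bool set)"
      by (rule card_inj_on_le) auto
    then show False using four trivial_char fin by simp
  qed
  then obtain \<chi> \<psi> where \<chi>: "\<chi> \<in> dual - {trivial_char}" and \<psi>: "\<psi> \<in> dual - {trivial_char}"
    and ne: "\<chi> \<noteq> \<psi>" and im: "(Im (\<chi> s) \<ge> 0) = (Im (\<psi> s) \<ge> 0)"
    by (auto simp: inj_on_def)
  define \<xi> where "\<xi> = (\<lambda>x. \<chi> x * cnj (\<psi> x))"
  have \<xi>: "\<xi> \<in> dual - {trivial_char}" unfolding \<xi>_def using quotient_char \<chi> \<psi> ne by blast
  have im2: "0 \<le> Im (\<chi> s) * Im (\<psi> s)" using im
    by (cases "Im (\<chi> s) \<ge> 0") (auto simp: mult_nonneg_nonneg mult_nonpos_nonpos)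
  have sum: "(\<Sum>s\<in>#S. Re (\<zeta> s)) = Re (\<zeta> s) + Re (\<zeta> t)" for \<zeta> by (simp add: st)
  have re: "Re (\<zeta> s) < 0 \<and> Re (\<zeta> t) < 0" if "\<zeta> \<in> dual - {trivial_char}" for \<zeta>
    using neg[OF that] sign[of \<zeta>] that unfolding sum by auto
  have "0 \<le> Im (\<chi> t) * Im (\<psi> t)"
    using sign[of \<chi>] sign[of \<psi>] \<chi> \<psi> im2 by auto
  moreover have "0 \<le> Re (\<chi> s) * Re (\<psi> s)" "0 \<le> Re (\<chi> t) * Re (\<psi> t)"
    using re[OF \<chi>] re[OF \<psi>] by (auto simp: mult_nonpos_nonpos)
  ultimately have "0 \<le> (\<Sum>s\<in>#S. Re (\<xi> s))" unfolding sum using im2 by (simp add: \<xi>_def)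
  then show False using neg[OF \<xi>] by simp
qed

text \<open>The parameter \<open>m\<close> will be the index of the quotient, which
  \<open>card_chars_ge\<close> bounds by the number of characters. The three cases use the trace,
  the quadrant argument and the pigeonhole principle.\<close>

lemma exists_char_near_one:
  assumes fin: "finite dual" and m: "2 \<le> m" "m \<le> card dual"
    and S: "symmetric_mset G S" and k: "2 \<le> size S"
  shows "\<exists>\<chi>\<in>dual - {trivial_char}.
           1 - (\<Sum>s\<in>#S. Re (\<chi> s)) / real (size S) \<le> 5 * real m powr (- 2 / real (size S))"
proof -
  define k where "k = size S"
  have k2: "2 \<le> k" using k by (simp add: k_def)
  have SG: "set_mset S \<subseteq> carrier G" using S by (simp add: symmetric_mset_def)
  consider "m \<le> 2 ^ k" "\<not> (m = 4 \<and> k = 2)" | "m = 4" "k = 2" | "2 ^ k < m" by linarith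
  then show ?thesis
  proof cases
    case 1
    obtain \<chi> where \<chi>: "\<chi> \<in> dual - {trivial_char}"
        "(\<Sum>s\<in>#S. Re (\<chi> s)) \<ge> - real k / (real (card dual) - 1)"
      using trace_bound[OF fin _ SG] m unfolding k_def by auto
    have "- (\<Sum>s\<in>#S. Re (\<chi> s)) / real k \<le> (real k / (real (card dual) - 1)) / real k"
      using \<chi>(2) by (intro divide_right_mono) auto
    also have "\<dots> = 1 / (real (card dual) - 1)" using k2 by simp
    also have "\<dots> \<le> 1 / (real m - 1)" using m by (intro divide_left_mono) auto
    finally have "1 - (\<Sum>s\<in>#S. Re (\<chi> s)) / real k \<le> 1 + 1 / (real m - 1)" by simp
    also have "\<dots> = real m / (real m - 1)" using m by (simp add: field_simps)
    also have "\<dots> \<le> 5 * real m powr (- 2 / real k)" using trace_estimate[OF k2 m(1) 1] .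
    finally show ?thesis using \<chi>(1) by (auto simp: k_def)
  next
    case 2
    then obtain \<chi> where \<chi>: "\<chi> \<in> dual - {trivial_char}" "0 \<le> (\<Sum>s\<in>#S. Re (\<chi> s))"
      using four_chars_two_generators[OF fin _ S] m by (auto simp: k_def)
    then have "1 - (\<Sum>s\<in>#S. Re (\<chi> s)) / real k \<le> 1" by simp
    also have "\<dots> \<le> 5 * real m powr (- 2 / real k)" using 2 by (simp add: powr_minus_divide)
    finally show ?thesis using \<chi>(1) by (auto simp: k_def)
  next
    case 3
    define y where "y = real m powr (1 / real k)"
    have yk: "y ^ k = real m" using m k2 by (simp add: y_def powr_realpow[symmetric] powr_powr)
    have y0: "0 \<le> y" by (simp add: y_def)
    have y2: "2 < y"
    proof (rule power_less_imp_less_base[OF _ y0])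
      show "2 ^ k < y ^ k" unfolding yk using 3 by (metis of_nat_less_iff of_nat_numeral of_nat_power)
    qed
    \<comment> \<open>The largest integer strictly below y^2. Being below y^2 makes the number of
      boxes smaller than y^k = m, while y^2 \<le> r + 1 turns the final bound 5 / (r + 1) into 5 /
      y^2.\<close>
    define r where "r = nat \<lceil>y\<^sup>2\<rceil> - 1"
    have "4 < y\<^sup>2" using y2 power_strict_mono[of 2 y 2] by simp
    then have r: "4 \<le> r" "real r < y\<^sup>2" "y\<^sup>2 \<le> real r + 1" unfolding r_def by linarith+
    define I where "I = {s \<in> set_mset S. s \<otimes> s = \<one>}"
    obtain T where T: "T \<subseteq> set_mset S" "set_mset S = I \<union> T \<union> m_inv G ` T" "card I + 2 * card T \<le> k"
      using symmetric_mset_transversal[OF S] unfolding I_def k_def by blast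
    have finI: "finite I" and finT: "finite T" using T(1) by (auto simp: I_def intro: finite_subset)
    \<comment> \<open>The count of boxes has to be strictly smaller than the power of y, which needs
      at least one factor.\<close>
    have "I \<noteq> {} \<or> T \<noteq> {}" using T(2) k by auto
    then have pos: "0 < card I \<or> 0 < card T" using finI finT by (simp add: card_gt_0_iff)
    have "2 ^ card I * real r ^ card T < y ^ card I * (y\<^sup>2) ^ card T"
    proof (cases "0 < card I")
      case True
      then have "(2::real) ^ card I < y ^ card I" using y2 by (intro power_strict_mono) auto
      moreover have "real r ^ card T \<le> (y\<^sup>2) ^ card T" using r by (intro power_mono) auto
      ultimately show ?thesis using r by (intro mult_less_le_imp_less) auto
    next
      case False
      then have "real r ^ card T < (y\<^sup>2) ^ card T" using r pos by (intro power_strict_mono) auto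
      then show ?thesis using False by simp
    qed
    also have "\<dots> = y ^ (card I + 2 * card T)" by (simp add: power_add power_mult)
    also have "\<dots> \<le> y ^ k" using T(3) y2 by (intro power_increasing) auto
    also have "\<dots> \<le> real (card dual)" using m by (simp add: yk)
    finally have "real (2 ^ card I * r ^ card T) < real (card dual)" by simp
    then have "2 ^ card I * r ^ card T < card dual" by (simp only: of_nat_less_iff)
    then have "\<exists>\<chi>\<in>dual - {trivial_char}. \<forall>s\<in>I \<union> T \<union> m_inv G ` T. cos (2 * pi / real r) \<le> Re (\<chi> s)"
      using r SG T(1) by (intro pigeonhole_char fin finI finT) (auto simp: I_def)
    then obtain \<chi> where \<chi>: "\<chi> \<in> dual - {trivial_char}"
        "\<And>s. s \<in># S \<Longrightarrow> cos (2 * pi / real r) \<le> Re (\<chi> s)"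
      unfolding T(2)[symmetric] by blast
    have "real k * cos (2 * pi / real r) = (\<Sum>s\<in>#S. cos (2 * pi / real r))" by (simp add: k_def)
    also have "\<dots> \<le> (\<Sum>s\<in>#S. Re (\<chi> s))" using \<chi>(2) by (intro sum_mset_mono) auto
    finally have "1 - (\<Sum>s\<in>#S. Re (\<chi> s)) / real k \<le> 1 - cos (2 * pi / real r)"
      using k2 by (simp add: field_simps)
    also have "\<dots> \<le> 5 / (real r + 1)" by (rule one_minus_cos_le[OF r(1)])
    also have "\<dots> \<le> 5 / y\<^sup>2" using r(3) y2 by (intro divide_left_mono) auto
    also have "y\<^sup>2 = real m powr (2 / real k)"
      by (simp add: y_def power2_eq_square powr_add[symmetric])
    also have "5 / real m powr (2 / real k) = 5 * real m powr (- 2 / real k)"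
      by (simp add: powr_minus_divide)
    finally show ?thesis using \<chi>(1) by (auto simp: k_def)
  qed
qed

end

section \<open>The gap of an action and the index of an abelian quotient\<close>

locale transitive_quotient = transitive_action G E \<phi> + abelian_quotient G K
  for G (structure) and E \<phi> K +
  fixes \<omega>
  assumes base: "\<omega> \<in> E" and stabilizer_subset: "stabilizer G \<phi> \<omega> \<subseteq> K" and fin_E: "finite E"
begin

text \<open>Elements that move \<open>\<omega>\<close> to the same point differ by an element of its
  stabilizer, on which characters are 1. Hence a character descends to a function on
  \<open>E\<close>.\<close>

lemma char_cong_on_orbit:
  assumes "\<chi> \<in> dual" "g \<in> carrier G" "h \<in> carrier G" "\<phi> g \<omega> = \<phi> h \<omega>"
  shows "\<chi> g = \<chi> h"
proof -
  have "\<phi> (inv h \<otimes> g) \<omega> = \<phi> (inv h) (\<phi> h \<omega>)"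
    using assms base by (simp add: composition_rule)
  also have "\<dots> = \<omega>" using orbit_sym_aux[OF assms(3) base refl] .
  finally have "inv h \<otimes> g \<in> K" using assms stabilizer_subset by (auto simp: stabilizer_def)
  then have "\<chi> (h \<otimes> (inv h \<otimes> g)) = \<chi> h"
    using chars_mult[OF assms(1,3)] chars_one[OF assms(1)] assms by simp
  then show ?thesis using assms by (simp add: m_assoc[symmetric])
qed

text \<open>The function sending \<open>\<phi> g \<omega>\<close> to the real part of \<chi>(g) is
  an eigenfunction: by symmetry of \<open>S\<close> the imaginary parts cancel in the sum over
  \<open>S\<close>, so the eigenvalue is the average of the real parts. It is not constant, since a
  value of modulus 1 other than 1 has real part different from 1; it is therefore independent of the
  constants, which have eigenvalue 1.\<close>

lemma action_gap_le_char:
  assumes S: "symmetric_mset G S" "0 < size S" and \<chi>: "\<chi> \<in> dual - {trivial_char}"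
  shows "action_gap \<phi> E S \<le> 1 - (\<Sum>s\<in>#S. Re (\<chi> s)) / real (size S)"
proof -
  define l where "l = (\<Sum>s\<in>#S. Re (\<chi> s)) / real (size S)"
  define f where "f x = Re (\<chi> (SOME g. g \<in> carrier G \<and> \<phi> g \<omega> = x))" for x
  have \<chi>': "\<chi> \<in> dual" using \<chi> by simp
  have SG: "s \<in> carrier G" if "s \<in># S" for s using S(1) that by (auto simp: symmetric_mset_def)
  have f: "f (\<phi> g \<omega>) = Re (\<chi> g)" if g: "g \<in> carrier G" for g
  proof -
    define h where "h = (SOME h. h \<in> carrier G \<and> \<phi> h \<omega> = \<phi> g \<omega>)"
    have "\<exists>h. h \<in> carrier G \<and> \<phi> h \<omega> = \<phi> g \<omega>" using g by blast
    then have "h \<in> carrier G \<and> \<phi> h \<omega> = \<phi> g \<omega>" unfolding h_def by (rule someI_ex)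
    then have "\<chi> h = \<chi> g" using char_cong_on_orbit[OF \<chi>' _ g] by blast
    then show ?thesis by (simp only: f_def h_def)
  qed
  have "(\<Sum>s\<in>#S. Im (\<chi> s)) = (\<Sum>s\<in>#image_mset (\<lambda>s. inv s) S. Im (\<chi> s))"
    by (simp only: image_inv_symmetric_mset[OF S(1)])
  also have "\<dots> = (\<Sum>s\<in>#S. - Im (\<chi> s))"
    unfolding multiset.map_comp comp_def using SG
    by (intro arg_cong[of _ _ sum_mset] image_mset_cong) (simp add: char_inv[OF \<chi>'])
  also have "\<dots> = - (\<Sum>s\<in>#S. Im (\<chi> s))" by (induction S) simp_all
  finally have im: "(\<Sum>s\<in>#S. Im (\<chi> s)) = 0" by simp
  have eig: "1 / real (size S) * (\<Sum>s\<in>#S. f (\<phi> s x)) = l * f x" if xE: "x \<in> E" for x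
  proof -
    obtain g where g: "g \<in> carrier G" "x = \<phi> g \<omega>" using unique_orbit[OF base xE] by blast
    have "f (\<phi> s x) = Re (\<chi> s) * Re (\<chi> g) - Im (\<chi> s) * Im (\<chi> g)" if "s \<in># S" for s
    proof -
      have "\<phi> s x = \<phi> (s \<otimes> g) \<omega>" using g SG[OF that] base by (simp add: composition_rule)
      then show ?thesis using f[of "s \<otimes> g"] g SG[OF that] chars_mult[OF \<chi>', of s g] by simp
    qed
    then have "(\<Sum>s\<in>#S. f (\<phi> s x)) = (\<Sum>s\<in>#S. Re (\<chi> s) * Re (\<chi> g) - Im (\<chi> s) * Im (\<chi> g))"
      by (intro arg_cong[of _ _ sum_mset] image_mset_cong)
    also have "\<dots> = (\<Sum>s\<in>#S. Re (\<chi> s)) * Re (\<chi> g) - (\<Sum>s\<in>#S. Im (\<chi> s)) * Im (\<chi> g)"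
      by (induction S) (simp_all add: algebra_simps)
    finally have "(\<Sum>s\<in>#S. f (\<phi> s x)) = (\<Sum>s\<in>#S. Re (\<chi> s)) * f x"
      unfolding im g(2) f[OF g(1)] by simp
    then show ?thesis by (simp add: l_def)
  qed
  have "\<exists>g\<in>carrier G. \<chi> g \<noteq> 1"
  proof (rule ccontr)
    assume "\<not> ?thesis"
    then have one: "\<forall>x\<in>carrier G. \<chi> x = 1" by (simp only: bex_simps not_not)
    have "\<chi> = trivial_char"
    proof
      fix x
      show "\<chi> x = trivial_char x"
      proof (cases "x \<in> carrier G")
        case True
        then show ?thesis using bspec[OF one True] by (simp add: trivial_char_def)
      next
        case False
        then show ?thesis using chars_outside[OF \<chi>' False] by (simp add: trivial_char_def)
      qed
    qed
    with \<chi> show False by blast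
  qed
  then obtain g where g: "g \<in> carrier G" "\<chi> g \<noteq> 1" ..
  have "Re (\<chi> g) \<noteq> 1"
  proof
    assume "Re (\<chi> g) = 1"
    moreover have "(Re (\<chi> g))\<^sup>2 + (Im (\<chi> g))\<^sup>2 = 1"
      unfolding cmod_power2[symmetric] norm_char[OF \<chi>' g(1)] by simp
    ultimately show False using g(2) by (simp add: complex_eq_iff)
  qed
  have "f (\<phi> \<one> \<omega>) = 1"
    using f[OF one_closed] chars_one[OF \<chi>'] subgroup.one_closed[OF K] by simp
  have "action_gap \<phi> E S \<le> 1 - min 1 l"
  proof (rule action_gap_le[where u = "\<lambda>_. 1" and v = f and x = "\<phi> \<one> \<omega>" and y = "\<phi> g \<omega>"])
    show "set_mset S \<subseteq> carrier G" using SG by blast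
    show "\<phi> \<one> \<omega> \<in> E" "\<phi> g \<omega> \<in> E" using element_image[OF _ base] g(1) by blast+
    show "1 / real (size S) * (\<Sum>s\<in>#S. 1) = 1 * 1" using S(2) by (simp add: nonempty_has_size)
    show "1 * f (\<phi> g \<omega>) \<noteq> 1 * f (\<phi> \<one> \<omega>)"
      using \<open>Re (\<chi> g) \<noteq> 1\<close> f[OF g(1)] \<open>f (\<phi> \<one> \<omega>) = 1\<close> by simp
    show "1 / real (size S) * (\<Sum>s\<in>#S. f (\<phi> s x)) = l * f x" if "x \<in> E" for x
      by (rule eig[OF that])
  qed (rule fin_E)
  moreover have "l \<le> 1"
  proof -
    have "(\<Sum>s\<in>#S. Re (\<chi> s)) \<le> (\<Sum>s\<in>#S. 1)"
      using Re_char_le[OF \<chi>'] SG by (intro sum_mset_mono) auto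
    then have "l \<le> real (size S) / real (size S)"
      unfolding l_def by (intro divide_right_mono) simp_all
    also have "\<dots> \<le> 1" by (cases "size S = 0") simp_all
    finally show ?thesis .
  qed
  ultimately show ?thesis unfolding l_def by linarith
qed

text \<open>The bound 2 serves the case \<open>size S = 1\<close>, where the exponent of the theorem
  is 0.\<close>

lemma action_gap_le_index:
  assumes fin: "finite dual" and m: "2 \<le> m" "m \<le> card dual"
    and S: "symmetric_mset G S" "0 < size S"
  shows "action_gap \<phi> E S \<le> 2"
    and "2 \<le> size S \<Longrightarrow> action_gap \<phi> E S \<le> 5 * real m powr (- 2 / real (size S))"
proof -
  show "action_gap \<phi> E S \<le> 5 * real m powr (- 2 / real (size S))" if size: "2 \<le> size S"
  proof -
    obtain \<chi> where "\<chi> \<in> dual - {trivial_char}"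
      "1 - (\<Sum>s\<in>#S. Re (\<chi> s)) / real (size S) \<le> 5 * real m powr (- 2 / real (size S))"
      using exists_char_near_one[OF fin m S(1) size] by blast
    then show ?thesis using action_gap_le_char[OF S] by (meson order_trans)
  qed
  have "dual - {trivial_char} \<noteq> {}"
  proof
    assume "dual - {trivial_char} = {}"
    then have "card dual \<le> card {trivial_char}" by (intro card_mono) auto
    then show False using m by simp
  qed
  then obtain \<chi> where \<chi>: "\<chi> \<in> dual - {trivial_char}" by blast
  have "- 1 \<le> Re (\<chi> s)" if "s \<in># S" for s
  proof -
    have "norm (\<chi> s) = 1" using that S(1) \<chi> by (intro norm_char) (auto simp: symmetric_mset_def)
    then show ?thesis using abs_Re_le_cmod[of "\<chi> s"] by linarith
  qed
  then have "(\<Sum>s\<in>#S. - 1) \<le> (\<Sum>s\<in>#S. Re (\<chi> s))" by (intro sum_mset_mono) auto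
  then have "- 1 \<le> (\<Sum>s\<in>#S. Re (\<chi> s)) / real (size S)"
    using S(2) by (simp add: pos_le_divide_eq)
  then show "action_gap \<phi> E S \<le> 2" using action_gap_le_char[OF S \<chi>] by linarith
qed

end

section \<open>Bilinearity of commutators in the lower central series\<close>

definition (in group) commutator :: "'a \<Rightarrow> 'a \<Rightarrow> 'a" where
  "commutator x y = x \<otimes> y \<otimes> inv x \<otimes> inv y"

context group
begin

lemma commutator_closed [simp]:
  "x \<in> carrier G \<Longrightarrow> y \<in> carrier G \<Longrightarrow> commutator x y \<in> carrier G"
  by (simp add: commutator_def)

lemma mult_eq_commutator_mult:
  assumes "x \<in> carrier G" "y \<in> carrier G"
  shows "x \<otimes> y = commutator x y \<otimes> (y \<otimes> x)"
proof -
  have "inv y \<otimes> (y \<otimes> x) = x" using assms by (simp add: m_assoc[symmetric])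
  then show ?thesis using assms by (simp add: commutator_def m_assoc)
qed

lemma lower_central_in_carrier: "lower_central G n \<subseteq> carrier G"
proof (induction n)
  case (Suc n)
  then show ?case by (auto intro!: generate_incl)
qed simp

lemma lower_central_subgroup: "subgroup (lower_central G n) G"
proof (cases n)
  case 0
  then show ?thesis by (simp add: subgroup_self)
next
  case (Suc m)
  then show ?thesis
    using lower_central_in_carrier[of m] by (auto intro!: generate_is_subgroup)
qed

lemma commutator_in_lower_central:
  "x \<in> lower_central G n \<Longrightarrow> y \<in> carrier G \<Longrightarrow> commutator x y \<in> lower_central G (Suc n)"
  by (auto simp: commutator_def intro!: generate.incl)

text \<open>A conjugate of a commutator is the commutator of the conjugates, and the first entry
  stays in the preceding term by induction.\<close>

lemma lower_central_normal: "lower_central G n \<lhd> G"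
proof (induction n)
  case 0
  then show ?case by (simp add: normal_self)
next
  case (Suc n)
  interpret N: normal "lower_central G n" G by (fact Suc.IH)
  show ?case
    unfolding lower_central.simps
  proof (rule normal_generateI)
    show "{x \<otimes> y \<otimes> inv x \<otimes> inv y |x y. x \<in> lower_central G n \<and> y \<in> carrier G} \<subseteq> carrier G"
      by auto
    fix h g assume "h \<in> {x \<otimes> y \<otimes> inv x \<otimes> inv y |x y. x \<in> lower_central G n \<and> y \<in> carrier G}"
      and g: "g \<in> carrier G"
    then obtain x y where h: "h = x \<otimes> y \<otimes> inv x \<otimes> inv y" "x \<in> lower_central G n" "y \<in> carrier G"
      by blast
    have x: "x \<in> carrier G" using h(2) by simp
    let ?x = "g \<otimes> x \<otimes> inv g" and ?y = "g \<otimes> y \<otimes> inv g"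
    have cancel: "inv g \<otimes> (g \<otimes> z) = z" if "z \<in> carrier G" for z
      using g that by (simp add: m_assoc[symmetric])
    have "g \<otimes> h \<otimes> inv g = ?x \<otimes> ?y \<otimes> inv ?x \<otimes> inv ?y"
      using g x h(3) by (simp add: h(1) inv_mult_group m_assoc cancel)
    moreover have "?x \<in> lower_central G n" using N.inv_op_closed2[OF g h(2)] .
    moreover have "?y \<in> carrier G" using g h(3) by simp
    ultimately show "g \<otimes> h \<otimes> inv g \<in> {x \<otimes> y \<otimes> inv x \<otimes> inv y |x y. x \<in> lower_central G n \<and> y \<in> carrier G}"
      by blast
  qed
qed

lemma lower_central_Suc_subset: "lower_central G (Suc n) \<subseteq> lower_central G n"
proof -
  interpret N: normal "lower_central G n" G by (rule lower_central_normal)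
  have "x \<otimes> y \<otimes> inv x \<otimes> inv y \<in> lower_central G n"
    if "x \<in> lower_central G n" "y \<in> carrier G" for x y
  proof -
    have "x \<otimes> (y \<otimes> inv x \<otimes> inv y) \<in> lower_central G n"
      using that N.inv_op_closed2[OF that(2) N.m_inv_closed[OF that(1)]] by blast
    then show ?thesis using that by (simp add: m_assoc)
  qed
  then show ?thesis
    unfolding lower_central.simps by (intro generate_subgroup_incl lower_central_subgroup) auto
qed

lemma coset_eqI:
  assumes "N \<lhd> G" "x \<in> carrier G" "y \<in> carrier G" "\<nu> \<in> N" "x = \<nu> \<otimes> y"
  shows "N #> x = N #> y"
proof -
  interpret normal N G by fact
  have "x \<in> N #> y" unfolding assms(5) using assms(3,4) by (intro rcosI) auto
  then show ?thesis using repr_independence[OF _ assms(3) is_subgroup] by simp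
qed

lemma coset_eqD:
  assumes "N \<lhd> G" "x \<in> carrier G" "N #> x = N #> y"
  shows "\<exists>\<nu>\<in>N. x = \<nu> \<otimes> y"
proof -
  interpret normal N G by fact
  have "x \<in> N #> y" using rcos_self[OF assms(2) is_subgroup] assms(3) by simp
  then show ?thesis by (auto simp: r_coset_def)
qed

end

text \<open>
  The setting of a layer of the lower central series: \<open>N\<close> and \<open>X\<close> play the roles of
  \<open>\<gamma>\<^sub>n\<^sub>+\<^sub>2\<close> and \<open>\<gamma>\<^sub>n\<close>, so that the commutator map becomes bilinear modulo \<open>N\<close>.
\<close>

locale bilinear_layer = group +
  fixes N X
  assumes N: "N \<lhd> G" and X: "subgroup X G"
    and central: "\<And>x y z. x \<in> X \<Longrightarrow> y \<in> carrier G \<Longrightarrow> z \<in> carrier G \<Longrightarrow>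
                    commutator (commutator x y) z \<in> N"
begin

sublocale N: normal N G by (rule N)

definition Q where "Q = G Mod N"

definition q where "q g = N #> g"

sublocale Q: group Q unfolding Q_def by (rule N.factorgroup_is_group)

sublocale q: group_hom G Q q
  using N.r_coset_hom_Mod by unfold_locales (simp add: Q_def q_def[abs_def])

abbreviation D where "D x y \<equiv> q (commutator x y)"

lemma q_eqI:
  assumes "x \<in> carrier G" "y \<in> carrier G" "\<nu> \<in> N" "x = \<nu> \<otimes> y"
  shows "q x = q y"
  unfolding q_def using N assms by (rule coset_eqI)

lemma q_eqD: "x \<in> carrier G \<Longrightarrow> q x = q y \<Longrightarrow> \<exists>\<nu>\<in>N. x = \<nu> \<otimes> y"
  unfolding q_def using N by (rule coset_eqD)

lemma q_eq_one_iff: "x \<in> carrier G \<Longrightarrow> q x = \<one>\<^bsub>Q\<^esub> \<longleftrightarrow> x \<in> N"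
  using coset_join1[OF _ _ N.is_subgroup, of x] coset_join2[OF _ N.is_subgroup, of x]
  by (auto simp: FactGroup_def Q_def q_def)

lemma mem_if_q_eq:
  assumes "subgroup B G" "N \<subseteq> B" "a \<in> carrier G" "q a = q b" "b \<in> B"
  shows "a \<in> B"
  using q_eqD[OF assms(3,4)] assms(1,2,5) by (auto intro: subgroup.m_closed)

lemma XG: "x \<in> X \<Longrightarrow> x \<in> carrier G"
  using X by (rule subgroup.mem_carrier)

lemma D_central:
  assumes "x \<in> X" "y \<in> carrier G" "z \<in> carrier G"
  shows "D x y \<otimes>\<^bsub>Q\<^esub> q z = q z \<otimes>\<^bsub>Q\<^esub> D x y"
proof -
  have c: "commutator x y \<in> carrier G" using assms by (simp add: XG)
  have "q (commutator x y \<otimes> z) = q (z \<otimes> commutator x y)"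
    using c assms(3) central[OF assms] mult_eq_commutator_mult[OF c assms(3)]
    by (intro q_eqI[of _ _ "commutator (commutator x y) z"]) auto
  then show ?thesis using c assms(3) by simp
qed

text \<open>One has \<open>[x x', y] = x [x', y] r\<close> with \<open>x r = [x, y]\<close>, and
  \<open>[x', y]\<close> is central modulo \<open>N\<close>, so it can be moved out. Linearity in
  the second entry comes in the same way from \<open>[x, y y'] = r [x, y'] inv y\<close> with
  \<open>r inv y = [x, y]\<close>.\<close>

lemma D_mult_left:
  assumes "x \<in> X" "x' \<in> X" "y \<in> carrier G"
  shows "D (x \<otimes> x') y = D x y \<otimes>\<^bsub>Q\<^esub> D x' y"
proof -
  have G: "x \<in> carrier G" "x' \<in> carrier G" "y \<in> carrier G" using assms by (auto simp: XG)
  define r where "r = y \<otimes> inv x \<otimes> inv y"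
  have r: "r \<in> carrier G" using G by (simp add: r_def)
  have cancel: "inv y \<otimes> (y \<otimes> z) = z" if "z \<in> carrier G" for z
    using G that by (simp add: m_assoc[symmetric])
  have c': "commutator x' y \<in> carrier G" using G by simp
  have "commutator (x \<otimes> x') y = x \<otimes> commutator x' y \<otimes> r"
    using G by (simp add: r_def commutator_def inv_mult_group m_assoc cancel)
  then have "D (x \<otimes> x') y = q x \<otimes>\<^bsub>Q\<^esub> D x' y \<otimes>\<^bsub>Q\<^esub> q r"
    using G(1) c' r by simp
  also have "\<dots> = D x' y \<otimes>\<^bsub>Q\<^esub> q x \<otimes>\<^bsub>Q\<^esub> q r"
    by (simp only: D_central[OF assms(2,3) G(1)])
  also have "\<dots> = D x' y \<otimes>\<^bsub>Q\<^esub> q (x \<otimes> r)"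
    using G(1) c' r by (simp add: Q.m_assoc)
  also have "x \<otimes> r = commutator x y"
    using G by (simp add: r_def commutator_def m_assoc)
  also have "D x' y \<otimes>\<^bsub>Q\<^esub> D x y = D x y \<otimes>\<^bsub>Q\<^esub> D x' y"
    using G assms by (intro D_central) auto
  finally show ?thesis .
qed

lemma D_mult_right:
  assumes "x \<in> X" "y \<in> carrier G" "y' \<in> carrier G"
  shows "D x (y \<otimes> y') = D x y \<otimes>\<^bsub>Q\<^esub> D x y'"
proof -
  have G: "x \<in> carrier G" "y \<in> carrier G" "y' \<in> carrier G" using assms by (auto simp: XG)
  define r where "r = x \<otimes> y \<otimes> inv x"
  have r: "r \<in> carrier G" using G by (simp add: r_def)
  have cancel: "inv x \<otimes> (x \<otimes> z) = z" if "z \<in> carrier G" for z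
    using G that by (simp add: m_assoc[symmetric])
  have c': "commutator x y' \<in> carrier G" using G by simp
  have "commutator x (y \<otimes> y') = r \<otimes> commutator x y' \<otimes> inv y"
    using G by (simp add: r_def commutator_def inv_mult_group m_assoc cancel)
  then have "D x (y \<otimes> y') = q r \<otimes>\<^bsub>Q\<^esub> D x y' \<otimes>\<^bsub>Q\<^esub> q (inv y)"
    using G(2) c' r by simp
  also have "\<dots> = q r \<otimes>\<^bsub>Q\<^esub> (D x y' \<otimes>\<^bsub>Q\<^esub> q (inv y))"
    using G(2) c' r by (intro Q.m_assoc) auto
  also have "\<dots> = q r \<otimes>\<^bsub>Q\<^esub> (q (inv y) \<otimes>\<^bsub>Q\<^esub> D x y')"
    using D_central[OF assms(1,3) inv_closed[OF G(2)]] by (simp only:)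
  also have "\<dots> = q (r \<otimes> inv y) \<otimes>\<^bsub>Q\<^esub> D x y'"
    using G(2) c' r by (simp add: Q.m_assoc)
  also have "r \<otimes> inv y = commutator x y" by (simp add: r_def commutator_def)
  finally show ?thesis .
qed

lemma D_one: "x \<in> X \<Longrightarrow> D x \<one> = \<one>\<^bsub>Q\<^esub>" "y \<in> carrier G \<Longrightarrow> D \<one> y = \<one>\<^bsub>Q\<^esub>"
  using q.hom_one by (simp_all add: commutator_def XG)

lemma D_pow_left:
  "x \<in> X \<Longrightarrow> y \<in> carrier G \<Longrightarrow> D (x [^] (n::nat)) y = D x y [^]\<^bsub>Q\<^esub> n"
  by (induction n) (simp_all add: D_one D_mult_left subgroup_nat_pow_closed[OF X])

lemma D_pow_right:
  "x \<in> X \<Longrightarrow> y \<in> carrier G \<Longrightarrow> D x (y [^] (n::nat)) = D x y [^]\<^bsub>Q\<^esub> n"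
  by (induction n) (simp_all add: D_one D_mult_right)

text \<open>This is the preimage of \<open>B\<close> under a homomorphism modulo \<open>N\<close>.
  Together with \<open>subgroup_right\<close> it reduces statements about all commutators to
  commutators of generators.\<close>

lemma subgroup_left:
  assumes "subgroup B G" "N \<subseteq> B" "y \<in> carrier G"
  shows "subgroup {x \<in> X. commutator x y \<in> B} G"
proof -
  note mod = mem_if_q_eq[OF assms(1,2)]
  note BG = subgroup.mem_carrier[OF assms(1)]
  show ?thesis
  proof (rule subgroupI)
    show "{x \<in> X. commutator x y \<in> B} \<subseteq> carrier G" using XG by auto
    have "commutator \<one> y = \<one>" using assms(3) by (simp add: commutator_def)
    then show "{x \<in> X. commutator x y \<in> B} \<noteq> {}"
      using subgroup.one_closed[OF X] subgroup.one_closed[OF assms(1)] by auto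
  next
    fix x assume "x \<in> {x \<in> X. commutator x y \<in> B}"
    then have x: "x \<in> X" "commutator x y \<in> B" by auto
    have ix: "inv x \<in> X" using subgroup.m_inv_closed[OF X x(1)] .
    have "D x y \<otimes>\<^bsub>Q\<^esub> D (inv x) y = \<one>\<^bsub>Q\<^esub>"
      using D_mult_left[OF x(1) ix assms(3)] D_one(2)[OF assms(3)] x by (simp add: XG)
    then have "D (inv x) y = inv\<^bsub>Q\<^esub> (D x y)"
      using Q.inv_equality[OF Q.inv_comm, of "D x y" "D (inv x) y"] x ix assms(3) by (simp add: XG)
    then have "D (inv x) y = q (inv (commutator x y))"
      using x assms(3) by (simp add: XG)
    then have "commutator (inv x) y \<in> B"
      using x ix assms(3) by (intro mod[OF _ _ subgroup.m_inv_closed[OF assms(1) x(2)]]) (simp_all add: XG)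
    then show "inv x \<in> {x \<in> X. commutator x y \<in> B}" using ix by simp
  next
    fix x x' assume "x \<in> {x \<in> X. commutator x y \<in> B}" "x' \<in> {x \<in> X. commutator x y \<in> B}"
    then have x: "x \<in> X" "commutator x y \<in> B" "x' \<in> X" "commutator x' y \<in> B" by auto
    have "D (x \<otimes> x') y = q (commutator x y \<otimes> commutator x' y)"
      using D_mult_left[OF x(1,3) assms(3)] x assms(3) by (simp add: XG)
    then have "commutator (x \<otimes> x') y \<in> B"
      using x assms(3) by (intro mod[OF _ _ subgroup.m_closed[OF assms(1) x(2,4)]]) (simp_all add: XG)
    then show "x \<otimes> x' \<in> {x \<in> X. commutator x y \<in> B}" using x X by (simp add: subgroup.m_closed)
  qed
qed

lemma subgroup_right:
  assumes "subgroup B G" "N \<subseteq> B" "x \<in> X"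
  shows "subgroup {y \<in> carrier G. commutator x y \<in> B} G"
proof -
  note mod = mem_if_q_eq[OF assms(1,2)]
  have xG: "x \<in> carrier G" using assms(3) by (rule XG)
  show ?thesis
  proof (rule subgroupI)
    show "{y \<in> carrier G. commutator x y \<in> B} \<subseteq> carrier G" by auto
    have "commutator x \<one> = \<one>" using xG by (simp add: commutator_def)
    then show "{y \<in> carrier G. commutator x y \<in> B} \<noteq> {}"
      using subgroup.one_closed[OF assms(1)] by auto
  next
    fix y assume "y \<in> {y \<in> carrier G. commutator x y \<in> B}"
    then have y: "y \<in> carrier G" "commutator x y \<in> B" by auto
    have "D x y \<otimes>\<^bsub>Q\<^esub> D x (inv y) = \<one>\<^bsub>Q\<^esub>"
      using D_mult_right[OF assms(3) y(1) inv_closed[OF y(1)]] D_one(1)[OF assms(3)] y by simp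
    then have "D x (inv y) = inv\<^bsub>Q\<^esub> (D x y)"
      using Q.inv_equality[OF Q.inv_comm, of "D x y" "D x (inv y)"] y xG by simp
    then have "D x (inv y) = q (inv (commutator x y))"
      using y xG by simp
    then have "commutator x (inv y) \<in> B"
      using y xG by (intro mod[OF _ _ subgroup.m_inv_closed[OF assms(1) y(2)]]) simp_all
    then show "inv y \<in> {y \<in> carrier G. commutator x y \<in> B}" using y by simp
  next
    fix y y' assume "y \<in> {y \<in> carrier G. commutator x y \<in> B}" "y' \<in> {y \<in> carrier G. commutator x y \<in> B}"
    then have y: "y \<in> carrier G" "commutator x y \<in> B" "y' \<in> carrier G" "commutator x y' \<in> B" by auto
    have "D x (y \<otimes> y') = q (commutator x y \<otimes> commutator x y')"
      using D_mult_right[OF assms(3) y(1,3)] y xG by simp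
    then have "commutator x (y \<otimes> y') \<in> B"
      using y xG by (intro mod[OF _ _ subgroup.m_closed[OF assms(1) y(2,4)]]) simp_all
    then show "y \<otimes> y' \<in> {y \<in> carrier G. commutator x y \<in> B}" using y by simp
  qed
qed

text \<open>For fixed \<open>x\<close> the map \<open>D x\<close> is a homomorphism whose values
  commute, so it is trivial on commutators: gh and hg have the same image.\<close>

lemma derived_kernel:
  assumes "x \<in> X" "d \<in> lower_central G 1"
  shows "commutator x d \<in> N"
proof -
  have xG: "x \<in> carrier G" using assms(1) by (rule XG)
  have "subgroup {y \<in> carrier G. commutator x y \<in> N} G"
    using assms(1) by (intro subgroup_right) (auto intro: N.is_subgroup)
  moreover have "commutator x (commutator g h) \<in> N" if g: "g \<in> carrier G" and h: "h \<in> carrier G" for g h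
  proof -
    have c: "commutator g h \<in> carrier G" "h \<otimes> g \<in> carrier G" using g h by simp_all
    have "D x (commutator g h) \<otimes>\<^bsub>Q\<^esub> D x (h \<otimes> g) = D x (g \<otimes> h)"
      using D_mult_right[OF assms(1) c] mult_eq_commutator_mult[OF g h] by (simp only:)
    also have "\<dots> = D x h \<otimes>\<^bsub>Q\<^esub> D x g"
      unfolding D_mult_right[OF assms(1) g h] using g h xG by (intro D_central[OF assms(1) g]) simp
    also have "\<dots> = D x (h \<otimes> g)" by (simp only: D_mult_right[OF assms(1) h g])
    finally have "D x (commutator g h) = \<one>\<^bsub>Q\<^esub>"
      using c xG by (subst (asm) Q.r_cancel_one) simp_all
    then show ?thesis using c(1) xG q_eq_one_iff by simp
  qed
  ultimately have "lower_central G 1 \<subseteq> {y \<in> carrier G. commutator x y \<in> N}"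
    unfolding One_nat_def lower_central.simps by (intro generate_subgroup_incl) (auto simp flip: commutator_def)
  then show ?thesis using assms(2) by blast
qed

end

lemma (in group) bilinear_layer_lower_central:
  "bilinear_layer G (lower_central G (Suc (Suc n))) (lower_central G n)"
proof (intro bilinear_layer.intro bilinear_layer_axioms.intro)
  show "group G" by (rule is_group)
  show "lower_central G (Suc (Suc n)) \<lhd> G" by (rule lower_central_normal)
  show "subgroup (lower_central G n) G" by (rule lower_central_subgroup)
  show "commutator (commutator x y) z \<in> lower_central G (Suc (Suc n))"
    if "x \<in> lower_central G n" "y \<in> carrier G" "z \<in> carrier G" for x y z
    using that by (intro commutator_in_lower_central)
qed

declare lower_central.simps(2) [simp del]

section \<open>Left-normed commutators as generators of the layers\<close>

context group
begin

text \<open>The head of the list is the outermost, that is the last, entry of the commutator.\<close>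

primrec left_normed :: "'a list \<Rightarrow> 'a" where
  "left_normed [] = \<one>"
| "left_normed (s # J) = (if J = [] then s else commutator (left_normed J) s)"

lemma left_normed_closed: "subgroup B G \<Longrightarrow> set J \<subseteq> B \<Longrightarrow> left_normed J \<in> B"
  by (induction J)
    (auto simp: commutator_def subgroup.one_closed intro!: subgroup.m_closed subgroup.m_inv_closed)

lemma left_normed_in_lower_central:
  "set J \<subseteq> carrier G \<Longrightarrow> length J = Suc n \<Longrightarrow> left_normed J \<in> lower_central G n"
proof (induction n arbitrary: J)
  case 0
  then show ?case by (cases J) auto
next
  case (Suc n)
  then obtain s J' where J: "J = s # J'" "length J' = Suc n" by (cases J) auto
  then have "left_normed J' \<in> lower_central G n" using Suc by auto
  then have "commutator (left_normed J') s \<in> lower_central G (Suc n)"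
    using Suc.prems(1) J by (intro commutator_in_lower_central) auto
  then show ?case using J by auto
qed

text \<open>Multilinearity of a commutator of weight n + 1: each entry contributes one factor
  \<open>e\<close> to the exponent. Entries matter only modulo the derived subgroup, so
  \<open>h s\<close> may stand in for the power of \<open>s\<close>; later \<open>h s\<close> is
  taken from the stabilizer.\<close>

lemma left_normed_power:
  fixes e :: nat
  assumes "\<And>s. s \<in> set J \<Longrightarrow> s \<in> carrier G \<and> h s \<in> carrier G \<and>
             lower_central G 1 #> h s = lower_central G 1 #> (s [^] e)"
    and "length J = Suc n"
  shows "lower_central G (Suc n) #> left_normed (map h J) =
         lower_central G (Suc n) #> (left_normed J [^] (e ^ Suc n))"
  using assms
proof (induction n arbitrary: J)
  case 0
  then obtain s where "J = [s]" by (cases J) auto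
  then show ?case using 0(1)[of s] by simp
next
  case (Suc n)
  then obtain s J' where J: "J = s # J'" "length J' = Suc n" by (cases J) auto
  interpret L: bilinear_layer G "lower_central G (Suc (Suc n))" "lower_central G n"
    by (rule bilinear_layer_lower_central)
  define M where "M = e ^ Suc n"
  define u where "u = left_normed J'"
  define a where "a = left_normed (map h J')"
  have s: "s \<in> carrier G" "h s \<in> carrier G" "lower_central G 1 #> h s = lower_central G 1 #> (s [^] e)"
    using Suc.prems(1)[of s] J by auto
  have u: "u \<in> lower_central G n" and a: "a \<in> carrier G"
    using Suc.prems(1) J unfolding u_def a_def
    by (auto intro!: left_normed_in_lower_central left_normed_closed[OF subgroup_self])
  have uM: "u [^] M \<in> lower_central G n"
    using u by (rule subgroup_nat_pow_closed[OF lower_central_subgroup])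
  have "lower_central G (Suc n) #> a = lower_central G (Suc n) #> (u [^] M)"
    unfolding a_def u_def M_def using Suc.prems(1) J by (intro Suc.IH) auto
  then obtain \<nu> where \<nu>: "\<nu> \<in> lower_central G (Suc n)" "a = \<nu> \<otimes> u [^] M"
    using coset_eqD[OF lower_central_normal a] by blast
  have \<nu>n: "\<nu> \<in> lower_central G n" using \<nu>(1) lower_central_Suc_subset by blast
  obtain \<delta> where \<delta>: "\<delta> \<in> lower_central G 1" "h s = \<delta> \<otimes> s [^] e"
    using coset_eqD[OF lower_central_normal s(2,3)] by blast
  have \<delta>G: "\<delta> \<in> carrier G" using \<delta>(1) lower_central_in_carrier by blast
  \<comment> \<open>Both error terms disappear: \<nu> already lies one term deeper in the series, so
    its commutator lies two terms deeper, and \<delta> lies in the derived subgroup.\<close>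
  have "L.D \<nu> (h s) = \<one>\<^bsub>L.Q\<^esub>"
    using \<nu> \<nu>n s by (subst L.q_eq_one_iff) (auto simp: L.XG intro: commutator_in_lower_central)
  moreover have "L.D (u [^] M) \<delta> = \<one>\<^bsub>L.Q\<^esub>"
    using uM \<delta>G \<delta>(1) by (subst L.q_eq_one_iff) (auto simp: L.XG intro: L.derived_kernel)
  ultimately have "L.D a (h s) = L.D (u [^] M) (s [^] e)"
    using \<nu>(2) \<nu>n uM s(1,2) \<delta>G \<delta>(2) L.D_mult_left[OF \<nu>n uM s(2)]
      L.D_mult_right[OF uM \<delta>G, of "s [^] e"] L.XG[OF uM] by simp
  also have "\<dots> = (L.D u s [^]\<^bsub>L.Q\<^esub> e) [^]\<^bsub>L.Q\<^esub> M"
    using u s(1) by (simp add: L.D_pow_left L.D_pow_right)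
  also have "\<dots> = L.D u s [^]\<^bsub>L.Q\<^esub> (e ^ Suc (Suc n))"
    using u s(1) by (simp add: L.Q.nat_pow_pow L.XG M_def mult_ac)
  also have "\<dots> = L.q (commutator u s [^] (e ^ Suc (Suc n)))"
    using u s(1) by (simp add: L.q.hom_nat_pow L.XG)
  finally show ?case
    using J by (auto simp: L.q_def a_def u_def)
qed

text \<open>Multilinearity again: the square can be shifted to the entry \<open>s\<close>, directly
  if \<open>s\<close> is the outermost entry and by induction on the inner commutator
  otherwise.\<close>

lemma left_normed_square:
  assumes "set J \<subseteq> carrier G" "length J = Suc n" "s \<in> set J" "s \<otimes> s = \<one>"
  shows "left_normed J [^] (2::nat) \<in> lower_central G (Suc n)"
  using assms(1-3)
proof (induction n arbitrary: J)
  case 0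
  then have "J = [s]" by (cases J) auto
  then have "left_normed J [^] (2::nat) = \<one>" using 0 assms(4) by (simp add: numeral_2_eq_2)
  then show ?case by (simp add: subgroup.one_closed[OF lower_central_subgroup])
next
  case (Suc n)
  then obtain t J' where J: "J = t # J'" "length J' = Suc n" by (cases J) auto
  interpret L: bilinear_layer G "lower_central G (Suc (Suc n))" "lower_central G n"
    by (rule bilinear_layer_lower_central)
  define u where "u = left_normed J'"
  have t: "t \<in> carrier G" using Suc.prems(1) J by auto
  have u: "u \<in> lower_central G n"
    using Suc.prems(1) J unfolding u_def by (auto intro!: left_normed_in_lower_central)
  have "L.D u t [^]\<^bsub>L.Q\<^esub> (2::nat) = \<one>\<^bsub>L.Q\<^esub>"
  proof (cases "s = t")
    case True
    then have "t [^] (2::nat) = \<one>" using t assms(4) by (simp add: numeral_2_eq_2)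
    then show ?thesis using L.D_pow_right[OF u t, of 2] L.D_one(1)[OF u] by simp
  next
    case False
    then have "u [^] (2::nat) \<in> lower_central G (Suc n)"
      unfolding u_def using Suc.prems J by (intro Suc.IH) auto
    then have "commutator (u [^] (2::nat)) t \<in> lower_central G (Suc (Suc n))"
      using t by (rule commutator_in_lower_central)
    then have "L.D (u [^] (2::nat)) t = \<one>\<^bsub>L.Q\<^esub>"
      using u t by (subst L.q_eq_one_iff) (auto simp: L.XG)
    then show ?thesis using L.D_pow_left[OF u t, of 2] by simp
  qed
  then have "L.q (commutator u t [^] (2::nat)) = \<one>\<^bsub>L.Q\<^esub>"
    using u t by (simp add: L.q.hom_nat_pow L.XG)
  then have "commutator u t [^] (2::nat) \<in> lower_central G (Suc (Suc n))"
    using u t by (subst (asm) L.q_eq_one_iff) (auto simp: L.XG)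
  then show ?case using J by (auto simp: u_def)
qed

text \<open>By bilinearity modulo the term after next it is enough to take commutators of
  generators: \<open>gens\<close> extends the second entry from \<open>A\<close> to the whole group,
  and \<open>subgroup_left\<close> then extends the first. Inverses are absorbed by bilinearity, so
  one element of each pair of mutually inverse generators suffices in \<open>A\<close>.\<close>

lemma lower_central_generated:
  assumes A: "A \<subseteq> carrier G" "generate G A = carrier G"
  shows "lower_central G n \<subseteq>
    generate G (lower_central G (Suc n) \<union> left_normed ` {J. set J \<subseteq> A \<and> length J = Suc n})"
proof (induction n)
  case 0
  have "A \<subseteq> left_normed ` {J. set J \<subseteq> A \<and> length J = Suc 0}"
  proof
    fix a assume "a \<in> A"
    then show "a \<in> left_normed ` {J. set J \<subseteq> A \<and> length J = Suc 0}"
      by (intro image_eqI[of _ _ "[a]"]) auto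
  qed
  then have "generate G A \<subseteq>
    generate G (lower_central G (Suc 0) \<union> left_normed ` {J. set J \<subseteq> A \<and> length J = Suc 0})"
    by (intro mono_generate) auto
  then show ?case using A(2) by simp
next
  case (Suc n)
  interpret L: bilinear_layer G "lower_central G (Suc (Suc n))" "lower_central G n"
    by (rule bilinear_layer_lower_central)
  define W where "W k = left_normed ` {J. set J \<subseteq> A \<and> length J = Suc k}" for k
  define B where "B = generate G (lower_central G (Suc (Suc n)) \<union> W (Suc n))"
  have W: "W k \<subseteq> carrier G" for k
    using A(1) left_normed_closed[OF subgroup_self] by (fastforce simp: W_def)
  have B: "subgroup B G"
    unfolding B_def using W lower_central_in_carrier by (intro generate_is_subgroup) auto
  have NB: "lower_central G (Suc (Suc n)) \<subseteq> B" by (auto simp: B_def intro: generate.incl)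
  have gens: "commutator (left_normed J) y \<in> B"
    if J: "set J \<subseteq> A" "length J = Suc n" and y: "y \<in> carrier G" for J y
  proof -
    have x: "left_normed J \<in> lower_central G n"
      using J A(1) by (intro left_normed_in_lower_central) auto
    have "commutator (left_normed J) a \<in> B" if "a \<in> A" for a
    proof -
      have "commutator (left_normed J) a = left_normed (a # J)" using J(2) by auto
      moreover have "left_normed (a # J) \<in> W (Suc n)"
        unfolding W_def using J that by (intro imageI) simp
      ultimately show ?thesis by (auto simp: B_def intro: generate.incl)
    qed
    then have "generate G A \<subseteq> {y \<in> carrier G. commutator (left_normed J) y \<in> B}"
      using A(1) by (intro generate_subgroup_incl L.subgroup_right[OF B NB x]) auto
    then show ?thesis using y A(2) by auto
  qed
  have "commutator x y \<in> B" if "x \<in> lower_central G n" "y \<in> carrier G" for x y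
  proof -
    have "lower_central G (Suc n) \<union> W n \<subseteq> {x \<in> lower_central G n. commutator x y \<in> B}"
    proof (intro Un_least subsetI)
      fix x assume x: "x \<in> lower_central G (Suc n)"
      then have "commutator x y \<in> B" using commutator_in_lower_central[OF x that(2)] NB by blast
      then show "x \<in> {x \<in> lower_central G n. commutator x y \<in> B}"
        using x lower_central_Suc_subset by blast
    next
      fix x assume "x \<in> W n"
      then obtain J where J: "x = left_normed J" "set J \<subseteq> A" "length J = Suc n"
        by (auto simp: W_def)
      then show "x \<in> {x \<in> lower_central G n. commutator x y \<in> B}"
        using gens[OF J(2,3) that(2)] A(1) left_normed_in_lower_central[of J n] by auto
    qed
    then have "generate G (lower_central G (Suc n) \<union> W n) \<subseteq> {x \<in> lower_central G n. commutator x y \<in> B}"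
      using that(2) by (intro generate_subgroup_incl L.subgroup_left[OF B NB])
    then show ?thesis using Suc.IH that(1) unfolding W_def[symmetric] by blast
  qed
  then have "lower_central G (Suc n) \<subseteq> B"
    unfolding lower_central.simps(2)[of G n]
    by (intro generate_subgroup_incl[OF _ B]) (auto simp flip: commutator_def)
  then show ?case by (simp only: B_def W_def)
qed

end

section \<open>Orbits of the lower central series\<close>

locale pointed_action = transitive_action G E \<phi> for G (structure) and E \<phi> +
  fixes \<omega>
  assumes base: "\<omega> \<in> E" and fin_E: "finite E"
begin

sublocale group G
  using group_hom by (rule group_hom.axioms(1))

definition orb where
  "orb N = (\<lambda>g. \<phi> g \<omega>) ` N"

text \<open>For a normal subgroup \<open>N\<close> this is the product of \<open>N\<close> and the stabilizer of \<open>\<omega>\<close>.\<close>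

definition reach where
  "reach N = {g \<in> carrier G. \<phi> g \<omega> \<in> orb N}"

lemma act_mult: "g \<in> carrier G \<Longrightarrow> h \<in> carrier G \<Longrightarrow> \<phi> (g \<otimes> h) \<omega> = \<phi> g (\<phi> h \<omega>)"
  using base by (rule composition_rule)

lemma act_one: "\<phi> \<one> \<omega> = \<omega>"
  using id_eq_one base by (metis restrict_apply')

lemma orb_finite: "N \<subseteq> carrier G \<Longrightarrow> finite (orb N)"
  using element_image[OF _ base] by (intro finite_subset[OF _ fin_E]) (auto simp: orb_def)

lemma subset_reach: "N \<subseteq> carrier G \<Longrightarrow> N \<subseteq> reach N"
  by (auto simp: reach_def orb_def)

lemma act_normal:
  assumes "N \<lhd> G" "g \<in> carrier G" "r \<in> N" "h \<in> carrier G"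
  shows "\<exists>r'\<in>N. \<phi> g (\<phi> r (\<phi> h \<omega>)) = \<phi> r' (\<phi> (g \<otimes> h) \<omega>)"
proof
  interpret N: normal N G by fact
  have r: "r \<in> carrier G" using assms(3) by (rule N.mem_carrier)
  show "g \<otimes> r \<otimes> inv g \<in> N" by (rule N.inv_op_closed2[OF assms(2,3)])
  have "\<phi> g (\<phi> r (\<phi> h \<omega>)) = \<phi> (g \<otimes> (r \<otimes> h)) \<omega>"
    using assms r by (simp add: act_mult)
  also have "g \<otimes> (r \<otimes> h) = (g \<otimes> r \<otimes> inv g) \<otimes> (g \<otimes> h)"
  proof -
    have "inv g \<otimes> (g \<otimes> h) = h" using assms by (simp add: m_assoc[symmetric])
    then show ?thesis using assms r by (simp add: m_assoc)
  qed
  also have "\<phi> ((g \<otimes> r \<otimes> inv g) \<otimes> (g \<otimes> h)) \<omega> = \<phi> (g \<otimes> r \<otimes> inv g) (\<phi> (g \<otimes> h) \<omega>)"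
    using assms r by (intro act_mult) auto
  finally show "\<phi> g (\<phi> r (\<phi> h \<omega>)) = \<phi> (g \<otimes> r \<otimes> inv g) (\<phi> (g \<otimes> h) \<omega>)" .
qed

lemma reach_subgroup:
  assumes "N \<lhd> G"
  shows "subgroup (reach N) G"
proof (rule subgroupI)
  interpret N: normal N G by fact
  show "reach N \<subseteq> carrier G" by (auto simp: reach_def)
  show "reach N \<noteq> {}" using subset_reach[OF N.subset] N.one_closed by blast
next
  interpret N: normal N G by fact
  fix g assume "g \<in> reach N"
  then obtain r where g: "g \<in> carrier G" "r \<in> N" "\<phi> g \<omega> = \<phi> r \<omega>" by (auto simp: reach_def orb_def)
  have ir: "inv r \<in> N" "r \<in> carrier G" using g(2) by auto
  obtain r' where r': "r' \<in> N" "\<phi> (inv g) (\<phi> (inv r) (\<phi> g \<omega>)) = \<phi> r' (\<phi> (inv g \<otimes> g) \<omega>)"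
    using act_normal[OF assms inv_closed[OF g(1)] ir(1) g(1)] by blast
  have "\<phi> (inv r) (\<phi> g \<omega>) = \<omega>"
    unfolding g(3) using ir(2) by (simp add: act_mult[symmetric] act_one)
  then have "\<phi> (inv g) \<omega> = \<phi> r' \<omega>" using r'(2) g(1) by (simp add: act_one)
  then show "inv g \<in> reach N" using g(1) r'(1) by (auto simp: reach_def orb_def)
next
  interpret N: normal N G by fact
  fix g h assume "g \<in> reach N" "h \<in> reach N"
  then obtain r s where g: "g \<in> carrier G" "r \<in> N" "\<phi> g \<omega> = \<phi> r \<omega>"
    and h: "h \<in> carrier G" "s \<in> N" "\<phi> h \<omega> = \<phi> s \<omega>"
    by (auto simp: reach_def orb_def)
  have rs: "r \<in> carrier G" "s \<in> carrier G" using g(2) h(2) by auto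
  obtain r' where r': "r' \<in> N" "\<phi> g (\<phi> s (\<phi> \<one> \<omega>)) = \<phi> r' (\<phi> (g \<otimes> \<one>) \<omega>)"
    using act_normal[OF assms g(1) h(2) one_closed] by blast
  have "\<phi> (g \<otimes> h) \<omega> = \<phi> g (\<phi> s \<omega>)" using g(1) h(1,3) by (simp add: act_mult)
  also have "\<dots> = \<phi> r' (\<phi> r \<omega>)" using r'(2) g by (simp add: act_one)
  also have "\<dots> = \<phi> (r' \<otimes> r) \<omega>" using r'(1) rs by (simp add: act_mult)
  finally show "g \<otimes> h \<in> reach N"
    using g(1,2) h(1) r'(1) by (auto simp: reach_def orb_def intro!: imageI)
qed

text \<open>Elements of \<open>reach N\<close> send \<open>\<omega>\<close> into
  \<open>orb N\<close>, so the translates of \<open>orb N\<close> by elements of \<open>F\<close>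
  cover \<open>orb M\<close>.\<close>

lemma card_orb_le:
  assumes cover: "M \<subseteq> F <#> reach N" and F: "finite F" "F \<subseteq> carrier G" and N: "N \<subseteq> carrier G"
  shows "card (orb M) \<le> card F * card (orb N)"
proof -
  have "orb M \<subseteq> (\<lambda>(f, x). \<phi> f x) ` (F \<times> orb N)"
  proof
    fix y assume "y \<in> orb M"
    then obtain g where g: "g \<in> M" "y = \<phi> g \<omega>" by (auto simp: orb_def)
    then obtain f k where fk: "f \<in> F" "k \<in> reach N" "g = f \<otimes> k"
      using cover by (auto simp: set_mult_def)
    then have "y = \<phi> f (\<phi> k \<omega>)" using g F(2) by (auto simp: reach_def act_mult)
    then show "y \<in> (\<lambda>(f, x). \<phi> f x) ` (F \<times> orb N)"
      using fk(1,2) by (intro image_eqI[of _ _ "(f, \<phi> k \<omega>)"]) (auto simp: reach_def)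
  qed
  then have "card (orb M) \<le> card ((\<lambda>(f, x). \<phi> f x) ` (F \<times> orb N))"
    using F orb_finite[OF N] by (intro card_mono) auto
  also have "\<dots> \<le> card (F \<times> orb N)" using F orb_finite[OF N] by (intro card_image_le) auto
  finally show ?thesis by (simp add: card_cartesian_product)
qed

text \<open>The covering lemma is applied inside the group \<open>lower_central G n\<close>. Its
  commutators lie in the next term, so they lie in the intersection \<open>K\<close> of that group
  with \<open>reach\<close>, and at most the product of the \<open>e i\<close> many cosets are
  needed.\<close>

lemma card_orb_layer:
  assumes I: "finite I" and t: "\<And>i. i \<in> I \<Longrightarrow> t i \<in> lower_central G n"
    and e: "\<And>i. i \<in> I \<Longrightarrow> 0 < e i"
    and te: "\<And>i. i \<in> I \<Longrightarrow> t i [^] (e i :: nat) \<in> reach (lower_central G (Suc n))"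
    and gen: "lower_central G n \<subseteq> generate G (lower_central G (Suc n) \<union> t ` I)"
  shows "card (orb (lower_central G n)) \<le> (\<Prod>i\<in>I. e i) * card (orb (lower_central G (Suc n)))"
proof -
  let ?C = "lower_central G n" and ?N = "lower_central G (Suc n)"
  define M where "M = G\<lparr>carrier := ?C\<rparr>"
  define K where "K = reach ?N \<inter> ?C"
  have C: "subgroup ?C G" by (rule lower_central_subgroup)
  have NC: "?N \<subseteq> K"
    using lower_central_Suc_subset subset_reach[OF lower_central_in_carrier] by (auto simp: K_def)
  have K: "subgroup K G" unfolding K_def
    using reach_subgroup[OF lower_central_normal] C by (rule subgroups_Inter_pair)
  interpret M: group M unfolding M_def using C by (rule subgroup_imp_group)
  have pow: "x [^]\<^bsub>M\<^esub> (k::nat) = x [^] k" for x k unfolding M_def by (simp add: nat_pow_def)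
  have "\<exists>F. finite F \<and> F \<subseteq> carrier M \<and> card F \<le> (\<Prod>i\<in>I. e i) \<and> generate M (K \<union> t ` I) \<subseteq> F <#>\<^bsub>M\<^esub> K"
  proof (rule M.generate_cover)
    show "subgroup K M" unfolding M_def using K by (rule subgroup_incl[OF _ C]) (simp add: K_def)
    fix x y assume xy: "x \<in> carrier M" "y \<in> carrier M"
    have "x \<otimes>\<^bsub>M\<^esub> y \<otimes>\<^bsub>M\<^esub> inv\<^bsub>M\<^esub> x \<otimes>\<^bsub>M\<^esub> inv\<^bsub>M\<^esub> y = commutator x y"
      using xy m_inv_consistent[OF C] by (simp add: M_def commutator_def)
    also have "\<dots> \<in> ?N"
      using xy lower_central_in_carrier by (intro commutator_in_lower_central) (auto simp: M_def)
    finally show "x \<otimes>\<^bsub>M\<^esub> y \<otimes>\<^bsub>M\<^esub> inv\<^bsub>M\<^esub> x \<otimes>\<^bsub>M\<^esub> inv\<^bsub>M\<^esub> y \<in> K" using NC by blast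
  next
    fix i assume i: "i \<in> I"
    show "t i [^]\<^bsub>M\<^esub> e i \<in> K"
      unfolding pow K_def using te[OF i] subgroup_nat_pow_closed[OF C t[OF i]] by simp
  qed (use I t e in \<open>auto simp: M_def\<close>)
  then obtain F where F: "finite F" "F \<subseteq> ?C" "card F \<le> (\<Prod>i\<in>I. e i)"
      "generate M (K \<union> t ` I) \<subseteq> F <#> K"
    by (auto simp: M_def set_mult_def)
  have "generate M (K \<union> t ` I) = generate G (K \<union> t ` I)"
    unfolding M_def using t by (intro generate_consistent C) (auto simp: K_def)
  moreover have "generate G (?N \<union> t ` I) \<subseteq> generate G (K \<union> t ` I)"
    using NC by (intro mono_generate) auto
  moreover have "F <#> K \<subseteq> F <#> reach ?N" by (auto simp: set_mult_def K_def)
  ultimately have "?C \<subseteq> F <#> reach ?N" using gen F(4) by blast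
  then have "card (orb ?C) \<le> card F * card (orb ?N)"
    using F(1,2) lower_central_in_carrier by (intro card_orb_le) auto
  also have "\<dots> \<le> (\<Prod>i\<in>I. e i) * card (orb ?N)" using F(3) by (rule mult_right_mono) simp
  finally show ?thesis .
qed

text \<open>As the series is indexed from 0, this is the product of the derived subgroup and the
  stabilizer of \<open>\<omega>\<close>.\<close>

abbreviation K where "K \<equiv> reach (lower_central G 1)"

lemma K_subgroup: "subgroup K G"
  by (rule reach_subgroup[OF lower_central_normal])

lemma K_commutators:
  assumes "x \<in> carrier G" "y \<in> carrier G"
  shows "x \<otimes> y \<otimes> inv x \<otimes> inv y \<in> K"
proof -
  have "commutator x y \<in> lower_central G (Suc 0)"
    using assms by (intro commutator_in_lower_central) simp_all
  then show ?thesis using subset_reach[OF lower_central_in_carrier] by (auto simp: commutator_def)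
qed

lemma K_normal: "K \<lhd> G"
  using K_subgroup K_commutators by (rule normal_if_commutators)

lemma stabilizer_K: "stabilizer G \<phi> \<omega> \<subseteq> K"
  using subgroup.one_closed[OF lower_central_subgroup] act_one
  by (auto simp: stabilizer_def reach_def orb_def intro!: image_eqI[of _ _ \<one>])

definition index :: nat where "index = card ((\<lambda>g. g <# K) ` carrier G)"

text \<open>\<open>K\<close> contains the stabilizer, so the coset of \<open>g\<close> depends only
  on the point \<open>\<phi> g \<omega>\<close> of the finite set \<open>E\<close>.\<close>

lemma finite_cosets: "finite ((\<lambda>g. g <# K) ` carrier G)"
proof -
  have "g <# K = h <# K" if "g \<in> carrier G" "h \<in> carrier G" "\<phi> g \<omega> = \<phi> h \<omega>" for g h
  proof -
    have "\<phi> (inv h \<otimes> g) \<omega> = \<phi> (inv h) (\<phi> h \<omega>)" using that by (simp add: act_mult)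
    also have "\<dots> = \<omega>" using that(2) by (simp add: act_mult[symmetric] act_one)
    finally have "inv h \<otimes> g \<in> K" using that stabilizer_K by (auto simp: stabilizer_def)
    then have "h <# K = (h \<otimes> (inv h \<otimes> g)) <# K"
      using that K_subgroup by (simp add: lcos_m_assoc[symmetric] coset_join3 subgroup.subset)
    then show ?thesis using that by (simp add: m_assoc[symmetric])
  qed
  then have "g <# K = (SOME g. g \<in> carrier G \<and> \<phi> g \<omega> = x) <# K" if "g \<in> carrier G" "x = \<phi> g \<omega>" for g x
    using that someI_ex[of "\<lambda>g. g \<in> carrier G \<and> \<phi> g \<omega> = x"] by blast
  then have "(\<lambda>g. g <# K) ` carrier G \<subseteq> (\<lambda>x. (SOME g. g \<in> carrier G \<and> \<phi> g \<omega> = x) <# K) ` E"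
    using element_image[OF _ base] by blast
  then show ?thesis using fin_E by (rule finite_subset[OF _ finite_imageI])
qed

lemma index_pos: "0 < index"
  unfolding index_def using finite_cosets one_closed by (auto simp: card_gt_0_iff)

lemma pow_index_in_K:
  assumes "g \<in> carrier G"
  shows "g [^] index \<in> K"
proof -
  interpret K: normal K G by (rule K_normal)
  interpret Q: group "G Mod K" by (rule K.factorgroup_is_group)
  have "(\<lambda>g. g <# K) ` carrier G = rcosets K"
    using K.coset_eq by (auto simp: RCOSETS_def)
  then have ord: "Coset.order (G Mod K) = index" by (simp add: Coset.order_def FactGroup_def index_def)
  interpret h: group_hom G "G Mod K" "\<lambda>g. K #> g"
    using K.r_coset_hom_Mod by unfold_locales
  have "K #> (g [^] index) = (K #> g) [^]\<^bsub>G Mod K\<^esub> Coset.order (G Mod K)"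
    unfolding ord using assms by (rule h.hom_nat_pow)
  also have "\<dots> = \<one>\<^bsub>G Mod K\<^esub>" using h.hom_closed[OF assms] by (rule Q.pow_order_eq_1)
  finally have "K #> (g [^] index) = K" by (simp add: FactGroup_def)
  then show ?thesis using assms by (intro coset_join1[OF _ _ K_subgroup]) auto
qed

lemma card_E_le_index: "card E \<le> index * card (orb (lower_central G 1))"
proof -
  define c where "c C = (SOME g. g \<in> carrier G \<and> C = g <# K)" for C
  let ?F = "c ` (\<lambda>g. g <# K) ` carrier G"
  have c: "c (g <# K) \<in> carrier G \<and> g <# K = c (g <# K) <# K" if "g \<in> carrier G" for g
  proof -
    have "\<exists>h. h \<in> carrier G \<and> g <# K = h <# K" using that by blast
    then show ?thesis unfolding c_def by (rule someI_ex)
  qed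
  have cover: "carrier G \<subseteq> ?F <#> K"
  proof
    fix g assume g: "g \<in> carrier G"
    have "g \<in> g <# K"
      using g subgroup.one_closed[OF K_subgroup] unfolding l_coset_def by (auto intro!: bexI[of _ \<one>])
    then have "g \<in> c (g <# K) <# K" using c[OF g] by blast
    then show "g \<in> ?F <#> K" using g by (auto simp: l_coset_def set_mult_def)
  qed
  have "E \<subseteq> orb (carrier G)" using unique_orbit[OF base] by (fastforce simp: orb_def)
  then have "card E \<le> card (orb (carrier G))" by (intro card_mono orb_finite) auto
  also have "\<dots> \<le> card ?F * card (orb (lower_central G 1))"
    using finite_cosets c by (intro card_orb_le[OF cover] lower_central_in_carrier) auto
  also have "\<dots> \<le> index * card (orb (lower_central G 1))"
    unfolding index_def using finite_cosets by (intro mult_right_mono card_image_le) auto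
  finally show ?thesis .
qed

end

text \<open>The first two binomial terms are x^i and i x^(i - 1) b, and the second is at least i b^i
  because b \<le> x. In \<open>card_layer_le\<close> it is used with
  \<open>x = card I + card T\<close> and \<open>b = card T\<close>.\<close>

lemma power_add_ge:
  fixes x b :: nat
  assumes "b \<le> x"
  shows "x ^ i + i * b ^ i \<le> (x + b) ^ i"
proof (induction i)
  case (Suc i)
  have "b ^ i \<le> x ^ i" using assms by (rule power_mono) simp
  then have "b * b ^ i \<le> b * x ^ i" by simp
  then have "x ^ Suc i + Suc i * b ^ Suc i \<le> x * x ^ i + b * x ^ i + i * (b * b ^ i)"
    by simp
  also have "\<dots> \<le> x * x ^ i + b * x ^ i + (x * (i * b ^ i) + b * (i * b ^ i))"
    by (simp add: algebra_simps)
  also have "\<dots> = (x + b) * (x ^ i + i * b ^ i)" by (simp add: algebra_simps)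
  also have "\<dots> \<le> (x + b) * (x + b) ^ i" using Suc.IH by (rule mult_left_mono) simp
  finally show ?case by simp
qed simp

section \<open>The contribution of each layer to the number of points\<close>

context pointed_action
begin

text \<open>Raising any \<open>s\<close> to the power \<open>index\<close> gives, modulo the derived
  subgroup, an element of the stabilizer. The commutator of these elements stays in the stabilizer,
  and by \<open>left_normed_power\<close> it agrees with the required power of
  \<open>left_normed J\<close> modulo the next term.\<close>

lemma left_normed_power_in_reach:
  assumes J: "set J \<subseteq> carrier G" "length J = Suc n"
  shows "left_normed J [^] (index ^ Suc n) \<in> reach (lower_central G (Suc n))"
proof -
  let ?N = "lower_central G (Suc n)"
  have "\<exists>h. h \<in> stabilizer G \<phi> \<omega> \<and> lower_central G 1 #> h = lower_central G 1 #> (s [^] index)"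
    if s: "s \<in> carrier G" for s
  proof -
    obtain r where r: "r \<in> lower_central G 1" "\<phi> (s [^] index) \<omega> = \<phi> r \<omega>"
      using pow_index_in_K[OF s] by (auto simp: reach_def orb_def)
    have rG: "r \<in> carrier G" using r(1) lower_central_in_carrier by blast
    have ir: "inv r \<in> lower_central G 1"
      using subgroup.m_inv_closed[OF lower_central_subgroup r(1)] .
    have "\<phi> (inv r \<otimes> s [^] index) \<omega> = \<phi> (inv r \<otimes> r) \<omega>"
      using s rG r(2) by (simp only: act_mult inv_closed nat_pow_closed)
    then have "inv r \<otimes> s [^] index \<in> stabilizer G \<phi> \<omega>"
      using s rG by (simp add: stabilizer_def act_one)
    moreover have "lower_central G 1 #> (inv r \<otimes> s [^] index) = lower_central G 1 #> (s [^] index)"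
      using s rG ir by (intro coset_eqI[OF lower_central_normal _ _ ir refl]) auto
    ultimately show ?thesis by blast
  qed
  then obtain h where h: "\<And>s. s \<in> carrier G \<Longrightarrow> h s \<in> stabilizer G \<phi> \<omega> \<and>
      lower_central G 1 #> h s = lower_central G 1 #> (s [^] index)"
    by metis
  have stab: "subgroup (stabilizer G \<phi> \<omega>) G" by (rule stabilizer_subgroup[OF base])
  have hG: "h s \<in> carrier G" if "s \<in> carrier G" for s
    using h[OF that] subgroup.mem_carrier[OF stab] by blast
  define w where "w = left_normed (map h J)"
  have w: "w \<in> stabilizer G \<phi> \<omega>"
    unfolding w_def using J(1) h by (intro left_normed_closed[OF stab]) auto
  have jG: "left_normed J [^] (index ^ Suc n) \<in> carrier G"
    using left_normed_closed[OF subgroup_self J(1)] by simp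
  have "?N #> (left_normed J [^] (index ^ Suc n)) = ?N #> w"
    unfolding w_def using J h hG by (intro left_normed_power[symmetric]) auto
  then obtain \<nu> where \<nu>: "\<nu> \<in> ?N" "left_normed J [^] (index ^ Suc n) = \<nu> \<otimes> w"
    using coset_eqD[OF lower_central_normal jG] by blast
  have "\<nu> \<in> reach ?N" using \<nu>(1) subset_reach[OF lower_central_in_carrier] by blast
  moreover have "w \<in> reach ?N"
    using w subgroup.one_closed[OF lower_central_subgroup] act_one
    by (auto simp: stabilizer_def reach_def orb_def intro!: image_eqI[of _ _ \<one>])
  ultimately show ?thesis
    unfolding \<nu>(2) by (rule subgroup.m_closed[OF reach_subgroup[OF lower_central_normal]])
qed

text \<open>Let i = n + 1. A list with all entries in \<open>T\<close> contributes at most i factors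
  \<open>index\<close>, and every other list contributes at most one, as it contains an involution.
  With a = |A| and t = |T| the total exponent is at most a^i - t^i + i t^i, and
  \<open>power_add_ge\<close> bounds this by (|I| + 2|T|)^i, hence by \<open>size S\<close> to the
  power i.\<close>

lemma card_layer_le:
  assumes S: "symmetric_mset G S" and gen: "generate G (set_mset S) = carrier G"
  shows "card (orb (lower_central G n)) \<le> index ^ (size S ^ Suc n) * card (orb (lower_central G (Suc n)))"
proof -
  define I where "I = {s \<in> set_mset S. s \<otimes> s = \<one>}"
  obtain T where T: "T \<subseteq> set_mset S" "set_mset S = I \<union> T \<union> m_inv G ` T" "card I + 2 * card T \<le> size S"
    using symmetric_mset_transversal[OF S] unfolding I_def by blast
  define A where "A = I \<union> T"
  have SG: "set_mset S \<subseteq> carrier G" using S by (simp add: symmetric_mset_def)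
  have A: "A \<subseteq> carrier G" "finite A"
    using SG T(1) by (auto simp: A_def I_def intro: finite_subset)
  have finT: "finite T" using A by (simp add: A_def)
  have genA: "generate G A = carrier G"
  proof -
    have gA: "subgroup (generate G A) G" by (rule generate_is_subgroup[OF A(1)])
    have "A \<subseteq> generate G A" by (auto intro: generate.incl)
    then have "set_mset S \<subseteq> generate G A"
      unfolding T(2) using subgroup.m_inv_closed[OF gA] by (auto simp: A_def)
    then have "generate G (set_mset S) \<subseteq> generate G A" by (rule generate_subgroup_incl[OF _ gA])
    then show ?thesis using gen subgroup.subset[OF gA] by auto
  qed
  define JJ where "JJ = {J. set J \<subseteq> A \<and> length J = Suc n}"
  define TT where "TT = {J. set J \<subseteq> T \<and> length J = Suc n}"
  \<comment> \<open>The exponent 2 is at most \<open>index\<close> only if \<open>index\<close> is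
    at least 2; for \<open>index = 1\<close> the power of \<open>index\<close>, which is 1, is used
    for all lists.\<close>
  define e where "e J = (if set J \<subseteq> T \<or> index = 1 then index ^ Suc n else 2)" for J
  have fin: "finite JJ" "finite TT" "TT \<subseteq> JJ"
    using A(2) finT by (auto simp: JJ_def TT_def A_def intro!: finite_lists_length_eq)
  have cards: "card JJ = card A ^ Suc n" "card TT = card T ^ Suc n"
    using card_lists_length_eq[OF A(2)] card_lists_length_eq[OF finT] by (simp_all add: JJ_def TT_def)
  have "card (orb (lower_central G n)) \<le> (\<Prod>J\<in>JJ. e J) * card (orb (lower_central G (Suc n)))"
  proof (rule card_orb_layer[where t = left_normed])
    fix J assume J: "J \<in> JJ"
    then have J': "set J \<subseteq> carrier G" "length J = Suc n" using A(1) by (auto simp: JJ_def)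
    show "left_normed J \<in> lower_central G n" by (rule left_normed_in_lower_central[OF J'])
    show "0 < e J" using index_pos by (simp add: e_def)
    show "left_normed J [^] e J \<in> reach (lower_central G (Suc n))"
    proof (cases "set J \<subseteq> T \<or> index = 1")
      case True
      then show ?thesis using left_normed_power_in_reach[OF J'] by (simp add: e_def)
    next
      case False
      then obtain s where "s \<in> set J" "s \<in> I" using J by (auto simp: JJ_def A_def)
      then have "left_normed J [^] (2::nat) \<in> lower_central G (Suc n)"
        using left_normed_square[OF J'] by (auto simp: I_def)
      then show ?thesis
        using False subset_reach[OF lower_central_in_carrier] by (auto simp: e_def)
    qed
  next
    show "lower_central G n \<subseteq> generate G (lower_central G (Suc n) \<union> left_normed ` JJ)"
      unfolding JJ_def by (rule lower_central_generated[OF A(1) genA])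
  qed (rule fin(1))
  also have "(\<Prod>J\<in>JJ. e J) \<le> index ^ (size S ^ Suc n)"
  proof -
    have "(\<Prod>J\<in>JJ. e J) = (\<Prod>J\<in>JJ - TT. e J) * (\<Prod>J\<in>TT. e J)"
      using fin by (intro prod.subset_diff) auto
    also have "\<dots> \<le> (\<Prod>J\<in>JJ - TT. index) * (\<Prod>J\<in>TT. index ^ Suc n)"
      using index_pos by (intro mult_mono prod_mono) (auto simp: e_def TT_def JJ_def)
    also have "\<dots> = index ^ (card JJ - card TT + Suc n * card TT)"
      using fin by (simp add: card_Diff_subset power_add power_mult[symmetric] del: power_Suc)
    also have "\<dots> \<le> index ^ (size S ^ Suc n)"
    proof (rule power_increasing)
      have le: "card A \<le> card I + card T" unfolding A_def by (rule card_Un_le)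
      have "card T ^ Suc n \<le> card A ^ Suc n"
        using A(2) by (intro power_mono card_mono) (auto simp: A_def)
      then have "card JJ - card TT + Suc n * card TT \<le> card A ^ Suc n + Suc n * card T ^ Suc n"
        unfolding cards by linarith
      also have "\<dots> \<le> (card I + card T) ^ Suc n + Suc n * card T ^ Suc n"
        using le by (intro add_right_mono power_mono) auto
      also have "\<dots> \<le> (card I + card T + card T) ^ Suc n" by (rule power_add_ge) simp
      also have "\<dots> \<le> size S ^ Suc n" using T(3) by (intro power_mono) auto
      finally show "card JJ - card TT + Suc n * card TT \<le> size S ^ Suc n" .
    qed (use index_pos in simp)
    finally show ?thesis .
  qed
  finally show ?thesis by simp
qed

text \<open>The layer bounds telescope down to the trivial subgroup, whose orbit is a single point.
  The top layer is counted by \<open>index\<close> itself, which gives the summand 1 in place of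
  \<open>size S\<close>.\<close>

lemma card_E_le_index_power:
  assumes S: "symmetric_mset G S" "generate G (set_mset S) = carrier G"
    and nil: "lower_central G (Suc j) = {\<one>}"
  shows "card E \<le> index ^ (1 + (\<Sum>i = 2..Suc j. size S ^ i))"
proof -
  have "card (orb (lower_central G 1)) \<le>
      index ^ (\<Sum>i = 2..Suc n. size S ^ i) * card (orb (lower_central G (Suc n)))" for n
  proof (induction n)
    case (Suc n)
    note Suc.IH
    also have "index ^ (\<Sum>i = 2..Suc n. size S ^ i) * card (orb (lower_central G (Suc n))) \<le>
        index ^ (\<Sum>i = 2..Suc n. size S ^ i) *
          (index ^ (size S ^ Suc (Suc n)) * card (orb (lower_central G (Suc (Suc n)))))"
      by (intro mult_left_mono card_layer_le S) simp
    also have "\<dots> = index ^ (\<Sum>i = 2..Suc (Suc n). size S ^ i) * card (orb (lower_central G (Suc (Suc n))))"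
      by (simp add: power_add mult_ac)
    finally show ?case .
  qed simp
  from this[of j] have "card (orb (lower_central G 1)) \<le> index ^ (\<Sum>i = 2..Suc j. size S ^ i)"
    by (simp add: nil orb_def)
  then have "index * card (orb (lower_central G 1)) \<le> index * index ^ (\<Sum>i = 2..Suc j. size S ^ i)"
    by (rule mult_left_mono) simp
  with card_E_le_index have "card E \<le> index * index ^ (\<Sum>i = 2..Suc j. size S ^ i)"
    by (rule order_trans)
  then show ?thesis by (simp only: power_add power_one_right)
qed

lemma transitive_quotient: "transitive_quotient G E \<phi> K \<omega>"
proof (intro transitive_quotient.intro abelian_quotient.intro abelian_quotient_axioms.intro
    transitive_quotient_axioms.intro)
  show "transitive_action G E \<phi>" by (rule transitive_action_axioms)
  show "group G" by (rule is_group)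
  show "\<exists>n>0. g [^] (n::nat) \<in> K" if "g \<in> carrier G" for g
    using pow_index_in_K[OF that] index_pos by blast
qed (use K_subgroup K_commutators stabilizer_K base fin_E in auto)

lemma action_gap_le_card:
  assumes S: "symmetric_mset G S" "generate G (set_mset S) = carrier G" "0 < size S"
    and nil: "lower_central G (Suc j) = {\<one>}" and E2: "2 \<le> card E"
  shows "action_gap \<phi> E S \<le> 2"
    and "2 \<le> size S \<Longrightarrow> \<exists>m\<ge>2. card E \<le> m ^ (1 + (\<Sum>i = 2..Suc j. size S ^ i)) \<and>
           action_gap \<phi> E S \<le> 5 * real m powr (- 2 / real (size S))"
proof -
  interpret A: transitive_quotient G E \<phi> K \<omega> by (rule transitive_quotient)
  have card: "card E \<le> index ^ (1 + (\<Sum>i = 2..Suc j. size S ^ i))"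
    using S(1,2) nil by (rule card_E_le_index_power)
  \<comment> \<open>If \<open>index\<close> were 1, the cardinality bound would leave only one
    point.\<close>
  have m: "2 \<le> index"
  proof (rule ccontr)
    assume "\<not> 2 \<le> index"
    then have "index = 1" using index_pos by linarith
    then show False using card E2 by simp
  qed
  have SG: "set_mset S \<subseteq> carrier G" using S(1) by (simp add: symmetric_mset_def)
  have KG: "K \<subseteq> carrier G" by (rule subgroup.subset[OF K_subgroup])
  have "generate G (set_mset S) \<subseteq> generate G (K \<union> set_mset S)" by (intro mono_generate) auto
  then have gen: "generate G (K \<union> set_mset S) = carrier G"
    using S(2) generate_incl[of "K \<union> set_mset S"] KG SG by auto
  have "finite A.dual \<and> finite ((\<lambda>g. g <# K) ` carrier G) \<and>
      card ((\<lambda>g. g <# K) ` carrier G) \<le> card A.dual"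
    using card_chars_ge[OF K_subgroup K_commutators finite_set_mset SG] A.torsion SG
    unfolding gen by blast
  then have "finite A.dual" "index \<le> card A.dual" by (auto simp: index_def)
  from A.action_gap_le_index[OF this(1) m this(2) S(1,3)]
  show "action_gap \<phi> E S \<le> 2"
    and "2 \<le> size S \<Longrightarrow> \<exists>m\<ge>2. card E \<le> m ^ (1 + (\<Sum>i = 2..Suc j. size S ^ i)) \<and>
           action_gap \<phi> E S \<le> 5 * real m powr (- 2 / real (size S))"
    using m card by blast+
qed

end

text \<open>A geometric sum with its linear term removed: the product of k - 1 and 1 + k^2 + ... +
  k^c is k^(c+1) - k^2 + k - 1.\<close>

lemma gap_exponent_eq:
  assumes "2 \<le> k"
  shows "gap_exponent k (Suc j) = 2 / (real k * (1 + (\<Sum>i = 2..Suc j. real k ^ i)))"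
proof -
  have sum: "(real k - 1) * (1 + (\<Sum>i = 2..Suc j. real k ^ i)) = real k ^ (Suc j + 1) - real k ^ 2 + real k - 1"
  proof (induction j)
    case (Suc j)
    have "(real k - 1) * (1 + (\<Sum>i = 2..Suc (Suc j). real k ^ i)) =
        (real k - 1) * (1 + (\<Sum>i = 2..Suc j. real k ^ i)) + (real k - 1) * real k ^ Suc (Suc j)"
      by (simp add: distrib_left)
    then show ?case unfolding Suc.IH by (simp add: algebra_simps)
  qed (simp add: power2_eq_square)
  define F where "F = 1 + (\<Sum>i = 2..Suc j. real k ^ i)"
  define a where "a = real k - 1"
  have "a \<noteq> 0" using assms by (simp add: a_def)
  have "2 * a / (real k * (a * F)) = (a * 2) / (a * (real k * F))" by (simp only: ac_simps)
  also have "\<dots> = 2 / (real k * F)" using \<open>a \<noteq> 0\<close> by (rule mult_divide_mult_cancel_left)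
  finally have "2 * (real k - 1) / (real k * ((real k - 1) * F)) = 2 / (real k * F)"
    by (simp only: a_def)
  then show ?thesis unfolding gap_exponent_def sum[symmetric] F_def .
qed

text \<open>The second factor d of the denominator is at most k^(c+1), and k \<le> 2 (k - 1) gives d
  \<le> 2 (k - 1) k^c.\<close>

lemma gap_exponent_ge:
  assumes k: "2 \<le> k" and c: "1 \<le> c"
  shows "real k powr (- real c - 1) \<le> gap_exponent k c"
proof -
  define x where "x = real k"
  have x: "2 \<le> x" using k by (simp add: x_def)
  define d where "d = x ^ (c + 1) - x ^ 2 + x - 1"
  have "x ^ 2 \<le> x ^ (c + 1)" using c x by (intro power_increasing) auto
  then have d: "0 < d" using x unfolding d_def by linarith
  have "x ^ 2 \<ge> x" using x by (simp add: power2_eq_square)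
  then have "d \<le> x ^ (c + 1)" using x by (simp add: d_def)
  also have "\<dots> \<le> 2 * (x - 1) * x ^ c" using x by (simp add: mult_right_mono)
  finally have "1 / x ^ (c + 1) \<le> 2 * (x - 1) / (x * d)"
    using x d by (simp add: field_simps)
  moreover have "x powr (- real c - 1) = 1 / x ^ (c + 1)"
  proof -
    have "- real c - 1 = - real (c + 1)" by simp
    then have "x powr (- real c - 1) = 1 / x powr real (c + 1)"
      by (simp only: powr_minus_divide)
    also have "x powr real (c + 1) = x ^ (c + 1)" using x by (intro powr_realpow) simp
    finally show ?thesis .
  qed
  ultimately show ?thesis by (simp add: gap_exponent_def d_def x_def)
qed

text \<open>If F is the exponent in N \<le> m^F, the number f =
  \<open>gap_exponent k (Suc j)\<close> satisfies F f = 2 / k, so N^f \<le> m^(2/k).\<close>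

lemma powr_le_powr_gap_exponent:
  assumes k: "2 \<le> k" and m: "2 \<le> m" and N: "1 \<le> N" "N \<le> m ^ (1 + (\<Sum>i = 2..Suc j. k ^ i))"
  shows "real m powr (- 2 / real k) \<le> real N powr (- gap_exponent k (Suc j))"
proof -
  define F where "F = 1 + (\<Sum>i = 2..Suc j. k ^ i)"
  define f where "f = gap_exponent k (Suc j)"
  have f: "f = 2 / (real k * real F)" using gap_exponent_eq[OF k] by (simp add: f_def F_def)
  have F: "0 < F" by (simp add: F_def)
  have "real N \<le> real m ^ F" using N(2) unfolding F_def[symmetric] by (metis of_nat_mono of_nat_power)
  then have "real N powr f \<le> (real m ^ F) powr f"
    using N(1) by (intro powr_mono2) (simp_all add: f)
  also have "\<dots> = real m powr (real F * f)"
    using m by (simp add: powr_realpow[symmetric] powr_powr)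
  also have "real F * f = 2 / real k" using F by (simp add: f)
  finally have le: "real N powr f \<le> real m powr (2 / real k)" .
  have "real m powr (- 2 / real k) = 1 / real m powr (2 / real k)" by (simp add: powr_minus_divide)
  also have "\<dots> \<le> 1 / real N powr f" using le N(1) m by (intro divide_left_mono mult_pos_pos) auto
  also have "\<dots> = real N powr (- f)" by (simp add: powr_minus_divide)
  finally show ?thesis by (simp add: f_def)
qed

section \<open>The upper bound for the gap\<close>

text \<open>This serves to replace the group by the subgroup generated by \<open>S\<close>. The
  class may drop on the way, so the estimates use only that the term with index c is
  trivial.\<close>

lemma (in group) lower_central_subgroup_mono:
  assumes "subgroup P G"
  shows "lower_central (G\<lparr>carrier := P\<rparr>) n \<subseteq> lower_central G n"
proof (induction n)
  case 0
  then show ?case using subgroup.subset[OF assms] by simp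
next
  case (Suc n)
  let ?M = "G\<lparr>carrier := P\<rparr>"
  interpret M: group ?M using assms by (rule subgroup_imp_group)
  let ?X = "{x \<otimes>\<^bsub>?M\<^esub> y \<otimes>\<^bsub>?M\<^esub> inv\<^bsub>?M\<^esub> x \<otimes>\<^bsub>?M\<^esub> inv\<^bsub>?M\<^esub> y |x y. x \<in> lower_central ?M n \<and> y \<in> carrier ?M}"
  have P: "lower_central ?M n \<subseteq> P" using M.lower_central_in_carrier[of n] by simp
  have X: "\<exists>x y. z = x \<otimes> y \<otimes> inv x \<otimes> inv y \<and> x \<in> lower_central ?M n \<and> x \<in> P \<and> y \<in> P" if z: "z \<in> ?X" for z
  proof -
    obtain x y where xy: "z = x \<otimes>\<^bsub>?M\<^esub> y \<otimes>\<^bsub>?M\<^esub> inv\<^bsub>?M\<^esub> x \<otimes>\<^bsub>?M\<^esub> inv\<^bsub>?M\<^esub> y"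
        "x \<in> lower_central ?M n" "y \<in> carrier ?M"
      using z by blast
    then have "x \<in> P" "y \<in> P" using P by auto
    then have "z = x \<otimes> y \<otimes> inv x \<otimes> inv y" using xy(1) m_inv_consistent[OF assms] by simp
    then show ?thesis using xy(2) \<open>x \<in> P\<close> \<open>y \<in> P\<close> by blast
  qed
  have XP: "?X \<subseteq> P"
  proof
    fix z assume "z \<in> ?X"
    then obtain x y where "z = x \<otimes> y \<otimes> inv x \<otimes> inv y" "x \<in> P" "y \<in> P" using X by blast
    then show "z \<in> P"
      using subgroup.m_closed[OF assms] subgroup.m_inv_closed[OF assms] by blast
  qed
  have "?X \<subseteq> {x \<otimes> y \<otimes> inv x \<otimes> inv y |x y. x \<in> lower_central G n \<and> y \<in> carrier G}"
  proof
    fix z assume "z \<in> ?X"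
    then obtain x y where "z = x \<otimes> y \<otimes> inv x \<otimes> inv y" "x \<in> lower_central ?M n" "y \<in> P" using X by blast
    then show "z \<in> {x \<otimes> y \<otimes> inv x \<otimes> inv y |x y. x \<in> lower_central G n \<and> y \<in> carrier G}"
      using Suc.IH subgroup.subset[OF assms] by blast
  qed
  then show ?case
    unfolding lower_central.simps generate_consistent[OF XP assms] by (rule mono_generate)
qed

lemma (in group_action) restrict_to_subgroup:
  assumes "subgroup P G"
  shows "group_action (G\<lparr>carrier := P\<rparr>) E \<phi>"
proof -
  interpret gh: group_hom G "BijGroup E" \<phi> by (rule group_hom)
  have "\<phi> \<in> hom (G\<lparr>carrier := P\<rparr>) (BijGroup E)"
    using gh.hom_closed gh.hom_mult subgroup.mem_carrier[OF assms] by (intro homI) simp_all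
  then show ?thesis
    using gh.G.subgroup_imp_group[OF assms] gh.H.group_axioms
    by (intro group_action.intro group_hom.intro group_hom_axioms.intro)
qed

text \<open>The constants and the indicator function of the invariant set \<open>Y\<close> are
  independent, and averaging fixes both.\<close>

lemma (in group_action) action_gap_le_zero:
  assumes fin: "finite E" and S: "set_mset S \<subseteq> carrier G" "0 < size S"
    and Y: "\<And>s x. s \<in># S \<Longrightarrow> x \<in> E \<Longrightarrow> \<phi> s x \<in> Y \<longleftrightarrow> x \<in> Y"
    and xy: "x \<in> E" "x \<in> Y" "y \<in> E" "y \<notin> Y"
  shows "action_gap \<phi> E S \<le> 0"
proof -
  have "action_gap \<phi> E S \<le> 1 - min 1 1"
  proof (rule action_gap_le[where u = "\<lambda>_. 1" and v = "\<lambda>x. if x \<in> Y then 1 else 0" and x = x and y = y])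
    fix x assume x: "x \<in> E"
    have "(\<Sum>s\<in>#S. if \<phi> s x \<in> Y then 1 else 0) = (\<Sum>s\<in>#S. if x \<in> Y then 1 else (0::real))"
      using Y[OF _ x] by (intro arg_cong[where f = sum_mset] image_mset_cong) simp
    then show "1 / real (size S) * (\<Sum>s\<in>#S. if \<phi> s x \<in> Y then 1 else 0) = 1 * (if x \<in> Y then 1 else 0)"
      using S(2) by (simp add: nonempty_has_size)
  qed (use fin S xy in \<open>simp_all add: nonempty_has_size\<close>)
  then show ?thesis by simp
qed

text \<open>With 1 / 0 = 0 the averaging operator of the empty multiset is zero, so all functions
  belong to the eigenvalue 0.\<close>

lemma (in group_action) action_gap_empty_le_one:
  assumes fin: "finite E" and xy: "x \<in> E" "y \<in> E" "x \<noteq> y"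
  shows "action_gap \<phi> E {#} \<le> 1"
proof -
  have "action_gap \<phi> E {#} \<le> 1 - min 0 0"
    by (rule action_gap_le[where u = "\<lambda>_. 1" and v = "\<lambda>z. if z = x then 1 else 0" and x = x and y = y])
      (use fin xy in simp_all)
  then show ?thesis by simp
qed

text \<open>If the subgroup generated by \<open>S\<close> has several orbits, one of them is an
  invariant set and the gap is at most 0. If it is transitive, it takes the place of the group, and
  the estimates for a generating \<open>S\<close> apply.\<close>

lemma action_gap_upper_bound:
  fixes G :: "('g, 'm) monoid_scheme" and \<Omega> :: "'a set"
  assumes nil: "lower_central G (Suc j) = {\<one>\<^bsub>G\<^esub>}" and trans: "transitive_action G \<Omega> \<phi>"
    and fin: "finite \<Omega>" and S: "symmetric_mset G S"
  shows "action_gap \<phi> \<Omega> S \<le> 5 * real (card \<Omega>) powr (- gap_exponent (size S) (Suc j))"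
proof (cases "2 \<le> card \<Omega>")
  case False
  then have "action_gap \<phi> \<Omega> S = 0"
    by (simp add: action_gap_def spectral_gap_def schreier_graph_def)
  then show ?thesis by simp
next
  case two: True
  interpret transitive_action G \<Omega> \<phi> by (rule trans)
  interpret group G using group_hom by (rule group_hom.axioms(1))
  obtain \<omega> where \<omega>: "\<omega> \<in> \<Omega>" using two by fastforce
  have SG: "set_mset S \<subseteq> carrier G" using S by (simp add: symmetric_mset_def)
  define P where "P = generate G (set_mset S)"
  define M where "M = G\<lparr>carrier := P\<rparr>"
  have P: "subgroup P G" unfolding P_def using SG by (rule generate_is_subgroup)
  have SP: "set_mset S \<subseteq> P" by (auto simp: P_def intro: generate.incl)
  have nonneg: "0 \<le> 5 * real (card \<Omega>) powr (- gap_exponent (size S) (Suc j))" by simp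
  consider "size S = 0" | "0 < size S" "\<exists>y\<in>\<Omega>. y \<notin> orbit M \<phi> \<omega>"
    | "0 < size S" "\<Omega> \<subseteq> orbit M \<phi> \<omega>" by blast
  then show ?thesis
  proof cases
    case 1
    obtain y where "y \<in> \<Omega>" "y \<noteq> \<omega>"
    proof -
      have "\<not> \<Omega> \<subseteq> {\<omega>}" using two card_mono[of "{\<omega>}" \<Omega>] by auto
      then show ?thesis using that by blast
    qed
    then have "action_gap \<phi> \<Omega> S \<le> 1" using 1 action_gap_empty_le_one[OF fin \<omega>] by auto
    \<comment> \<open>For the empty multiset the exponent is 0 by the convention for division, so
      the right-hand side is 5.\<close>
    also have "1 \<le> 5 * real (card \<Omega>) powr (- gap_exponent (size S) (Suc j))"
      using 1 two by (simp add: gap_exponent_def)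
    finally show ?thesis .
  next
    case 2
    then obtain y where y: "y \<in> \<Omega>" "y \<notin> orbit M \<phi> \<omega>" by blast
    interpret M: group_action M \<Omega> \<phi> unfolding M_def by (rule restrict_to_subgroup[OF P])
    have "\<phi> s x \<in> orbit M \<phi> \<omega> \<longleftrightarrow> x \<in> orbit M \<phi> \<omega>" if s: "s \<in># S" and x: "x \<in> \<Omega>" for s x
    proof -
      have sM: "s \<in> carrier M" using s SP by (auto simp: M_def)
      have sx: "\<phi> s x \<in> \<Omega>" using M.element_image[OF sM x refl] .
      have "\<phi> s x \<in> orbit M \<phi> x" using sM by (auto simp: orbit_def)
      then show ?thesis
        using M.orbit_trans[OF \<omega> x sx] M.orbit_trans[OF \<omega> sx x] M.orbit_sym[OF x sx] by blast
    qed
    then have "action_gap \<phi> \<Omega> S \<le> 0"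
      using action_gap_le_zero[OF fin SG 2(1) _ \<omega> M.orbit_refl[OF \<omega>] y] by blast
    then show ?thesis using nonneg by linarith
  next
    case 3
    interpret M: group_action M \<Omega> \<phi> unfolding M_def by (rule restrict_to_subgroup[OF P])
    interpret M: pointed_action M \<Omega> \<phi> \<omega>
    proof
      show "\<exists>g\<in>carrier M. \<phi> g x = y" if "x \<in> \<Omega>" "y \<in> \<Omega>" for x y
      proof -
        have "y \<in> orbit M \<phi> x"
          using 3(2) M.orbit_trans[OF that(1) \<omega> that(2)] M.orbit_sym[OF \<omega> that(1)] that by blast
        then show ?thesis by (auto simp: orbit_def)
      qed
    qed (use \<omega> fin in auto)
    have SM: "symmetric_mset M S"
      using S SP subgroup.subset[OF P] m_inv_consistent[OF P]
      by (auto simp: symmetric_mset_def M_def)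
    have genM: "generate M (set_mset S) = carrier M"
      unfolding M_def using generate_consistent[OF SP P] by (simp add: P_def)
    have nilM: "lower_central M (Suc j) = {\<one>\<^bsub>M\<^esub>}"
      using lower_central_subgroup_mono[OF P, of "Suc j"] nil
        subgroup.one_closed[OF M.lower_central_subgroup[of "Suc j"]]
      unfolding M_def by auto
    note gap = M.action_gap_le_card[OF SM genM 3(1) nilM two]
    show ?thesis
    proof (cases "2 \<le> size S")
      case True
      obtain m where m: "2 \<le> m" "card \<Omega> \<le> m ^ (1 + (\<Sum>i = 2..Suc j. size S ^ i))"
        "action_gap \<phi> \<Omega> S \<le> 5 * real m powr (- 2 / real (size S))"
        using gap(2)[OF True] by blast
      have "real m powr (- 2 / real (size S)) \<le> real (card \<Omega>) powr (- gap_exponent (size S) (Suc j))"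
        using True m(1,2) two by (intro powr_le_powr_gap_exponent) auto
      then show ?thesis using m(3) by linarith
    next
      case False
      \<comment> \<open>The denominator of the exponent vanishes, so the bound to be shown is 5, and
        the trivial bound 2 is enough.\<close>
      then have "size S = 1" using 3(1) by simp
      then have "gap_exponent (size S) (Suc j) = 0" by (simp add: gap_exponent_def)
      then have "real (card \<Omega>) powr (- gap_exponent (size S) (Suc j)) = 1" using two by simp
      then show ?thesis using gap(1) by simp
    qed
  qed
qed

theorem theorem1p4:
  fixes G :: "('g, 'm) monoid_scheme"
    and \<Omega> :: "'a set"
    and \<phi> :: "'g \<Rightarrow> 'a \<Rightarrow> 'a"
    and S :: "'g multiset"
    and c :: nat
  assumes "nilpotent_of_class G c"
    and "c \<ge> 1"
    and "transitive_action G \<Omega> \<phi>"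
    and "finite \<Omega>"
    and "symmetric_mset G S"
  shows "action_gap \<phi> \<Omega> S \<le> 5 * real (card \<Omega>) powr (- gap_exponent (size S) c)
       \<and> (size S \<ge> 2 \<longrightarrow> gap_exponent (size S) c \<ge> real (size S) powr (- real c - 1))"
proof -
  obtain j where c: "c = Suc j" using assms(2) by (cases c) auto
  have "lower_central G (Suc j) = {\<one>\<^bsub>G\<^esub>}"
    using assms(1) by (simp add: nilpotent_of_class_def c)
  then show ?thesis
    using action_gap_upper_bound[OF _ assms(3-5)] gap_exponent_ge[OF _ assms(2)] by (auto simp: c)
qed

end
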